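(* Let $\kappa_1,\ldots,\kappa_d\ge0$, $\mu\ge0$ and $\nu>0$, and let $U_{\kappa,\mu,\nu}(x)=\prod_{i=1}^dx_i^{\kappa_i-1/2}\,|x|^{\nu}(1-|x|)^{\mu-1/2}$ on $\mathbb{T}^d$. Then for all $n\ge0$ and $x,y\in\mathbb{T}^d$, $$ P_n(U_{\kappa,\mu,\nu};x,y)=a_{\kappa,\mu,\nu}\int_{-1}^1\int_0^1\int_{-1}^1\int_{[-1,1]^d}\Xi_n^{\lambda_{\kappa,\mu,\nu}}\big(2\zeta(x,y,u,v,s,t)^2-1\big)\prod_{i=1}^d(1-s_i^2)^{\kappa_i-1}\,ds\,(1-t^2)^{\mu-1}dt\;u^{\nu-1}(1-u)^{\gamma_\kappa+\frac{d-2}{2}}du\,(1-v^2)^{\nu-\frac12}dv, $$ where $a_{\kappa,\mu,\nu}$ is the constant such that the right-hand side equals $1$ when $n=0$, and $$ \zeta(x,y,u,v,s,t)=\sqrt{|x|}\sqrt{|y|}\,uv+(1-u)\sum_{i=1}^d\sqrt{x_iy_i}\,s_i+\sqrt{1-|x|}\sqrt{1-|y|}\;t . $$ When $\mu$ or any $\kappa_i$ is $0$, the formula holds under the limit $$\lim_{a\to0+}c_a\int_{-1}^1f(t)(1-t^2)^{a-1}dt=\tfrac12[f(1)+f(-1)],\qquad c_a=\frac{\Gamma(a+1/2)}{\sqrt\pi\,\Gamma(a)},$$ applied to the corresponding normalized integral.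
   Context: Let $d\ge2$, $|x|=x_1+\cdots+x_d$, and $\mathbb{T}^d=\{x\in\mathbb{R}^d:x_1\ge0,\ldots,x_d\ge0,\ |x|\le1\}$. Here $\gamma_\kappa=\kappa_1+\cdots+\kappa_d$ and $\lambda_{\kappa,\mu,\nu}=\nu+\mu+\gamma_\kappa+\frac{d-1}{2}$. The inner product on $\mathbb{T}^d$ is $\langle f,g\rangle^T_{\kappa,\mu,\nu}=b_{\kappa,\mu,\nu}\int_{\mathbb{T}^d}f(x)g(x)U_{\kappa,\mu,\nu}(x)\,dx$, with $b_{\kappa,\mu,\nu}$ such that $\langle1,1\rangle^T_{\kappa,\mu,\nu}=1$. $\mathcal{V}_n^d(U_{\kappa,\mu,\nu},\mathbb{T}^d)$ is the space of polynomials of degree $n$ in $d$ variables orthogonal to all polynomials of degree at most $n-1$ (together with $0$), and $P_n(U_{\kappa,\mu,\nu};x,y)=\sum_kQ_k(x)Q_k(y)$, for any orthonormal basis $\{Q_k\}$ of this space, is its reproducing kernel. For $\lambda>0$, $\Xi_n^\lambda$ is the polynomial of degree $n$ determined by $$\Xi_n^\lambda(2t^2-1)=\frac{2n+\lambda}{\lambda}C_{2n}^\lambda(t),$$ where $C_{2n}^\lambda$ is the Gegenbauer polynomial; equivalently $\Xi_n^\lambda(s)=p_n^{(\lambda-\frac12,-\frac12)}(1)\,p_n^{(\lambda-\frac12,-\frac12)}(s)$, where $p_n^{(a,b)}$ is the Jacobi polynomial of degree $n$ that is orthonormal with respect to the weight $(1-s)^a(1+s)^b$ on $[-1,1]$ normalized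 to have total mass $1$. *)

theory Defs
  imports "HOL-Analysis.Analysis" "HOL-Computational_Algebra.Polynomial"
begin

section \<open>Gegenbauer weights, including the limiting parameter\<close>

definition gegen_const :: "real \<Rightarrow> real" where
  "gegen_const a = Gamma (a + 1/2) / (sqrt pi * Gamma a)"

text \<open>For \<open>a > 0\<close> this is the normalized weight \<open>c\<^sub>a (1 - t\<^sup>2)\<^bsup>a - 1\<^esup> dt\<close> on \<open>[-1, 1]\<close>.
  For \<open>a = 0\<close> it is the weak limit of these measures as \<open>a\<close> tends to \<open>0\<close> from above, that is
  mass \<open>1/2\<close> at each of \<open>1\<close> and \<open>-1\<close>; see \<open>gegen_measure_limit\<close> below.\<close>

definition gegen_measure :: "real \<Rightarrow> real measure" where
  "gegen_measure a =
     (if a = 0 then distr (uniform_count_measure {-1, 1}) borel (\<lambda>t. t)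
      else density lborel
        (\<lambda>t. ennreal (indicator {-1..1} t * (gegen_const a * (1 - t\<^sup>2) powr (a - 1)))))"

lemma sets_gegen_measure [measurable_cong, simp]: "sets (gegen_measure a) = sets borel"
  by (simp add: gegen_measure_def)

lemma Gamma_real_duplication:
  fixes a :: real
  assumes "a > 0"
  shows "Gamma a * Gamma (a + 1/2) = 2 powr (1 - 2 * a) * sqrt pi * Gamma (2 * a)"
proof -
  have "complex_of_real a \<notin> \<int>\<^sub>\<le>\<^sub>0" "complex_of_real (a + 1/2) \<notin> \<int>\<^sub>\<le>\<^sub>0"
    using assms by (auto simp only: of_real_in_nonpos_Ints_iff elim!: nonpos_Ints_cases)
  hence *: "Gamma (complex_of_real a) * Gamma (complex_of_real a + 1/2) =
    exp ((1 - 2 * complex_of_real a) * of_real (ln 2)) * of_real (sqrt pi) * Gamma (2 * complex_of_real a)"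
    by (intro Gamma_legendre_duplication) simp_all
  have "complex_of_real (Gamma a * Gamma (a + 1/2)) =
    Gamma (complex_of_real a) * Gamma (complex_of_real a + 1/2)"
    by (simp flip: Gamma_complex_of_real)
  also have "\<dots> = complex_of_real (exp ((1 - 2 * a) * ln 2) * sqrt pi * Gamma (2 * a))"
    unfolding * by (simp flip: Gamma_complex_of_real exp_of_real)
  finally have "Gamma a * Gamma (a + 1/2) = exp ((1 - 2 * a) * ln 2) * sqrt pi * Gamma (2 * a)"
    by (simp only: of_real_eq_iff)
  thus ?thesis by (simp add: powr_def)
qed

lemma gegen_const_pos: "a > 0 \<Longrightarrow> gegen_const a > 0"
  by (simp add: gegen_const_def Gamma_real_pos)

lemma has_integral_gegen:
  assumes "a > 0"
  shows "((\<lambda>t. (1 - t\<^sup>2) powr (a - 1)) has_integral (1 / gegen_const a)) {-1..1}"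
proof -
  have "((\<lambda>t. t powr (a - 1) * (1 - t) powr (a - 1)) has_integral Beta a a) (cbox 0 (1::real))"
    using has_integral_Beta_real[OF assms assms] by simp
  from has_integral_affinity'[OF this, of "1/2" "1/2"]
  have "((\<lambda>t::real. (t/2 + 1/2) powr (a - 1) * (1 - (t/2 + 1/2)) powr (a - 1))
      has_integral 2 * Beta a a) {-1..1}"
    by (simp add: mult.commute)
  hence "((\<lambda>t::real. 4 powr (a - 1) * ((t/2 + 1/2) powr (a - 1) * (1 - (t/2 + 1/2)) powr (a - 1)))
      has_integral 4 powr (a - 1) * (2 * Beta a a)) {-1..1}"
    by (rule has_integral_mult_right)
  also have "?this \<longleftrightarrow> ((\<lambda>t. (1 - t\<^sup>2) powr (a - 1)) has_integral
      4 powr (a - 1) * (2 * Beta a a)) {-1..1}"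
  proof (rule has_integral_cong)
    fix t :: real assume "t \<in> {-1..1}"
    hence "4 powr (a - 1) * ((t/2 + 1/2) powr (a - 1) * (1 - (t/2 + 1/2)) powr (a - 1)) =
       (4 * ((t/2 + 1/2) * (1 - (t/2 + 1/2)))) powr (a - 1)"
      by (simp only: powr_mult)
    also have "4 * ((t/2 + 1/2) * (1 - (t/2 + 1/2))) = 1 - t\<^sup>2"
      by (simp add: field_simps power2_eq_square)
    finally show "4 powr (a - 1) * ((t/2 + 1/2) powr (a - 1) * (1 - (t/2 + 1/2)) powr (a - 1)) =
      (1 - t\<^sup>2) powr (a - 1)" .
  qed
  also have "4 powr (a - 1) * (2 * Beta a a) = 1 / gegen_const a"
  proof -
    have "4 powr (a - 1) = (2 powr 2) powr (a - 1)" by simp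
    also have "\<dots> = 2 powr (2 * a - 2)" by (subst powr_powr) (simp add: algebra_simps)
    finally have p: "4 powr (a - 1) * 2 = 2 powr (2 * a - 1)"
      by (simp add: powr_diff)
    have g: "Gamma a > 0" "Gamma (a + 1/2) > 0" "Gamma (2 * a) > 0"
      using assms by (auto intro!: Gamma_real_pos)
    have q: "2 powr (2 * a - 1) * 2 powr (1 - 2 * a) = (1::real)"
      by (simp flip: powr_add)
    have "4 powr (a - 1) * (2 * Beta a a) = 2 powr (2 * a - 1) * (Gamma a * Gamma a / Gamma (2 * a))"
      by (simp add: Beta_def p[symmetric])
    also have "Gamma a = 2 powr (1 - 2 * a) * sqrt pi * Gamma (2 * a) / Gamma (a + 1/2)"
      using Gamma_real_duplication[OF assms] g by (simp add: field_simps)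
    hence "Gamma a * Gamma a / Gamma (2 * a) = 2 powr (1 - 2 * a) * sqrt pi / Gamma (a + 1/2) * Gamma a"
      using g by (simp add: field_simps)
    hence "2 powr (2 * a - 1) * (Gamma a * Gamma a / Gamma (2 * a)) =
      (2 powr (2 * a - 1) * 2 powr (1 - 2 * a)) * (sqrt pi / Gamma (a + 1/2) * Gamma a)"
      by simp
    finally show ?thesis unfolding q by (simp add: gegen_const_def)
  qed
  finally show ?thesis .
qed

lemma gegen_weight:
  assumes "a > 0"
  shows "integrable lborel (\<lambda>t. indicator {-1..1} t * (1 - t\<^sup>2) powr (a - 1))"
    and "(LINT t|lborel. indicator {-1..1} t * (1 - t\<^sup>2) powr (a - 1)) = 1 / gegen_const a"
proof -
  have nn: "(\<integral>\<^sup>+ t. ennreal (indicator {-1..1} t * (1 - t\<^sup>2) powr (a - 1)) \<partial>lborel) =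
      ennreal (1 / gegen_const a)"
    by (rule nn_integral_has_integral_lebesgue[OF _ has_integral_gegen[OF assms]]) simp
  show i: "integrable lborel (\<lambda>t. indicator {-1..1} t * (1 - t\<^sup>2) powr (a - 1))"
    by (rule integrableI_nonneg) (use nn in auto)
  show "(LINT t|lborel. indicator {-1..1} t * (1 - t\<^sup>2) powr (a - 1)) = 1 / gegen_const a"
    by (subst integral_eq_nn_integral)
       (use nn gegen_const_pos[OF assms] in \<open>auto simp: enn2real_ennreal\<close>)
qed

lemma integral_gegen_measure_0:
  "(LINT t|gegen_measure 0. f t) = (f 1 + f (-1)) / (2 :: real)"
  if "f \<in> borel_measurable borel"
proof -
  have "(\<lambda>t. t) \<in> uniform_count_measure {-1, 1} \<rightarrow>\<^sub>M (borel :: real measure)"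
    by (auto simp: measurable_def sets_uniform_count_measure space_uniform_count_measure)
  from integral_distr[OF this that] show ?thesis
    by (simp add: gegen_measure_def integral_uniform_count_measure)
qed

lemma integral_gegen_measure_pos:
  fixes f :: "real \<Rightarrow> real"
  assumes "a > 0" "f \<in> borel_measurable borel"
  shows "(LINT t|gegen_measure a. f t) =
    gegen_const a * (LINT t:{-1..1}|lborel. f t * (1 - t\<^sup>2) powr (a - 1))"
proof -
  have "(LINT t|gegen_measure a. f t) =
    (LINT t|lborel. indicator {-1..1} t * (gegen_const a * (1 - t\<^sup>2) powr (a - 1)) * f t)"
    using assms gegen_const_pos[of a] unfolding gegen_measure_def
    by (simp add: integral_density)
  also have "\<dots> = (LINT t|lborel. gegen_const a *
      (indicator {-1..1} t * (f t * (1 - t\<^sup>2) powr (a - 1))))"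
    by (simp add: mult_ac)
  finally show ?thesis by (simp add: set_lebesgue_integral_def)
qed

lemma gegen_measure_limit:
  fixes f :: "real \<Rightarrow> real"
  assumes cont: "continuous_on {-1..1} f"
  shows "((\<lambda>a. gegen_const a * (LINT t:{-1..1}|lborel. f t * (1 - t\<^sup>2) powr (a - 1)))
    \<longlongrightarrow> (f 1 + f (-1)) / 2) (at_right 0)"
proof -
  define w where "w = (\<lambda>a t::real. indicator {-1..1} t * (1 - t\<^sup>2) powr (a - 1) :: real)"
  define g where "g = (\<lambda>t. (f t + f (-t)) / 2)"
  have contg: "continuous_on {-1..1} g"
    unfolding g_def
    by (intro continuous_intros cont continuous_on_compose2[OF cont]) auto
  obtain M where M: "\<And>t. t \<in> {-1..1} \<Longrightarrow> \<bar>f t\<bar> \<le> M"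
    using compact_imp_bounded[OF compact_continuous_image[OF cont compact_Icc]]
    by (fastforce simp: bounded_iff)
  have Mg: "\<bar>g t\<bar> \<le> M" if "t \<in> {-1..1}" for t
    using M[of t] M[of "-t"] that by (auto simp: g_def)
  have M0: "M \<ge> 0" using M[of 0] by simp
  have wnn: "w a t \<ge> 0" for a t by (simp add: w_def)
  have int: "integrable lborel (\<lambda>t. h t * w a t)"
    if a: "a > 0" and h: "continuous_on {-1..1} h" "\<And>t. t \<in> {-1..1} \<Longrightarrow> \<bar>h t\<bar> \<le> M"
    for a and h :: "real \<Rightarrow> real"
  proof (rule Bochner_Integration.integrable_bound)
    show "integrable lborel (\<lambda>t. M * w a t)"
      using gegen_weight(1)[OF a] by (simp add: w_def)
    have "(\<lambda>t. indicator {-1..1} t *\<^sub>R h t) \<in> borel_measurable borel"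
      by (rule borel_measurable_continuous_on_indicator[OF _ h(1)]) simp
    hence "(\<lambda>t. (indicator {-1..1} t *\<^sub>R h t) * (1 - t\<^sup>2) powr (a - 1)) \<in> borel_measurable lborel"
      by simp
    thus "(\<lambda>t. h t * w a t) \<in> borel_measurable lborel"
      by (simp add: w_def mult_ac)
    show "AE t in lborel. norm (h t * w a t) \<le> norm (M * w a t)"
      using h(2) M0 by (intro AE_I2) (auto simp: w_def abs_mult indicator_def mult_right_mono)
  qed
  have sym: "(LINT t|lborel. f t * w a t) = (LINT t|lborel. g t * w a t)" if a: "a > 0" for a
  proof -
    have "(LINT t|lborel. f t * w a t) = (LINT t|lborel. f (-t) * w a (-t))"
      by (subst lborel_integral_real_affine[where c = "-1" and t = 0]) simp_all
    also have "\<dots> = (LINT t|lborel. f (-t) * w a t)"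
      by (intro Bochner_Integration.integral_cong) (auto simp: w_def indicator_def)
    finally have eq: "(LINT t|lborel. f t * w a t) = (LINT t|lborel. f (-t) * w a t)" .
    have "(LINT t|lborel. g t * w a t) = (LINT t|lborel. (1/2) * (f t * w a t) + (1/2) * (f (-t) * w a t))"
      by (intro Bochner_Integration.integral_cong) (auto simp: g_def field_simps)
    also have "\<dots> = (1/2) * (LINT t|lborel. f t * w a t) + (1/2) * (LINT t|lborel. f (-t) * w a t)"
      by (subst Bochner_Integration.integral_add)
         (auto intro!: int a cont M continuous_on_compose2[OF cont] continuous_intros)
    finally show ?thesis using eq by simp
  qed
  have c0: "(gegen_const \<longlongrightarrow> 0) (at_right 0)"
  proof -
    have "isCont (rGamma :: real \<Rightarrow> real) 0"
      by (rule DERIV_isCont[OF has_field_derivative_rGamma_real'])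
    hence r0: "((rGamma :: real \<Rightarrow> real) \<longlongrightarrow> rGamma 0) (at_right 0)"
      unfolding isCont_def by (rule tendsto_mono[OF at_le, rotated]) simp
    have "((\<lambda>a::real. Gamma (a + 1/2) / sqrt pi * rGamma a) \<longlongrightarrow> Gamma (0 + 1/2) / sqrt pi * rGamma 0)
      (at_right 0)"
      by (intro tendsto_mult tendsto_divide tendsto_Gamma tendsto_add r0 tendsto_const tendsto_ident_at)
         (auto elim!: nonpos_Ints_cases)
    hence "((\<lambda>a::real. Gamma (a + 1/2) / sqrt pi * rGamma a) \<longlongrightarrow> 0) (at_right 0)"
      by (simp only: rGamma_0 mult_zero_right)
    moreover have "(\<lambda>a::real. Gamma (a + 1/2) / sqrt pi * rGamma a) = gegen_const"
      by (intro ext) (simp only: gegen_const_def rGamma_inverse_Gamma divide_inverse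
          inverse_mult_distrib mult.assoc)
    ultimately show ?thesis by (simp only:)
  qed
  show ?thesis
  proof (rule tendstoI)
    fix e :: real assume e: "e > 0"
    have "\<forall>e>0. \<exists>d>0. \<forall>t\<in>{-1..1}. dist t 1 < d \<longrightarrow> dist (g t) (g 1) < e"
      using contg unfolding continuous_on_iff by (rule bspec) simp
    moreover have "e / 2 > 0" using e by simp
    ultimately have "\<exists>d>0. \<forall>t\<in>{-1..1}. dist t 1 < d \<longrightarrow> dist (g t) (g 1) < e / 2"
      by (elim allE impE)
    then obtain d0 where d0: "d0 > 0" "\<And>t. t \<in> {-1..1} \<Longrightarrow> dist t 1 < d0 \<Longrightarrow> \<bar>g t - g 1\<bar> < e / 2"
      unfolding dist_real_def[of "g _"] by blast
    define d where "d = min d0 1"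
    have d: "d > 0" "d \<le> 1" using d0 by (auto simp: d_def)
    define r where "r = 1 - (1 - d)\<^sup>2"
    have "(1 - d)\<^sup>2 < 1\<^sup>2" using d by (intro power_strict_mono) auto
    hence r: "r > 0" "r \<le> 1" by (auto simp: r_def)
    have geven: "g (-t) = g t" for t by (simp add: g_def add.commute)
    have near: "\<bar>g t - g 1\<bar> < e / 2" if t: "t \<in> {-1..1}" "\<bar>t\<bar> > 1 - d" for t
    proof -
      have "dist \<bar>t\<bar> 1 < d0" "\<bar>t\<bar> \<in> {-1..1}" using t by (auto simp: dist_real_def d_def)
      hence "\<bar>g \<bar>t\<bar> - g 1\<bar> < e / 2" by (intro d0)
      moreover have "g \<bar>t\<bar> = g t" by (simp add: abs_if geven)
      ultimately show ?thesis by simp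
    qed
    have "((\<lambda>a. gegen_const a * (4 * M / r)) \<longlongrightarrow> 0 * (4 * M / r)) (at_right 0)"
      by (intro tendsto_intros c0)
    hence "eventually (\<lambda>a. gegen_const a * (4 * M / r) < e / 2) (at_right 0)"
      using e by (intro order_tendstoD) auto
    moreover have "eventually (\<lambda>a::real. a < 1) (at_right 0)"
      by (rule order_tendstoD[OF tendsto_ident_at]) simp
    moreover have "eventually (\<lambda>a::real. a > 0) (at_right 0)"
      by (rule eventually_at_right_less)
    ultimately show "eventually (\<lambda>a. dist (gegen_const a * (LINT t:{-1..1}|lborel. f t * (1 - t\<^sup>2) powr (a - 1)))
      ((f 1 + f (-1)) / 2) < e) (at_right 0)"
    proof eventually_elim
      case (elim a)
      have c: "gegen_const a > 0" using elim gegen_const_pos by simp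
      have iw: "integrable lborel (w a)" "(LINT t|lborel. w a t) = 1 / gegen_const a"
        using gegen_weight[of a] elim by (auto simp: w_def)
      have ig: "integrable lborel (\<lambda>t. g t * w a t)"
        using elim contg Mg by (intro int) auto
      have bound: "\<bar>(g t - g 1) * w a t\<bar> \<le> e / 2 * w a t + 2 * M / r * indicator {-1..1} t" for t
      proof (cases "t \<in> {-1..1}")
        case True
        show ?thesis
        proof (cases "\<bar>t\<bar> > 1 - d")
          case near': True
          have "\<bar>g t - g 1\<bar> * w a t \<le> e / 2 * w a t"
            using near[OF True near'] wnn by (intro mult_right_mono) auto
          moreover have "2 * M / r * indicator {-1..1} t \<ge> 0" using M0 r by simp
          ultimately show ?thesis using wnn[of a t] by (simp add: abs_mult)
        next
          case False
          have "t\<^sup>2 \<le> (1 - d)\<^sup>2" using False d by (intro abs_le_square_iff[THEN iffD1]) auto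
          hence le: "r \<le> 1 - t\<^sup>2" by (simp add: r_def)
          have "w a t = (1 - t\<^sup>2) powr (a - 1)" using True by (simp add: w_def)
          also have "\<dots> \<le> r powr (a - 1)"
            using le r elim by (intro powr_mono2') auto
          also have "\<dots> \<le> r powr (-1)"
            using r elim by (intro powr_mono') auto
          also have "\<dots> = 1 / r" using r by (simp add: powr_minus divide_inverse)
          finally have "w a t \<le> 1 / r" .
          moreover have "\<bar>g t - g 1\<bar> \<le> 2 * M"
            using Mg[OF True] Mg[of 1] by auto
          ultimately have "\<bar>g t - g 1\<bar> * w a t \<le> 2 * M * (1 / r)"
            using wnn M0 by (intro mult_mono) auto
          moreover have "e / 2 * w a t \<ge> 0" using e wnn[of a t] by simp
          ultimately show ?thesis using True wnn[of a t] by (simp add: abs_mult)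
        qed
      qed (simp add: w_def)
      have idiff: "integrable lborel (\<lambda>t. (g t - g 1) * w a t)"
        using ig iw by (simp add: left_diff_distrib)
      have "(LINT t|lborel. (g t - g 1) * w a t) = (LINT t|lborel. g t * w a t) - g 1 / gegen_const a"
        using ig iw by (simp add: left_diff_distrib)
      hence "gegen_const a * (LINT t|lborel. (g t - g 1) * w a t) =
        gegen_const a * (LINT t|lborel. g t * w a t) - g 1"
        using c by (simp add: right_diff_distrib)
      hence eq: "dist (gegen_const a * (LINT t|lborel. g t * w a t)) (g 1) =
        gegen_const a * \<bar>LINT t|lborel. (g t - g 1) * w a t\<bar>"
        using c by (simp add: dist_real_def abs_mult flip: \<open>gegen_const a * (LINT t|lborel. (g t - g 1) * w a t) = _\<close>)
      have "\<bar>LINT t|lborel. (g t - g 1) * w a t\<bar> \<le> (LINT t|lborel. \<bar>(g t - g 1) * w a t\<bar>)"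
        by (rule integral_abs_bound)
      also have "\<dots> \<le> (LINT t|lborel. e / 2 * w a t + 2 * M / r * indicator {-1..1} t)"
        using bound idiff iw
        by (intro integral_mono) (auto intro!: Bochner_Integration.integrable_add integrable_mult_right)
      also have "\<dots> = e / 2 / gegen_const a + 4 * M / r"
        using iw by (subst Bochner_Integration.integral_add) auto
      finally have "gegen_const a * \<bar>LINT t|lborel. (g t - g 1) * w a t\<bar> \<le>
        gegen_const a * (e / 2 / gegen_const a + 4 * M / r)"
        using c by (intro mult_left_mono) auto
      also have "\<dots> = e / 2 + gegen_const a * (4 * M / r)"
        using c by (simp add: distrib_left)
      also have "\<dots> < e" using elim by simp
      finally have "dist (gegen_const a * (LINT t|lborel. g t * w a t)) (g 1) < e"
        unfolding eq .
      moreover have "(LINT t:{-1..1}|lborel. f t * (1 - t\<^sup>2) powr (a - 1)) = (LINT t|lborel. f t * w a t)"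
        by (simp add: set_lebesgue_integral_def w_def mult_ac)
      moreover note sym[OF \<open>a > 0\<close>]
      moreover have "g 1 = (f 1 + f (-1)) / 2" by (simp only: g_def)
      ultimately show ?case by (simp only:)
    qed
  qed
qed

section \<open>Orthogonal polynomials on the simplex\<close>

definition simplexT :: "(real ^ 'd) set" where
  "simplexT = {x. (\<forall>i. 0 \<le> x $ i) \<and> (\<Sum>i\<in>UNIV. x $ i) \<le> 1}"

definition U_weight :: "real ^ 'd \<Rightarrow> real \<Rightarrow> real \<Rightarrow> real ^ 'd \<Rightarrow> real" where
  "U_weight \<kappa> \<mu> \<nu> x =
     (\<Prod>i\<in>UNIV. x $ i powr (\<kappa> $ i - 1/2)) * (\<Sum>i\<in>UNIV. x $ i) powr \<nu>
       * (1 - (\<Sum>i\<in>UNIV. x $ i)) powr (\<mu> - 1/2)"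

definition inner_T :: "(real ^ 'd \<Rightarrow> real) \<Rightarrow> (real ^ 'd \<Rightarrow> real) \<Rightarrow> (real ^ 'd \<Rightarrow> real) \<Rightarrow> real" where
  "inner_T W f g =
     1 / (LINT x:simplexT|lborel. W x) * (LINT x:simplexT|lborel. f x * g x * W x)"

text \<open>Polynomials in \<open>d\<close> variables are identified with the functions they induce;
  \<open>\<alpha>\<close> ranges over the multi-indices of total degree at most \<open>n\<close>.\<close>

definition polys_le :: "nat \<Rightarrow> (real ^ 'd \<Rightarrow> real) set" where
  "polys_le n = {p. \<exists>c. p = (\<lambda>x. \<Sum>\<alpha> | (\<Sum>i\<in>UNIV. \<alpha> i) \<le> n. c \<alpha> * (\<Prod>i\<in>UNIV. x $ i ^ \<alpha> i))}"

definition orth_space :: "(real ^ 'd \<Rightarrow> real) \<Rightarrow> nat \<Rightarrow> (real ^ 'd \<Rightarrow> real) set" where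
  "orth_space W n = insert (\<lambda>x. 0)
     {p \<in> polys_le n. \<forall>m<n. p \<notin> polys_le m \<and> (\<forall>q\<in>polys_le m. inner_T W p q = 0)}"

definition orthonormal_basis ::
  "(real ^ 'd \<Rightarrow> real) \<Rightarrow> nat \<Rightarrow> (real ^ 'd \<Rightarrow> real) set \<Rightarrow> bool" where
  "orthonormal_basis W n B \<longleftrightarrow>
     finite B \<and> B \<subseteq> orth_space W n \<and>
     (\<forall>p\<in>B. \<forall>q\<in>B. inner_T W p q = (if p = q then 1 else 0)) \<and>
     (\<forall>p\<in>orth_space W n. \<exists>c. p = (\<lambda>x. \<Sum>Q\<in>B. c Q * Q x))"

text \<open>The value common to all orthonormal bases; it is specified only because such bases exist
  and the sum does not depend on the choice.\<close>

definition repr_kernel ::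
  "(real ^ 'd \<Rightarrow> real) \<Rightarrow> nat \<Rightarrow> real ^ 'd \<Rightarrow> real ^ 'd \<Rightarrow> real" where
  "repr_kernel W n x y = (THE k. \<forall>B. orthonormal_basis W n B \<longrightarrow> k = (\<Sum>Q\<in>B. Q x * Q y))"

section \<open>The integral representation\<close>

definition gegenbauer :: "nat \<Rightarrow> real \<Rightarrow> real \<Rightarrow> real" where
  "gegenbauer n l t =
     (\<Sum>k\<le>n div 2. (-1) ^ k * pochhammer l (n - k) / (fact k * fact (n - 2 * k)) * (2 * t) ^ (n - 2 * k))"

definition Xi_poly :: "nat \<Rightarrow> real \<Rightarrow> real poly" where
  "Xi_poly n l = (THE p. degree p = n \<and>
     (\<forall>t. poly p (2 * t\<^sup>2 - 1) = (2 * real n + l) / l * gegenbauer (2 * n) l t))"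

definition gamma_sum :: "real ^ 'd \<Rightarrow> real" where
  "gamma_sum \<kappa> = (\<Sum>i\<in>UNIV. \<kappa> $ i)"

definition lambda_par :: "real ^ 'd \<Rightarrow> real \<Rightarrow> real \<Rightarrow> real" where
  "lambda_par \<kappa> \<mu> \<nu> = \<nu> + \<mu> + gamma_sum \<kappa> + (real CARD('d) - 1) / 2"

definition zeta_arg ::
  "real ^ 'd \<Rightarrow> real ^ 'd \<Rightarrow> real \<Rightarrow> real \<Rightarrow> ('d \<Rightarrow> real) \<Rightarrow> real \<Rightarrow> real" where
  "zeta_arg x y u v s t =
     sqrt (\<Sum>i\<in>UNIV. x $ i) * sqrt (\<Sum>i\<in>UNIV. y $ i) * u * v
     + (1 - u) * (\<Sum>i\<in>UNIV. sqrt (x $ i * y $ i) * s i)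
     + sqrt (1 - (\<Sum>i\<in>UNIV. x $ i)) * sqrt (1 - (\<Sum>i\<in>UNIV. y $ i)) * t"

text \<open>The integrals over \<open>s\<close> and \<open>t\<close> are taken against the normalized Gegenbauer measures, so that
  vanishing \<open>\<mu>\<close> or \<open>\<kappa>\<^sub>i\<close> are covered; the factors \<open>c\<^sub>a\<close> this introduces for positive parameters
  cancel against \<open>kernel_const\<close>.\<close>

definition kernel_integral ::
  "real ^ 'd \<Rightarrow> real \<Rightarrow> real \<Rightarrow> nat \<Rightarrow> real ^ 'd \<Rightarrow> real ^ 'd \<Rightarrow> real" where
  "kernel_integral \<kappa> \<mu> \<nu> n x y =
     (LINT v:{-1..1}|lborel. (LINT u:{0..1}|lborel.
        (LINT t|gegen_measure \<mu>. (LINT s|PiM UNIV (\<lambda>i. gegen_measure (\<kappa> $ i)).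
           poly (Xi_poly n (lambda_par \<kappa> \<mu> \<nu>)) (2 * (zeta_arg x y u v s t)\<^sup>2 - 1)))
        * (u powr (\<nu> - 1) * (1 - u) powr (gamma_sum \<kappa> + (real CARD('d) - 2) / 2)))
        * (1 - v\<^sup>2) powr (\<nu> - 1/2))"

definition kernel_const :: "real ^ 'd \<Rightarrow> real \<Rightarrow> real \<Rightarrow> real" where
  "kernel_const \<kappa> \<mu> \<nu> =
     (THE a. \<forall>x\<in>simplexT. \<forall>y\<in>simplexT. a * kernel_integral \<kappa> \<mu> \<nu> 0 x y = 1)"

end

theory Submission
  imports Defs
begin

text \<open>Write \<open>r = |x|\<close>, \<open>s = |y|\<close>, \<open>A = \<gamma>\<^sub>\<kappa> + d/2\<close>. Integrating \<open>\<zeta>\<^bsup>2m\<^esup>\<close> over all the auxiliary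
  variables turns the right-hand side into an explicit polynomial \<open>K n x y\<close>, built from
  \<open>(r s)\<^sup>a\<close>, \<open>((1 - r) (1 - s))\<^sup>b\<close> and the homogeneous polynomials \<open>hk k x y\<close>; vanishing
  \<open>\<kappa>\<^sub>i\<close> or \<open>\<mu>\<close> need no separate treatment at this level. It remains to show that \<open>K n\<close>
  reproduces the orthogonal polynomials of degree \<open>n\<close>.

  The Dirichlet integral makes the moments of the weight explicit. A homogeneous polynomial
  is a sum of terms \<open>|x|\<^sup>q Y(x)\<close> with \<open>Y\<close> homogeneous and orthogonal to lower degrees on
  the face \<open>|x| = 1\<close>, and the kernels \<open>hk k\<close> send such a \<open>Y\<close> of degree \<open>j\<close> to a multiple
  of \<open>|y|\<^bsup>k - j\<^esup> Y(y)\<close> (a Funk--Hecke formula). Summing over the exponent \<open>a\<close> is then a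
  Rothe--Hagen convolution, which replaces \<open>A\<close> by \<open>A + \<nu>\<close>, and the remaining radial sum is
  a finite difference. Hence the operator with kernel \<open>K n\<close> annihilates polynomials of degree
  less than \<open>n\<close> and is the identity modulo lower degrees on those of degree \<open>n\<close>; by symmetry
  of \<open>K n\<close> this forces it to be the reproducing kernel.\<close>

section \<open>Combinatorial identities\<close>

text \<open>The factor |x|^\<nu> keeps U from being a Dirichlet weight, but it depends on |x| alone.
  So the moments split into a part on the face |x| = 1 with total parameter A and a Beta factor in
  |x| with parameters A + \<nu> and M = \<mu> + 1/2, whose sum is \<lambda> + 1. The obstacle is the
  mismatch of A and A + \<nu>: Funk--Hecke eigenvalues are Pochhammer symbols of A, the radial
  moments are those of A + \<nu>, and the u- and v-integrals supply exactly the Rothe coefficients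
  with parameter \<nu> that convert one into the other. The parameters \<kappa>_i and \<mu> enter
  the integral only through the even moments (1/2)_b / (a + 1/2)_b, a formula that holds at a = 0 as
  well. Let T be the operator with kernel \<open>K n\<close>. For P orthogonal to lower degrees, T P
  = P + t with t of lower degree. By symmetry T P is orthogonal to t, because T t = 0; P is
  orthogonal to t too, so t = 0. The existence of orthonormal bases is also extracted from T, whose
  values on monomials span the space.\<close>

lemma pochhammer_forward_diff:
  "pochhammer (c + 1) (Suc n) - pochhammer c (Suc n) = of_nat (Suc n) * pochhammer (c + 1 :: real) n"
proof -
  have "pochhammer (c + 1) (Suc n) = (c + 1 + of_nat n) * pochhammer (c + 1) n"
    by (rule pochhammer_rec')
  moreover have "pochhammer c (Suc n) = c * pochhammer (c + 1) n"
    by (rule pochhammer_rec)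
  ultimately show ?thesis by (simp add: algebra_simps)
qed

text \<open>Pascal's rule splits each coefficient in two, and shifting the index in one half pairs
  \<open>f m\<close> with \<open>f (Suc m)\<close>. Iterated, the alternating sum of order D is the
  D-fold difference of f.\<close>

lemma alternating_binomial_sum_diff:
  fixes f :: "nat \<Rightarrow> real"
  shows "(\<Sum>m\<le>Suc D. (-1) ^ m * real (Suc D choose m) * f m) =
    (\<Sum>m\<le>D. (-1) ^ m * real (D choose m) * (f m - f (Suc m)))"
proof -
  have "(\<Sum>m\<le>Suc D. (-1) ^ m * real (Suc D choose m) * f m) =
      f 0 + (\<Sum>m\<le>D. (-1) ^ Suc m * real (D choose m) * f (Suc m))
          + (\<Sum>m\<le>D. (-1) ^ Suc m * real (D choose Suc m) * f (Suc m))"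
    by (subst sum.atMost_Suc_shift) (simp add: algebra_simps sum.distrib sum_subtractf sum_negf del: sum.atMost_Suc)
  also have "f 0 + (\<Sum>m\<le>D. (-1) ^ Suc m * real (D choose m) * f (Suc m))
          + (\<Sum>m\<le>D. (-1) ^ Suc m * real (D choose Suc m) * f (Suc m)) =
      (\<Sum>m\<le>D. (-1) ^ Suc m * real (D choose m) * f (Suc m)) +
      (\<Sum>m\<le>Suc D. (-1) ^ m * real (D choose m) * f m)"
    using sum.atMost_Suc_shift[of "\<lambda>m. (-1) ^ m * real (D choose m) * f m" D] by simp
  also have "(\<Sum>m\<le>Suc D. (-1) ^ m * real (D choose m) * f m) =
      (\<Sum>m\<le>D. (-1) ^ m * real (D choose m) * f m)"
    by simp
  finally show ?thesis
    by (simp add: algebra_simps sum.distrib[symmetric] flip: sum_subtractf)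
qed

text \<open>The Pochhammer symbol is a polynomial of degree e in m, so D > e differences kill it.
  One difference shortens it by one factor and replaces c by c + 1, hence the induction over
  arbitrary e and c.\<close>

lemma alternating_pochhammer_sum_eq_0:
  assumes "e < D"
  shows "(\<Sum>m\<le>D. (-1) ^ m * real (D choose m) * pochhammer (c + real m) e) = 0"
  using assms
proof (induction D arbitrary: e c)
  case (Suc D)
  have "(\<Sum>m\<le>Suc D. (-1) ^ m * real (Suc D choose m) * pochhammer (c + real m) e) =
    (\<Sum>m\<le>D. (-1) ^ m * real (D choose m) * (pochhammer (c + real m) e - pochhammer (c + real (Suc m)) e))"
    by (rule alternating_binomial_sum_diff)
  also have "\<dots> = 0"
  proof (cases e)
    case (Suc e')
    have "pochhammer (c + real m) e - pochhammer (c + real (Suc m)) e =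
        - real e * pochhammer ((c + 1) + real m) e'" for m
      using pochhammer_forward_diff[of "c + real m" e'] Suc by (simp add: algebra_simps)
    hence "(\<Sum>m\<le>D. (-1) ^ m * real (D choose m) * (pochhammer (c + real m) e - pochhammer (c + real (Suc m)) e))
       = - real e * (\<Sum>m\<le>D. (-1) ^ m * real (D choose m) * pochhammer ((c + 1) + real m) e')"
      by (simp only: sum_distrib_left) (rule sum.cong, simp_all add: algebra_simps)
    also have "\<dots> = 0" using Suc.IH[of e' "c + 1"] Suc.prems \<open>e = Suc e'\<close> by simp
    finally show ?thesis .
  qed simp
  finally show ?case .
qed simp

text \<open>\<open>rothe x a\<close> is \<open>x / (x + 2a)\<close> times the binomial coefficient of \<open>x + 2a\<close> over \<open>a\<close>, written without the
  singular denominator, and \<open>central_binom y k\<close> is the binomial coefficient of \<open>y + 2k - 1\<close> over \<open>k\<close>.\<close>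

definition rothe :: "real \<Rightarrow> nat \<Rightarrow> real" where
  "rothe x a = (if a = 0 then 1 else x * pochhammer (x + real a + 1) (a - 1) / fact a)"

definition central_binom :: "real \<Rightarrow> nat \<Rightarrow> real" where
  "central_binom y k = pochhammer (y + real k) k / fact k"

text \<open>Both terms on the left share the factor (x + a + 2)_b with a = b + 1, and the cofactors
  satisfy x (x + 2a + 1) - (x - 1)(x + a + 1) = (a + 1)(x + 1). This Pascal-type rule reduces the
  convolution of order N + 1 to the one of order N.\<close>

lemma rothe_diff: "rothe x (Suc a) - rothe (x - 1) (Suc a) = rothe (x + 1) a"
proof (cases a)
  case (Suc b)
  define P where "P = pochhammer (x + real a + 2) b"
  have 1: "pochhammer (x + real (Suc a) + 1) (Suc b) = (x + 2 * real a + 1) * P"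
    unfolding P_def by (subst pochhammer_rec') (simp add: Suc algebra_simps)
  have 2: "pochhammer (x - 1 + real (Suc a) + 1) (Suc b) = (x + real a + 1) * P"
    unfolding P_def by (subst pochhammer_rec) (simp add: algebra_simps)
  have "rothe x (Suc a) - rothe (x - 1) (Suc a) =
      (x * ((x + 2 * real a + 1) * P) - (x - 1) * ((x + real a + 1) * P)) / fact (Suc a)"
    using 1 2 by (simp add: rothe_def Suc diff_divide_distrib)
  also have "x * ((x + 2 * real a + 1) * P) - (x - 1) * ((x + real a + 1) * P) =
      real (Suc a) * ((x + 1) * P)"
    by (simp add: algebra_simps)
  also have "\<dots> / fact (Suc a) = (x + 1) * P / fact a"
    by (simp add: fact_Suc del: of_nat_Suc)
  also have "\<dots> = rothe (x + 1) a"
    by (simp add: rothe_def P_def Suc add_ac)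
  finally show ?thesis .
qed (simp add: rothe_def)

lemma central_binom_diff: "central_binom y (Suc k) - central_binom (y - 1) (Suc k) = central_binom (y + 1) k"
proof -
  have "pochhammer (y + real (Suc k)) (Suc k) - pochhammer (y - 1 + real (Suc k)) (Suc k) =
    real (Suc k) * pochhammer (y + 1 + real k) k"
    using pochhammer_forward_diff[of "y + real k" k] by (simp add: algebra_simps)
  thus ?thesis
    unfolding central_binom_def diff_divide_distrib[symmetric]
    by (simp add: fact_Suc del: of_nat_Suc)
qed

lemmas real_polynomial_function_intros = real_polynomial_function.intros(2-)
  real_polynomial_function.intros(1)[OF bounded_linear_ident]

lemma real_polynomial_function_pochhammer:
  "real_polynomial_function (\<lambda>x::real. pochhammer (x + c) k)"
  by (induction k) (simp_all add: pochhammer_Suc real_polynomial_function_intros)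

lemma real_polynomial_function_zero_if_zero_on_nats:
  fixes f :: "real \<Rightarrow> real"
  assumes "real_polynomial_function f" "\<And>n::nat. f (real n) = 0"
  shows "f x = 0"
proof -
  obtain a n where a: "f = (\<lambda>x. \<Sum>i\<le>n. a i * x ^ i)"
    using assms(1) real_polynomial_function_iff_sum by blast
  have inf: "infinite {x. (\<Sum>i\<le>n. a i * x ^ i) = 0}"
  proof (rule infinite_super)
    show "range real \<subseteq> {x. (\<Sum>i\<le>n. a i * x ^ i) = 0}" using assms(2) a by auto
    show "infinite (range real)" by (simp add: finite_image_iff)
  qed
  have "\<forall>i\<le>n. a i = 0" using polyfun_finite_roots[of a n] inf by auto
  thus ?thesis by (simp add: a)
qed

text \<open>Both sides are polynomials in \<open>x\<close> that agree at \<open>0\<close> and, by induction on \<open>N\<close>, have the same backward difference.\<close>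

theorem rothe_hagen:
  "(\<Sum>a\<le>N. rothe x a * central_binom y (N - a)) = central_binom (x + y) N"
proof (induction N arbitrary: x y)
  case (Suc N)
  define D where "D = (\<lambda>x. (\<Sum>a\<le>Suc N. rothe x a * central_binom y (Suc N - a)) - central_binom (x + y) (Suc N))"
  have step: "D x = D (x - 1)" for x
  proof -
    have "(\<Sum>a\<le>Suc N. rothe x a * central_binom y (Suc N - a)) -
        (\<Sum>a\<le>Suc N. rothe (x - 1) a * central_binom y (Suc N - a)) =
        (\<Sum>a\<le>Suc N. (rothe x a - rothe (x - 1) a) * central_binom y (Suc N - a))"
      by (simp only: sum_subtractf[symmetric] left_diff_distrib)
    also have "\<dots> = (\<Sum>a\<le>N. rothe (x + 1) a * central_binom y (N - a))"
      by (subst sum.atMost_Suc_shift) (simp add: rothe_diff, simp add: rothe_def)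
    also have "\<dots> = central_binom (x + 1 + y) N" by (rule Suc.IH)
    also have "\<dots> = central_binom (x + y) (Suc N) - central_binom (x + y - 1) (Suc N)"
      by (subst central_binom_diff) (simp add: add_ac)
    finally show ?thesis by (simp add: D_def algebra_simps)
  qed
  have D0: "D 0 = 0"
  proof -
    have "(\<Sum>a\<le>Suc N. rothe 0 a * central_binom y (Suc N - a)) = central_binom y (Suc N)"
      by (subst sum.atMost_Suc_shift) (simp add: rothe_def)
    thus ?thesis by (simp add: D_def)
  qed
  have zero: "D (real n) = 0" for n
  proof (induction n)
    case (Suc n)
    thus ?case using step[of "real (Suc n)"] by simp
  qed (simp add: D0)
  have "real_polynomial_function D"
  proof -
    have *: "real_polynomial_function (\<lambda>x. rothe x a)" for a
    proof (cases a)
      case (Suc b)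
      have "(\<lambda>x. rothe x a) = (\<lambda>x. x * pochhammer (x + (real a + 1)) b * inverse (fact a))"
        by (simp add: rothe_def Suc divide_inverse add_ac fun_eq_iff)
      thus ?thesis
        by (simp only: real_polynomial_function_intros real_polynomial_function_pochhammer)
    qed (simp add: rothe_def real_polynomial_function_intros)
    have "real_polynomial_function (\<lambda>x. rothe x a * central_binom y (Suc N - a))" for a
      by (rule real_polynomial_function.intros(4)[OF * real_polynomial_function.intros(2)])
    hence **: "real_polynomial_function (\<lambda>x. \<Sum>a\<le>Suc N. rothe x a * central_binom y (Suc N - a))"
      by (intro real_polynomial_function_sum) simp_all
    have "(\<lambda>x. central_binom (x + y) (Suc N)) =
        (\<lambda>x. pochhammer (x + (y + real (Suc N))) (Suc N) * inverse (fact (Suc N)))"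
      unfolding central_binom_def divide_inverse add.assoc ..
    hence "real_polynomial_function (\<lambda>x. central_binom (x + y) (Suc N))"
      by (simp only: real_polynomial_function_intros real_polynomial_function_pochhammer)
    thus ?thesis
      unfolding D_def by (rule real_polynomial_function_diff[OF **])
  qed
  from real_polynomial_function_zero_if_zero_on_nats[OF this zero] have "D x = 0" .
  thus ?case by (simp only: D_def)
qed (simp add: rothe_def central_binom_def)

text \<open>Equivalently, the exponential generating function of \<open>\<beta> \<mapsto> (c + \<beta>)\<^sub>q\<close> is \<open>exp\<close> times
  a monic polynomial of degree \<open>q\<close>.\<close>

lemma pochhammer_shift_expansion:
  fixes c :: real
  shows "\<exists>p. p q = 1 \<and> (\<forall>i>q. p i = 0) \<and>
    (\<forall>\<beta>. pochhammer (c + real \<beta>) q / fact \<beta> = (\<Sum>i\<le>\<beta>. p i / fact (\<beta> - i)))"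
proof (induction q)
  case 0
  show ?case
  proof (intro exI[of _ "\<lambda>i. if i = 0 then 1 else 0"] conjI allI)
    fix \<beta> :: nat
    have "(\<Sum>i\<le>\<beta>. (if i = 0 then 1 else 0) / fact (\<beta> - i) :: real) =
        (\<Sum>i\<le>\<beta>. if i = 0 then 1 / fact \<beta> else 0)"
      by (intro sum.cong) auto
    thus "pochhammer (c + real \<beta>) 0 / fact \<beta> = (\<Sum>i\<le>\<beta>. (if i = 0 then 1 else 0) / fact (\<beta> - i))"
      by simp
  qed auto
next
  case (Suc q)
  then obtain p where p: "p q = 1" "\<And>i. i > q \<Longrightarrow> p i = 0"
    "\<And>\<beta>. pochhammer (c + real \<beta>) q / fact \<beta> = (\<Sum>i\<le>\<beta>. p i / fact (\<beta> - i))" by blast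
  \<comment> \<open>Split c + q + \<beta> as (c + q + i) + (\<beta> - i): the first part scales the
    coefficient, the second cancels a factor of the factorial of \<beta> - i and so shifts the index
    by one.\<close>
  define p' where "p' = (\<lambda>i. (c + real q + real i) * p i + (if i = 0 then 0 else p (i - 1)))"
  have "pochhammer (c + real \<beta>) (Suc q) / fact \<beta> = (\<Sum>i\<le>\<beta>. p' i / fact (\<beta> - i))" for \<beta>
  proof -
    have "pochhammer (c + real \<beta>) (Suc q) / fact \<beta> = (\<Sum>i\<le>\<beta>. (c + real q + real \<beta>) * (p i / fact (\<beta> - i)))"
      by (simp only: sum_distrib_left[symmetric] p(3)[symmetric]) (simp add: pochhammer_Suc algebra_simps)
    also have "\<dots> = (\<Sum>i\<le>\<beta>. (c + real q + real i) * p i / fact (\<beta> - i)) +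
        (\<Sum>i\<le>\<beta>. (real \<beta> - real i) * p i / fact (\<beta> - i))"
      by (simp add: sum.distrib[symmetric] add_divide_distrib[symmetric] algebra_simps)
    also have "(\<Sum>i\<le>\<beta>. (real \<beta> - real i) * p i / fact (\<beta> - i)) =
        (\<Sum>i<\<beta>. p i / fact (\<beta> - Suc i))"
    proof -
      have "(\<Sum>i\<le>\<beta>. (real \<beta> - real i) * p i / fact (\<beta> - i)) =
          (\<Sum>i<\<beta>. (real \<beta> - real i) * p i / fact (\<beta> - i))"
        by (simp add: lessThan_Suc_atMost[symmetric])
      also have "\<dots> = (\<Sum>i<\<beta>. p i / fact (\<beta> - Suc i))"
      proof (rule sum.cong)
        fix i assume "i \<in> {..<\<beta>}"
        then obtain k where k: "\<beta> = Suc (i + k)" using less_natE by auto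
        show "(real \<beta> - real i) * p i / fact (\<beta> - i) = p i / fact (\<beta> - Suc i)"
        proof -
          have "(real \<beta> - real i) * p i / fact (\<beta> - i) = ((1 + real k) * p i) / ((1 + real k) * fact k)"
            by (simp add: k Suc_diff_le)
          thus ?thesis by (simp add: k)
        qed
      qed simp
      finally show ?thesis .
    qed
    also have "(\<Sum>i<\<beta>. p i / fact (\<beta> - Suc i)) = (\<Sum>i\<le>\<beta>. (if i = 0 then 0 else p (i - 1)) / fact (\<beta> - i))"
      by (simp add: lessThan_Suc_atMost[symmetric] sum.lessThan_Suc_shift del: sum.lessThan_Suc)
    also have "(\<Sum>i\<le>\<beta>. (c + real q + real i) * p i / fact (\<beta> - i)) + \<dots> = (\<Sum>i\<le>\<beta>. p' i / fact (\<beta> - i))"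
      by (simp add: sum.distrib[symmetric] p'_def add_divide_distrib)
    finally show ?thesis .
  qed
  moreover have "p' (Suc q) = 1" "\<forall>i>Suc q. p' i = 0" using p by (auto simp: p'_def)
  ultimately show ?case by blast
qed

section \<open>Exponent vectors of fixed degree and coefficients of products of power series\<close>

definition compositions :: "nat \<Rightarrow> ('d::finite \<Rightarrow> nat) set" where
  "compositions k = {\<beta>. (\<Sum>i\<in>UNIV. \<beta> i) = k}"

text \<open>Translates the multiset indexing of \<open>fps_prod_nth'\<close> into exponent
  functions, and also gives the finiteness of \<open>compositions k\<close>.\<close>

lemma bij_betw_count_compositions:
  "bij_betw count (multisets_of_size (UNIV :: 'd::finite set) k) (compositions k)"
  unfolding bij_betw_def
proof (intro conjI set_eqI iffI)
  have size: "size X = (\<Sum>i\<in>UNIV. count X i)" for X :: "'d multiset"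
    unfolding size_multiset_overloaded_eq by (rule sum.mono_neutral_left) (auto simp: not_in_iff)
  show "inj_on count (multisets_of_size (UNIV :: 'd set) k)"
    by (auto intro!: inj_onI simp: count_inject)
  fix \<beta> :: "'d \<Rightarrow> nat"
  show "\<beta> \<in> compositions k" if "\<beta> \<in> count ` multisets_of_size UNIV k"
    using that by (auto simp: compositions_def multisets_of_size_def size)
  assume "\<beta> \<in> compositions k"
  moreover have "count (Abs_multiset \<beta>) = \<beta>" by (rule count_Abs_multiset) simp
  ultimately show "\<beta> \<in> count ` multisets_of_size UNIV k"
    by (intro image_eqI[of _ _ "Abs_multiset \<beta>"]) (auto simp: compositions_def multisets_of_size_def size)
qed

lemma finite_compositions [simp]: "finite (compositions k :: ('d::finite \<Rightarrow> nat) set)"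
  by (rule bij_betw_finite[OF bij_betw_count_compositions, THEN iffD1]) (simp add: finite_multisets_of_size)

text \<open>Makes a sum over exponent vectors of degree k a single coefficient of a product of
  univariate series. The multinomial expansion and the computation behind Funk--Hecke both use
  it.\<close>

lemma fps_nth_prod_compositions:
  fixes f :: "'d::finite \<Rightarrow> 'a::comm_ring_1 fps"
  shows "fps_nth (\<Prod>i\<in>UNIV. f i) k = (\<Sum>\<beta>\<in>compositions k. \<Prod>i\<in>UNIV. fps_nth (f i) (\<beta> i))"
  by (subst fps_prod_nth', simp) (rule sum.reindex_bij_betw[OF bij_betw_count_compositions])

section \<open>Beta, Gegenbauer and Dirichlet integrals\<close>

lemma finite_measure_gegen:
  assumes "a \<ge> 0"
  shows "finite_measure (gegen_measure a)" and "measure (gegen_measure a) UNIV = 1"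
proof -
  have "emeasure (gegen_measure a) UNIV = 1"
  proof (cases "a = 0")
    case True
    have "(\<lambda>t. t) \<in> uniform_count_measure {-1, 1} \<rightarrow>\<^sub>M (borel :: real measure)"
      by (auto simp: measurable_def sets_uniform_count_measure space_uniform_count_measure)
    thus ?thesis using True
      by (simp add: gegen_measure_def emeasure_distr space_uniform_count_measure
          emeasure_uniform_count_measure)
  next
    case False
    hence a: "a > 0" using assms by simp
    have c: "gegen_const a > 0" using gegen_const_pos[OF a] .
    have "emeasure (gegen_measure a) UNIV =
        (\<integral>\<^sup>+ t. ennreal (indicator {-1..1} t * (gegen_const a * (1 - t\<^sup>2) powr (a - 1))) \<partial>lborel)"
      using False by (simp add: gegen_measure_def emeasure_density)
    also have "\<dots> = (\<integral>\<^sup>+ t. ennreal (gegen_const a * (indicator {-1..1} t * (1 - t\<^sup>2) powr (a - 1))) \<partial>lborel)"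
      by (simp add: mult_ac)
    also have "\<dots> = ennreal (LINT t|lborel. gegen_const a * (indicator {-1..1} t * (1 - t\<^sup>2) powr (a - 1)))"
      using gegen_weight(1)[OF a] c by (intro nn_integral_eq_integral) auto
    also have "\<dots> = 1" using gegen_weight[OF a] c by simp
    finally show ?thesis .
  qed
  moreover have "space (gegen_measure a) = UNIV"
    using sets_eq_imp_space_eq[OF sets_gegen_measure] by simp
  ultimately show "finite_measure (gegen_measure a)" "measure (gegen_measure a) UNIV = 1"
    by (auto intro!: finite_measureI simp: measure_def)
qed

lemma AE_gegen_measure: "AE t in gegen_measure a. t \<in> {-1..1}"
proof (cases "a = 0")
  case True
  have "(\<lambda>t. t) \<in> uniform_count_measure {-1, 1} \<rightarrow>\<^sub>M (borel :: real measure)"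
    by (auto simp: measurable_def sets_uniform_count_measure space_uniform_count_measure)
  moreover have "AE t in uniform_count_measure {-1, 1 :: real}. t \<in> {-1..1}"
    by (rule AE_I2) (auto simp: space_uniform_count_measure)
  ultimately show ?thesis
    unfolding gegen_measure_def True by (simp only: if_True simp_thms) (subst AE_distr_iff, auto)
next
  case False
  have "AE t in density lborel
      (\<lambda>t. ennreal (indicator {-1..1} t * (gegen_const a * (1 - t\<^sup>2) powr (a - 1)))). t \<in> {-1..1}"
    by (subst AE_density) (auto simp: indicator_def)
  thus ?thesis unfolding gegen_measure_def using False by simp
qed

lemma integrable_gegen_power:
  assumes "a \<ge> 0"
  shows "integrable (gegen_measure a) (\<lambda>t. t ^ e)"
proof -
  interpret finite_measure "gegen_measure a" by (rule finite_measure_gegen[OF assms])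
  show ?thesis
  proof (rule integrable_const_bound[where B = 1])
    show "AE t in gegen_measure a. norm (t ^ e) \<le> 1"
      using AE_gegen_measure by eventually_elim (auto simp: power_abs intro!: power_le_one)
  qed measurable
qed

lemma integral_gegen_odd:
  assumes "a \<ge> 0"
  shows "(LINT t|gegen_measure a. t ^ Suc (2 * b)) = 0"
proof (cases "a = 0")
  case True
  thus ?thesis by (simp add: integral_gegen_measure_0)
next
  case False
  hence a: "a > 0" using assms by simp
  define I where "I = (LINT t|lborel. indicator {-1..1} t * (t ^ Suc (2 * b) * (1 - t\<^sup>2) powr (a - 1)) :: real)"
  have "I = (LINT t|lborel. indicator {-1..1} (-t) * ((-t) ^ Suc (2 * b) * (1 - (-t)\<^sup>2) powr (a - 1)) :: real)"
    unfolding I_def by (subst lborel_integral_real_affine[where c = "-1" and t = 0]) simp_all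
  also have "\<dots> = (LINT t|lborel. - (indicator {-1..1} t * (t ^ Suc (2 * b) * (1 - t\<^sup>2) powr (a - 1))) :: real)"
    by (intro Bochner_Integration.integral_cong) (auto simp: indicator_def)
  also have "\<dots> = - I" by (simp add: I_def)
  finally have "I = 0" by simp
  thus ?thesis using a by (simp add: integral_gegen_measure_pos set_lebesgue_integral_def I_def)
qed

text \<open>Multiplying the weight by 1 - t^2 raises the parameter from a to a + 1 and changes the
  normalization by a / (a + 1/2). This expresses the moment of order b + 1 through moments of order
  b at a and at a + 1, so the induction keeps a arbitrary. At a = 0 both sides equal 1.\<close>

lemma integral_gegen_even:
  assumes "a \<ge> 0"
  shows "(LINT t|gegen_measure a. t ^ (2 * b)) = pochhammer (1/2) b / pochhammer (a + 1/2) b"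
proof (cases "a = 0")
  case True
  have "pochhammer (1/2 :: real) b \<noteq> 0" using pochhammer_pos[of "1/2::real" b] by simp
  thus ?thesis using True by (simp add: integral_gegen_measure_0)
next
  case False
  hence "a > 0" using assms by simp
  thus ?thesis
  proof (induction b arbitrary: a)
    case 0
    then show ?case using finite_measure_gegen[of a] by (simp add: sets_eq_imp_space_eq[OF sets_gegen_measure])
  next
    case (Suc b)
    let ?I = "\<lambda>a b. (LINT t|gegen_measure a. t ^ (2 * b))"
    have G: "gegen_const (a + 1) = gegen_const a * ((a + 1/2) / a)"
    proof -
      have "a + 1/2 \<notin> \<int>\<^sub>\<le>\<^sub>0" "a \<notin> \<int>\<^sub>\<le>\<^sub>0"
        using Suc.prems by (auto elim!: nonpos_Ints_cases)
      hence "Gamma (a + 1/2 + 1) = (a + 1/2) * Gamma (a + 1/2)" "Gamma (a + 1) = a * Gamma a"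
        using Gamma_plus1[of "a + 1/2"] Gamma_plus1[of a] by blast+
      moreover have "a + 1 + 1/2 = a + 1/2 + 1" by simp
      ultimately show ?thesis unfolding gegen_const_def by (simp add: mult_ac)
    qed
    have "?I a b - ?I a (Suc b) = (LINT t|gegen_measure a. t ^ (2 * b) - t ^ (2 * Suc b))"
      using Suc.prems by (intro Bochner_Integration.integral_diff[symmetric] integrable_gegen_power) auto
    also have "\<dots> = (LINT t|gegen_measure a. t ^ (2 * b) * (1 - t\<^sup>2))"
      by (simp add: algebra_simps power2_eq_square)
    also have "\<dots> = gegen_const a * (LINT t:{-1..1}|lborel. t ^ (2 * b) * (1 - t\<^sup>2) * (1 - t\<^sup>2) powr (a - 1))"
      using Suc.prems by (subst integral_gegen_measure_pos) auto
    also have "(LINT t:{-1..1}|lborel. t ^ (2 * b) * (1 - t\<^sup>2) * (1 - t\<^sup>2) powr (a - 1)) =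
        (LINT t:{-1..1}|lborel. t ^ (2 * b) * (1 - t\<^sup>2) powr (a + 1 - 1))"
    proof (rule set_lebesgue_integral_cong)
      have "t ^ (2 * b) * (1 - t\<^sup>2) * (1 - t\<^sup>2) powr (a - 1) = t ^ (2 * b) * (1 - t\<^sup>2) powr (a + 1 - 1)"
        if "t \<in> {-1..1}" for t :: real
        using that powr_mult_base[of "1 - t\<^sup>2" "a - 1"] by (simp add: abs_square_le_1 abs_le_iff)
      thus "\<forall>t. t \<in> {-1..1} \<longrightarrow> t ^ (2 * b) * (1 - t\<^sup>2) * (1 - t\<^sup>2) powr (a - 1) =
          t ^ (2 * b) * (1 - t\<^sup>2) powr (a + 1 - 1)" by blast
    qed simp
    also have "gegen_const a * \<dots> = a / (a + 1/2) * ?I (a + 1) b"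
    proof -
      have "gegen_const a = a / (a + 1/2) * gegen_const (a + 1)" using G Suc.prems by simp
      thus ?thesis using Suc.prems
        by (subst integral_gegen_measure_pos) auto
    qed
    finally have "?I a (Suc b) = ?I a b - a / (a + 1/2) * ?I (a + 1) b" by simp
    also have "\<dots> = pochhammer (1/2) b / pochhammer (a + 1/2) b -
        a / (a + 1/2) * (pochhammer (1/2) b / pochhammer (a + 1 + 1/2) b)"
      using Suc.IH[of a] Suc.IH[of "a + 1"] Suc.prems by simp
    also have "\<dots> = pochhammer (1/2) (Suc b) / pochhammer (a + 1/2) (Suc b)"
    proof -
      define P where "P = pochhammer (a + 1/2) (Suc b)"
      have P: "P > 0" unfolding P_def using Suc.prems by (intro pochhammer_pos) auto
      have "a + 1/2 + real b \<noteq> 0" using Suc.prems by linarith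
      hence 1: "1 / pochhammer (a + 1/2) b = (a + 1/2 + real b) / P"
        unfolding P_def by (simp add: pochhammer_Suc)
      have 2: "1 / ((a + 1/2) * pochhammer (a + 1 + 1/2) b) = 1 / P"
        using P unfolding P_def by (simp add: pochhammer_rec add_ac)
      have "pochhammer (1/2) b / pochhammer (a + 1/2) b -
        a / (a + 1/2) * (pochhammer (1/2) b / pochhammer (a + 1 + 1/2) b) =
        pochhammer (1/2) b * (1 / pochhammer (a + 1/2) b) -
        a * pochhammer (1/2) b * (1 / ((a + 1/2) * pochhammer (a + 1 + 1/2) b))"
        by simp
      also have "\<dots> = pochhammer (1/2) b * (1/2 + real b) / P"
        unfolding 1 2 using P by (simp add: field_simps)
      finally show ?thesis by (simp add: P_def pochhammer_Suc)
    qed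
    finally show ?case .
  qed
qed

lemma set_integral_Beta:
  fixes p q :: real
  assumes "p > 0" "q > 0"
  shows "set_integrable lborel {0..1} (\<lambda>u. u powr (p - 1) * (1 - u) powr (q - 1))"
    and "(LINT u:{0..1}|lborel. u powr (p - 1) * (1 - u) powr (q - 1)) = Beta p q"
  using integrable_Beta[OF assms] has_integral_Beta_real[OF assms]
  by (auto simp: set_borel_integral_eq_integral(2) integral_unique)

lemma Beta_pochhammer:
  fixes p q :: real
  assumes "p > 0" "q > 0"
  shows "Beta (p + real i) (q + real j) =
    Beta p q * (pochhammer p i * pochhammer q j / pochhammer (p + q) (i + j))"
proof -
  have *: "Gamma (z + real n) = Gamma z * pochhammer z n" if "z > 0" for z n
  proof -
    have "z \<notin> \<int>\<^sub>\<le>\<^sub>0" using that by (auto elim!: nonpos_Ints_cases)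
    moreover have "Gamma z > 0" using that by (rule Gamma_real_pos)
    ultimately show ?thesis by (simp add: pochhammer_Gamma)
  qed
  show ?thesis unfolding Beta_def
    using assms *[of p i] *[of q j] *[of "p + q" "i + j"] by (simp add: algebra_simps)
qed

section \<open>Dirichlet integrals over the simplex, one coordinate at a time\<close>

lemma measurable_vec_lambda [measurable]:
  "(\<lambda>f. \<chi> i. f i) \<in> (\<Pi>\<^sub>M i\<in>(UNIV::'d::finite set). lborel) \<rightarrow>\<^sub>M (borel :: (real ^ 'd) measure)"
proof (subst borel_measurable_euclidean_space, intro ballI)
  fix b :: "real ^ 'd" assume "b \<in> Basis"
  then obtain i where b: "b = axis i 1" by (auto simp: Basis_vec_def)
  show "(\<lambda>f. (\<chi> i. f i) \<bullet> b) \<in> borel_measurable (\<Pi>\<^sub>M i\<in>(UNIV::'d set). lborel)"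
    unfolding b by (simp add: inner_axis)
qed

text \<open>Both measures give a box the product of its side lengths, which characterizes
  \<open>lborel\<close>. Integrals over vectors thereby become integrals over a product measure,
  where coordinates can be split off.\<close>

lemma lborel_vec:
  "(lborel :: (real ^ 'd::finite) measure) = distr (\<Pi>\<^sub>M i\<in>UNIV. lborel) borel (\<lambda>f. \<chi> i. f i)"
proof (rule lborel_eqI)
  fix l u :: "real ^ 'd"
  assume le: "\<And>b. b \<in> Basis \<Longrightarrow> l \<bullet> b \<le> u \<bullet> b"
  interpret product_sigma_finite "\<lambda>_::'d. lborel :: real measure"
    by standard
  have le': "l $ i \<le> u $ i" for i
    using le[of "axis i 1"] by (auto simp: Basis_vec_def inner_axis)
  have Basis: "(Basis :: (real ^ 'd) set) = range (\<lambda>i. axis i 1)"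
    by (auto simp: Basis_vec_def)
  have "(\<lambda>f. \<chi> i. f i) -` box l u \<inter> space (\<Pi>\<^sub>M i\<in>(UNIV::'d set). lborel) =
      Pi\<^sub>E UNIV (\<lambda>i. {l $ i<..<u $ i})"
    by (auto simp: mem_box_cart space_PiM PiE_def Pi_def)
  hence "emeasure (distr (\<Pi>\<^sub>M i\<in>UNIV. lborel) borel (\<lambda>f. \<chi> i. f i)) (box l u) =
      (\<Prod>i\<in>UNIV. emeasure lborel {l $ i<..<u $ i})"
    by (subst emeasure_distr) (simp_all add: emeasure_PiM)
  also have "\<dots> = ennreal (\<Prod>i\<in>UNIV. u $ i - l $ i)"
    using le' by (simp add: prod_ennreal)
  also have "(\<Prod>i\<in>UNIV. u $ i - l $ i) = (\<Prod>b\<in>Basis. (u - l) \<bullet> b)"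
    unfolding Basis by (subst prod.reindex) (auto simp: inj_on_def axis_eq_axis inner_axis)
  finally show "emeasure (distr (\<Pi>\<^sub>M i\<in>UNIV. lborel) borel (\<lambda>f. \<chi> i. f i)) (box l u) =
      ennreal (\<Prod>b\<in>Basis. (u - l) \<bullet> b)" .
qed simp

text \<open>The Gamma densities without their exponential factor; they form a convolution semigroup.\<close>

definition rl_kernel :: "real \<Rightarrow> real \<Rightarrow> real" where
  "rl_kernel p x = indicator {0..} x * x powr (p - 1) / Gamma p"

lemma rl_kernel_measurable [measurable]: "rl_kernel p \<in> borel_measurable borel"
  unfolding rl_kernel_def by measurable

lemma rl_kernel_nonneg: "p > 0 \<Longrightarrow> rl_kernel p x \<ge> 0"
  by (simp add: rl_kernel_def Gamma_real_pos less_imp_le)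

lemma nn_integral_Beta:
  fixes p q :: real
  assumes "p > 0" "q > 0"
  shows "(\<integral>\<^sup>+ t. ennreal (indicator {0..1} t * (t powr (p - 1) * (1 - t) powr (q - 1))) \<partial>lborel) = ennreal (Beta p q)"
  by (rule nn_integral_has_integral_lebesgue[OF _ has_integral_Beta_real[OF assms]]) simp

text \<open>For r > 0 the substitution x = r t pulls out r to the power p + q - 1 and leaves a Beta
  integral; its value cancels the Gamma normalizations. For r \<le> 0 both sides vanish.\<close>

lemma rl_kernel_convolution:
  assumes "p > 0" "q > 0"
  shows "(\<integral>\<^sup>+ x. ennreal (rl_kernel p x * rl_kernel q (r - x)) \<partial>lborel) = ennreal (rl_kernel (p + q) r)"
proof (cases "r > 0")
  case False
  have zero: "rl_kernel p x * rl_kernel q (r - x) = 0" for x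
    using False by (auto simp: rl_kernel_def indicator_def)
  moreover have "rl_kernel (p + q) r = 0" using False by (auto simp: rl_kernel_def indicator_def)
  ultimately show ?thesis unfolding zero by simp
next
  case True
  have G: "Gamma p > 0" "Gamma q > 0" "Gamma (p + q) > 0" using assms by (auto intro: Gamma_real_pos)
  have "(\<integral>\<^sup>+ x. ennreal (rl_kernel p x * rl_kernel q (r - x)) \<partial>lborel) =
      ennreal r * (\<integral>\<^sup>+ t. ennreal (rl_kernel p (r * t) * rl_kernel q (r - r * t)) \<partial>lborel)"
    using True by (subst nn_integral_real_affine[where c = r and t = 0]) auto
  also have "\<dots> = (\<integral>\<^sup>+ t. ennreal r * ennreal (rl_kernel p (r * t) * rl_kernel q (r - r * t)) \<partial>lborel)"
    by (subst nn_integral_cmult) auto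
  also have "\<dots> = (\<integral>\<^sup>+ t. ennreal (r powr (p + q - 1) / (Gamma p * Gamma q)) *
      ennreal (indicator {0..1} t * (t powr (p - 1) * (1 - t) powr (q - 1))) \<partial>lborel)"
  proof (rule nn_integral_cong)
    fix t :: real
    have ind: "indicator {0..} (r * t) * indicator {0..} (r - r * t) = (indicator {0..1} t :: real)"
      using True by (auto simp: indicator_def zero_le_mult_iff)
    have "r * (rl_kernel p (r * t) * rl_kernel q (r - r * t)) =
       (indicator {0..} (r * t) * indicator {0..} (r - r * t)) *
       (r * ((r * t) powr (p - 1) * (r * (1 - t)) powr (q - 1))) / (Gamma p * Gamma q)"
      by (simp add: rl_kernel_def algebra_simps)
    also have "\<dots> = indicator {0..1} t *
       ((r * r powr (p - 1) * r powr (q - 1)) * (t powr (p - 1) * (1 - t) powr (q - 1))) / (Gamma p * Gamma q)"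
      unfolding ind using True by (simp add: powr_mult indicator_def)
    also have "r * r powr (p - 1) * r powr (q - 1) = r powr (p + q - 1)"
      using True by (simp add: powr_mult_base powr_add[symmetric] add_diff_eq)
    finally have "r * (rl_kernel p (r * t) * rl_kernel q (r - r * t)) =
       (r powr (p + q - 1) / (Gamma p * Gamma q)) * (indicator {0..1} t * (t powr (p - 1) * (1 - t) powr (q - 1)))"
      by simp
    thus "ennreal r * ennreal (rl_kernel p (r * t) * rl_kernel q (r - r * t)) =
      ennreal (r powr (p + q - 1) / (Gamma p * Gamma q)) *
      ennreal (indicator {0..1} t * (t powr (p - 1) * (1 - t) powr (q - 1)))"
      using True G by (simp add: ennreal_mult'[symmetric])
  qed
  also have "\<dots> = ennreal (r powr (p + q - 1) / (Gamma p * Gamma q)) * ennreal (Beta p q)"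
    using nn_integral_Beta[OF assms] by (subst nn_integral_cmult) auto
  also have "\<dots> = ennreal (rl_kernel (p + q) r)"
    using True G by (subst ennreal_mult'[symmetric]) (auto simp: rl_kernel_def Beta_def)
  finally show ?thesis .
qed

text \<open>Tonelli with the new variable r = x + s exposes the convolution as the inner
  integral.\<close>

lemma nn_integral_rl_kernel_add:
  assumes "p > 0" "q > 0" and [measurable]: "F \<in> borel_measurable borel"
  shows "(\<integral>\<^sup>+ s. ennreal (rl_kernel q s) * (\<integral>\<^sup>+ x. ennreal (rl_kernel p x) * F (x + s) \<partial>lborel) \<partial>lborel)
    = (\<integral>\<^sup>+ r. ennreal (rl_kernel (p + q) r) * F r \<partial>lborel)"
proof -
  have "(\<integral>\<^sup>+ s. ennreal (rl_kernel q s) * (\<integral>\<^sup>+ x. ennreal (rl_kernel p x) * F (x + s) \<partial>lborel) \<partial>lborel) =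
     (\<integral>\<^sup>+ s. (\<integral>\<^sup>+ x. ennreal (rl_kernel q s) * ennreal (rl_kernel p x) * F (x + s) \<partial>lborel) \<partial>lborel)"
    by (simp add: nn_integral_cmult[symmetric] mult.assoc)
  also have "\<dots> = (\<integral>\<^sup>+ x. (\<integral>\<^sup>+ s. ennreal (rl_kernel q s) * ennreal (rl_kernel p x) * F (x + s) \<partial>lborel) \<partial>lborel)"
    by (rule lborel_pair.Fubini') measurable
  also have "\<dots> = (\<integral>\<^sup>+ x. (\<integral>\<^sup>+ r. ennreal (rl_kernel q (r - x)) * ennreal (rl_kernel p x) * F r \<partial>lborel) \<partial>lborel)"
  proof (rule nn_integral_cong)
    fix x :: real
    show "(\<integral>\<^sup>+ s. ennreal (rl_kernel q s) * ennreal (rl_kernel p x) * F (x + s) \<partial>lborel) =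
      (\<integral>\<^sup>+ r. ennreal (rl_kernel q (r - x)) * ennreal (rl_kernel p x) * F r \<partial>lborel)"
      by (subst nn_integral_real_affine[where c = 1 and t = "-x"]) (auto simp: algebra_simps)
  qed
  also have "\<dots> = (\<integral>\<^sup>+ r. (\<integral>\<^sup>+ x. ennreal (rl_kernel q (r - x)) * ennreal (rl_kernel p x) * F r \<partial>lborel) \<partial>lborel)"
    by (rule lborel_pair.Fubini') measurable
  also have "\<dots> = (\<integral>\<^sup>+ r. (\<integral>\<^sup>+ x. ennreal (rl_kernel p x * rl_kernel q (r - x)) \<partial>lborel) * F r \<partial>lborel)"
    using assms by (subst nn_integral_multc[symmetric])
      (auto simp: ennreal_mult' rl_kernel_nonneg mult_ac intro!: nn_integral_cong)
  finally show ?thesis using rl_kernel_convolution[OF assms(1,2)] by simp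
qed

text \<open>Integrating out one coordinate turns F into another function \<open>F'\<close> of the
  sum of the remaining ones, so F must be arbitrary in the induction.\<close>

lemma nn_integral_PiM_rl_kernel:
  fixes p :: "'d::finite \<Rightarrow> real"
  assumes p: "\<And>i. p i > 0" and "finite I" "I \<noteq> {}" and F: "F \<in> borel_measurable borel"
  shows "(\<integral>\<^sup>+ x. (\<Prod>i\<in>I. ennreal (rl_kernel (p i) (x i))) * F (\<Sum>i\<in>I. x i) \<partial>(\<Pi>\<^sub>M i\<in>I. lborel)) =
    (\<integral>\<^sup>+ r. ennreal (rl_kernel (\<Sum>i\<in>I. p i) r) * F r \<partial>lborel)"
  using assms(2,3) F
proof (induction I arbitrary: F rule: finite_ne_induct)
  case (singleton i)
  note [measurable] = singleton.prems
  interpret product_sigma_finite "\<lambda>_::'d. lborel :: real measure" by standard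
  show ?case
    using product_nn_integral_singleton[of "\<lambda>x. ennreal (rl_kernel (p i) x) * F x" i] by simp
next
  case (insert i I)
  note [measurable] = insert.prems
  interpret product_sigma_finite "\<lambda>_::'d. lborel :: real measure" by standard
  have P: "(\<Sum>i\<in>I. p i) > 0" using insert.hyps p by (intro sum_pos) auto
  define F' where "F' = (\<lambda>s. \<integral>\<^sup>+ x. ennreal (rl_kernel (p i) x) * F (x + s) \<partial>lborel)"
  have [measurable]: "F' \<in> borel_measurable borel" unfolding F'_def by measurable
  have "(\<integral>\<^sup>+ x. (\<Prod>j\<in>insert i I. ennreal (rl_kernel (p j) (x j))) * F (\<Sum>j\<in>insert i I. x j) \<partial>(\<Pi>\<^sub>M i\<in>insert i I. lborel)) =
    (\<integral>\<^sup>+ x. (\<integral>\<^sup>+ y. (\<Prod>j\<in>insert i I. ennreal (rl_kernel (p j) ((x(i := y)) j))) *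
       F (\<Sum>j\<in>insert i I. (x(i := y)) j) \<partial>lborel) \<partial>(\<Pi>\<^sub>M i\<in>I. lborel))"
    using insert.hyps by (intro product_nn_integral_insert) measurable
  also have "\<dots> = (\<integral>\<^sup>+ x. (\<Prod>j\<in>I. ennreal (rl_kernel (p j) (x j))) * F' (\<Sum>j\<in>I. x j) \<partial>(\<Pi>\<^sub>M i\<in>I. lborel))"
  proof (rule nn_integral_cong)
    fix x :: "'d \<Rightarrow> real"
    have "(x(i := y)) j = x j" if "j \<in> I" for j y
      using that insert.hyps by auto
    hence *: "(\<Prod>j\<in>I. ennreal (rl_kernel (p j) ((x(i := y)) j))) = (\<Prod>j\<in>I. ennreal (rl_kernel (p j) (x j)))"
      "(\<Sum>j\<in>I. (x(i := y)) j) = (\<Sum>j\<in>I. x j)" for y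
      by (simp_all cong: prod.cong sum.cong)
    show "(\<integral>\<^sup>+ y. (\<Prod>j\<in>insert i I. ennreal (rl_kernel (p j) ((x(i := y)) j))) *
       F (\<Sum>j\<in>insert i I. (x(i := y)) j) \<partial>lborel) = (\<Prod>j\<in>I. ennreal (rl_kernel (p j) (x j))) * F' (\<Sum>j\<in>I. x j)"
      using insert.hyps unfolding F'_def
      by (subst nn_integral_cmult[symmetric], measurable)
        (simp only: prod.insert sum.insert * fun_upd_same mult_ac not_False_eq_True if_True)
  qed
  also have "\<dots> = (\<integral>\<^sup>+ r. ennreal (rl_kernel (\<Sum>i\<in>I. p i) r) * F' r \<partial>lborel)"
    by (rule insert.IH) measurable
  also have "\<dots> = (\<integral>\<^sup>+ r. ennreal (rl_kernel (p i + (\<Sum>i\<in>I. p i)) r) * F r \<partial>lborel)"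
    unfolding F'_def by (rule nn_integral_rl_kernel_add) (use p P in auto)
  finally show ?case using insert.hyps by simp
qed

lemma nn_integral_lborel_rl_kernel:
  fixes p :: "'d::finite \<Rightarrow> real"
  assumes p: "\<And>i. p i > 0" and [measurable]: "F \<in> borel_measurable borel"
  shows "(\<integral>\<^sup>+ x. (\<Prod>i\<in>UNIV. ennreal (rl_kernel (p i) (x $ i))) * F (\<Sum>i\<in>UNIV. x $ i) \<partial>lborel) =
    (\<integral>\<^sup>+ r. ennreal (rl_kernel (\<Sum>i\<in>UNIV. p i) r) * F r \<partial>lborel)"
proof -
  have [measurable]: "(\<lambda>x::real^'d. x $ i) \<in> borel_measurable borel" for i
    by (intro borel_measurable_continuous_onI continuous_intros)
  show ?thesis
    by (subst lborel_vec, subst nn_integral_distr)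
       (simp_all add: nn_integral_PiM_rl_kernel p del: space_borel)
qed

text \<open>The indicator of the simplex splits into the signs of the coordinates, which sit inside
  \<open>rl_kernel\<close>, and the condition |x| \<le> 1, which joins the two radial powers in F.
  After reduction to r = |x| the exponent c merely shifts P, and a Beta integral remains.\<close>

lemma dirichlet_integral:
  fixes p :: "'d::finite \<Rightarrow> real"
  assumes p: "\<And>i. p i > 0" and "c \<ge> 0" "m > 0"
  defines "P \<equiv> (\<Sum>i\<in>UNIV. p i)"
  shows "has_bochner_integral lborel (\<lambda>x::real^'d. indicator simplexT x *
      ((\<Prod>i\<in>UNIV. x $ i powr (p i - 1)) * (\<Sum>i\<in>UNIV. x $ i) powr c * (1 - (\<Sum>i\<in>UNIV. x $ i)) powr (m - 1)))
    ((\<Prod>i\<in>UNIV. Gamma (p i)) / Gamma P * Beta (P + c) m)"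
proof (rule has_bochner_integral_nn_integral)
  have [measurable]: "(\<lambda>x::real^'d. x $ i) \<in> borel_measurable borel" for i
    by (intro borel_measurable_continuous_onI continuous_intros)
  have simplex: "(simplexT :: (real^'d) set) = {x\<in>space borel. (\<forall>i. 0 \<le> x $ i) \<and> (\<Sum>i\<in>UNIV. x $ i) \<le> 1}"
    by (simp add: simplexT_def)
  have [measurable]: "(simplexT :: (real^'d) set) \<in> sets borel"
    unfolding simplex by measurable
  show "(\<lambda>x::real^'d. indicator simplexT x *
      ((\<Prod>i\<in>UNIV. x $ i powr (p i - 1)) * (\<Sum>i\<in>UNIV. x $ i) powr c * (1 - (\<Sum>i\<in>UNIV. x $ i)) powr (m - 1)))
      \<in> borel_measurable lborel" by measurable
  have P: "P > 0" unfolding P_def using p by (intro sum_pos) auto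
  have G: "Gamma (p i) > 0" "Gamma P > 0" for i using p P by (auto intro: Gamma_real_pos)
  define K where "K = (\<Prod>i\<in>UNIV. Gamma (p i))"
  have K: "K > 0" unfolding K_def using G by (intro prod_pos) auto
  have B: "Beta (P + c) m \<ge> 0"
    unfolding Beta_def using P assms by (intro divide_nonneg_nonneg mult_nonneg_nonneg Gamma_real_nonneg) auto
  show "0 \<le> (\<Prod>i\<in>UNIV. Gamma (p i)) / Gamma P * Beta (P + c) m"
    using K G B by (simp add: K_def)
  show "AE x in lborel. 0 \<le> indicator simplexT x *
      ((\<Prod>i\<in>UNIV. (x::real^'d) $ i powr (p i - 1)) * (\<Sum>i\<in>UNIV. x $ i) powr c * (1 - (\<Sum>i\<in>UNIV. x $ i)) powr (m - 1))"
    by (auto intro!: AE_I2 mult_nonneg_nonneg prod_nonneg)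
  define F where "F = (\<lambda>r::real. ennreal (indicator {..1} r * (r powr c * (1 - r) powr (m - 1))))"
  have [measurable]: "F \<in> borel_measurable borel" unfolding F_def by measurable
  have "(\<integral>\<^sup>+ x. ennreal (indicator simplexT x *
      ((\<Prod>i\<in>UNIV. (x::real^'d) $ i powr (p i - 1)) * (\<Sum>i\<in>UNIV. x $ i) powr c * (1 - (\<Sum>i\<in>UNIV. x $ i)) powr (m - 1))) \<partial>lborel)
    = (\<integral>\<^sup>+ x. ennreal K * ((\<Prod>i\<in>UNIV. ennreal (rl_kernel (p i) (x $ i))) * F (\<Sum>i\<in>UNIV. x $ i)) \<partial>lborel)"
  proof (rule nn_integral_cong)
    fix x :: "real^'d"
    have eq: "indicator simplexT x = (\<Prod>i\<in>UNIV. indicator {0..} (x $ i)) * (indicator {..1} (\<Sum>i\<in>UNIV. x $ i) :: real)"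
      by (auto simp: simplexT_def indicator_def)
    have "indicator simplexT x *
      ((\<Prod>i\<in>UNIV. x $ i powr (p i - 1)) * (\<Sum>i\<in>UNIV. x $ i) powr c * (1 - (\<Sum>i\<in>UNIV. x $ i)) powr (m - 1)) =
      K * ((\<Prod>i\<in>UNIV. rl_kernel (p i) (x $ i)) * (indicator {..1} (\<Sum>i\<in>UNIV. x $ i) *
        ((\<Sum>i\<in>UNIV. x $ i) powr c * (1 - (\<Sum>i\<in>UNIV. x $ i)) powr (m - 1))))" (is "?L = K * (?A * ?B)")
      unfolding rl_kernel_def prod_dividef prod.distrib eq K_def[symmetric] using K by simp
    moreover have "?A \<ge> 0" using p by (intro prod_nonneg rl_kernel_nonneg) auto
    hence "ennreal (K * (?A * ?B)) = ennreal K * (ennreal ?A * ennreal ?B)"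
      using K by (simp only: ennreal_mult' less_imp_le)
    moreover have "ennreal ?A = (\<Prod>i\<in>UNIV. ennreal (rl_kernel (p i) (x $ i)))"
      using p by (simp add: prod_ennreal rl_kernel_nonneg)
    ultimately show "ennreal ?L =
      ennreal K * ((\<Prod>i\<in>UNIV. ennreal (rl_kernel (p i) (x $ i))) * F (\<Sum>i\<in>UNIV. x $ i))"
      unfolding F_def by (simp only:)
  qed
  also have "\<dots> = ennreal K * (\<integral>\<^sup>+ r. ennreal (rl_kernel P r) * F r \<partial>lborel)"
    unfolding P_def using nn_integral_lborel_rl_kernel[of p F] p by (subst nn_integral_cmult) auto
  also have "(\<integral>\<^sup>+ r. ennreal (rl_kernel P r) * F r \<partial>lborel) =
      (\<integral>\<^sup>+ r. ennreal (1 / Gamma P) * ennreal (indicator {0..1} r * (r powr (P + c - 1) * (1 - r) powr (m - 1))) \<partial>lborel)"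
  proof (rule nn_integral_cong)
    fix r :: real
    have "rl_kernel P r * (indicator {..1} r * (r powr c * (1 - r) powr (m - 1))) =
       (1 / Gamma P) * (indicator {0..1} r * ((r powr (P - 1) * r powr c) * (1 - r) powr (m - 1)))"
      by (auto simp: rl_kernel_def indicator_def)
    also have "r powr (P - 1) * r powr c = r powr (P + c - 1)"
      by (simp add: powr_add[symmetric] algebra_simps)
    finally show "ennreal (rl_kernel P r) * F r =
       ennreal (1 / Gamma P) * ennreal (indicator {0..1} r * (r powr (P + c - 1) * (1 - r) powr (m - 1)))"
      using G P unfolding F_def by (simp add: ennreal_mult'[symmetric] rl_kernel_nonneg)
  qed
  also have "\<dots> = ennreal (1 / Gamma P) * ennreal (Beta (P + c) m)"
    using nn_integral_Beta[of "P + c" m] P assms by (subst nn_integral_cmult) auto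
  also have "ennreal K * \<dots> = ennreal (K / Gamma P * Beta (P + c) m)"
    using K G B by (simp add: ennreal_mult'[symmetric])
  finally show "(\<integral>\<^sup>+ x. ennreal (indicator simplexT x *
      ((\<Prod>i\<in>UNIV. (x::real^'d) $ i powr (p i - 1)) * (\<Sum>i\<in>UNIV. x $ i) powr c * (1 - (\<Sum>i\<in>UNIV. x $ i)) powr (m - 1))) \<partial>lborel)
    = ennreal ((\<Prod>i\<in>UNIV. Gamma (p i)) / Gamma P * Beta (P + c) m)"
    unfolding K_def .
qed

section \<open>Spaces of polynomials\<close>

definition xpow :: "('d::finite \<Rightarrow> nat) \<Rightarrow> real ^ 'd \<Rightarrow> real" where
  "xpow \<alpha> x = (\<Prod>i\<in>UNIV. x $ i ^ \<alpha> i)"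

text \<open>With the exponent set as a parameter, closure properties are proved once for homogeneous
  polynomials, for degree at most n and for degree below n.\<close>

definition polys_on :: "('d::finite \<Rightarrow> nat) set \<Rightarrow> (real ^ 'd \<Rightarrow> real) set" where
  "polys_on A = {p. \<exists>c. p = (\<lambda>x. \<Sum>\<alpha>\<in>A. c \<alpha> * xpow \<alpha> x)}"

abbreviation multideg :: "('d::finite \<Rightarrow> nat) \<Rightarrow> nat" where
  "multideg \<alpha> \<equiv> (\<Sum>i\<in>UNIV. \<alpha> i)"

abbreviation homs :: "nat \<Rightarrow> (real ^ 'd::finite \<Rightarrow> real) set" where
  "homs k \<equiv> polys_on (compositions k)"

text \<open>The strict bound treats n = 0 uniformly: the space is then {0}, whereas
  \<open>polys_le (n - 1)\<close> would contain the constants.\<close>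

abbreviation polys_lt :: "nat \<Rightarrow> (real ^ 'd::finite \<Rightarrow> real) set" where
  "polys_lt n \<equiv> polys_on {\<alpha>. multideg \<alpha> < n}"

abbreviation coord_sum :: "real ^ 'd::finite \<Rightarrow> real" where
  "coord_sum x \<equiv> (\<Sum>i\<in>UNIV. x $ i)"

lemma polys_le_eq: "polys_le n = polys_on {\<alpha>. multideg \<alpha> \<le> n}"
  by (simp add: polys_le_def polys_on_def xpow_def)

lemma finite_multideg_lt [simp]: "finite {\<alpha> :: 'd::finite \<Rightarrow> nat. multideg \<alpha> < n}"
proof -
  have "{\<alpha> :: 'd \<Rightarrow> nat. multideg \<alpha> < n} = (\<Union>k<n. compositions k)"
    by (auto simp: compositions_def)
  thus ?thesis by simp
qed

lemma finite_multideg_le [simp]: "finite {\<alpha> :: 'd::finite \<Rightarrow> nat. multideg \<alpha> \<le> n}"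
  using finite_multideg_lt[of "Suc n"] by (simp add: less_Suc_eq_le)

lemma xpow_add: "xpow (\<lambda>i. \<alpha> i + \<beta> i) x = xpow \<alpha> x * xpow \<beta> x"
  by (simp add: xpow_def power_add prod.distrib)

lemma xpow_0: "xpow (\<lambda>_. 0) x = 1"
  by (simp add: xpow_def)

lemma polys_on_zero: "(\<lambda>_. 0) \<in> polys_on A"
  unfolding polys_on_def by (auto intro!: exI[of _ "\<lambda>_. 0"])

lemma polys_on_add: "p \<in> polys_on A \<Longrightarrow> q \<in> polys_on A \<Longrightarrow> (\<lambda>x. p x + q x) \<in> polys_on A"
  unfolding polys_on_def
proof clarify
  fix c c' :: "('a \<Rightarrow> nat) \<Rightarrow> real"
  show "\<exists>c''. (\<lambda>x. (\<Sum>\<alpha>\<in>A. c \<alpha> * xpow \<alpha> x) + (\<Sum>\<alpha>\<in>A. c' \<alpha> * xpow \<alpha> x)) = (\<lambda>x. \<Sum>\<alpha>\<in>A. c'' \<alpha> * xpow \<alpha> x)"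
    by (intro exI[of _ "\<lambda>\<alpha>. c \<alpha> + c' \<alpha>"]) (simp add: sum.distrib distrib_right)
qed

lemma polys_on_scale: "p \<in> polys_on A \<Longrightarrow> (\<lambda>x. r * p x) \<in> polys_on A"
  unfolding polys_on_def
proof clarify
  fix c :: "('a \<Rightarrow> nat) \<Rightarrow> real"
  show "\<exists>c'. (\<lambda>x. r * (\<Sum>\<alpha>\<in>A. c \<alpha> * xpow \<alpha> x)) = (\<lambda>x. \<Sum>\<alpha>\<in>A. c' \<alpha> * xpow \<alpha> x)"
    by (intro exI[of _ "\<lambda>\<alpha>. r * c \<alpha>"]) (simp add: sum_distrib_left mult.assoc)
qed

lemma polys_on_diff: "p \<in> polys_on A \<Longrightarrow> q \<in> polys_on A \<Longrightarrow> (\<lambda>x. p x - q x) \<in> polys_on A"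
  using polys_on_add[of p A "\<lambda>x. -1 * q x"] polys_on_scale[of q A "-1"] by simp

lemma polys_on_sum:
  "(\<And>i. i \<in> I \<Longrightarrow> f i \<in> polys_on A) \<Longrightarrow> (\<lambda>x. \<Sum>i\<in>I. f i x) \<in> polys_on A"
  by (induction I rule: infinite_finite_induct) (auto intro: polys_on_zero polys_on_add)

lemma xpow_in_polys_on: "finite A \<Longrightarrow> \<alpha> \<in> A \<Longrightarrow> xpow \<alpha> \<in> polys_on A"
  unfolding polys_on_def
  by (auto intro!: exI[of _ "\<lambda>\<beta>. if \<beta> = \<alpha> then 1 else 0"] simp: if_distrib[of "\<lambda>x. x * _"] cong: if_cong)

lemma polys_on_mono:
  assumes "p \<in> polys_on A" "A \<subseteq> B" "finite B"
  shows "p \<in> polys_on B"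
proof -
  obtain c where c: "p = (\<lambda>x. \<Sum>\<alpha>\<in>A. c \<alpha> * xpow \<alpha> x)" using assms(1) by (auto simp: polys_on_def)
  show ?thesis unfolding c
    using assms by (intro polys_on_sum polys_on_scale xpow_in_polys_on) auto
qed

lemma polys_on_mult:
  assumes "p \<in> polys_on A" "q \<in> polys_on B" "finite C"
    and "\<And>\<alpha> \<beta>. \<alpha> \<in> A \<Longrightarrow> \<beta> \<in> B \<Longrightarrow> (\<lambda>i. \<alpha> i + \<beta> i) \<in> C"
  shows "(\<lambda>x. p x * q x) \<in> polys_on C"
proof -
  obtain c c' where c: "p = (\<lambda>x. \<Sum>\<alpha>\<in>A. c \<alpha> * xpow \<alpha> x)" "q = (\<lambda>x. \<Sum>\<alpha>\<in>B. c' \<alpha> * xpow \<alpha> x)"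
    using assms(1,2) by (auto simp: polys_on_def)
  have "(\<lambda>x. p x * q x) = (\<lambda>x. \<Sum>\<alpha>\<in>A. \<Sum>\<beta>\<in>B. c \<alpha> * c' \<beta> * xpow (\<lambda>i. \<alpha> i + \<beta> i) x)"
    unfolding c sum_product by (intro ext sum.cong refl) (simp add: xpow_add)
  also have "\<dots> \<in> polys_on C"
    using assms(3,4) by (intro polys_on_sum polys_on_scale xpow_in_polys_on) auto
  finally show ?thesis .
qed

lemma homs_mult: "p \<in> homs j \<Longrightarrow> q \<in> homs k \<Longrightarrow> (\<lambda>x. p x * q x) \<in> homs (j + k)"
  by (rule polys_on_mult[OF _ _ finite_compositions]) (auto simp: compositions_def sum.distrib)

lemma coord_sum_in_homs: "coord_sum \<in> (homs 1 :: (real ^ 'd::finite \<Rightarrow> real) set)"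
proof (rule polys_on_sum)
  fix i :: 'd
  have "(\<lambda>x::real^'d. x $ i) = xpow (\<lambda>j. if j = i then 1 else 0)"
    by (simp add: xpow_def fun_eq_iff if_distrib[of "\<lambda>n. _ ^ n"] cong: if_cong)
  moreover have "(\<lambda>j. if j = i then 1 else 0) \<in> compositions 1"
    by (simp add: compositions_def)
  ultimately show "(\<lambda>x::real^'d. x $ i) \<in> homs 1"
    using xpow_in_polys_on[OF finite_compositions] by (simp only:)
qed

lemma one_in_homs: "(\<lambda>_. 1) \<in> homs 0"
proof -
  have "xpow (\<lambda>_. 0) \<in> homs 0" by (rule xpow_in_polys_on[OF finite_compositions]) (simp add: compositions_def)
  thus ?thesis by (simp add: xpow_0[abs_def])
qed

lemma homs_coord_sum_power: "p \<in> homs j \<Longrightarrow> (\<lambda>x. coord_sum x ^ k * p x) \<in> homs (j + k)"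
proof (induction k)
  case (Suc k)
  from homs_mult[OF coord_sum_in_homs Suc.IH[OF Suc.prems]] show ?case
    by (simp add: mult.assoc)
qed simp

lemma homs_polys_lt: "p \<in> homs k \<Longrightarrow> k < n \<Longrightarrow> p \<in> polys_lt n"
  by (erule polys_on_mono) (auto simp: compositions_def)

lemma homs_polys_le: "p \<in> homs k \<Longrightarrow> k \<le> n \<Longrightarrow> p \<in> polys_le n"
  unfolding polys_le_eq by (erule polys_on_mono) (auto simp: compositions_def)

lemma polys_lt_polys_le: "p \<in> polys_lt n \<Longrightarrow> p \<in> polys_le n"
  unfolding polys_le_eq by (erule polys_on_mono) auto

lemma polys_le_mult: "p \<in> polys_le j \<Longrightarrow> q \<in> polys_le k \<Longrightarrow> (\<lambda>x. p x * q x) \<in> polys_le (j + k)"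
  unfolding polys_le_eq by (rule polys_on_mult) (auto simp: sum.distrib add_mono)

lemma polys_le_coord_sum: "coord_sum \<in> polys_le 1" "(\<lambda>x. 1 - coord_sum x) \<in> polys_le 1" "(\<lambda>_. 1) \<in> polys_le 0"
proof -
  show 1: "coord_sum \<in> polys_le 1" by (rule homs_polys_le[OF coord_sum_in_homs]) simp
  show "(\<lambda>_. 1) \<in> polys_le 0" by (rule homs_polys_le[OF one_in_homs]) simp
  have "(\<lambda>_. 1) \<in> polys_le 1" by (rule homs_polys_le[OF one_in_homs]) simp
  with 1 show "(\<lambda>x. 1 - coord_sum x) \<in> polys_le 1"
    unfolding polys_le_eq by (intro polys_on_diff)
qed

lemma polys_le_power: "p \<in> polys_le 1 \<Longrightarrow> (\<lambda>x. p x ^ k) \<in> polys_le k"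
proof (induction k)
  case 0
  then show ?case by (simp add: polys_le_coord_sum)
next
  case (Suc k)
  from polys_le_mult[OF Suc.prems Suc.IH[OF Suc.prems]] show ?case by simp
qed

lemma polys_le_scale: "p \<in> polys_le n \<Longrightarrow> (\<lambda>x. c * p x) \<in> polys_le n"
  unfolding polys_le_eq by (rule polys_on_scale)

lemma polys_le_sum: "(\<And>i. i \<in> I \<Longrightarrow> f i \<in> polys_le n) \<Longrightarrow> (\<lambda>x. \<Sum>i\<in>I. f i x) \<in> polys_le n"
  unfolding polys_le_eq by (rule polys_on_sum)

lemma polys_le_add: "p \<in> polys_le n \<Longrightarrow> q \<in> polys_le n \<Longrightarrow> (\<lambda>x. p x + q x) \<in> polys_le n"
  unfolding polys_le_eq by (rule polys_on_add)

lemma polys_le_mono: "p \<in> polys_le m \<Longrightarrow> m \<le> n \<Longrightarrow> p \<in> polys_le n"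
  unfolding polys_le_eq by (erule polys_on_mono) auto

lemma polys_lt_iff: "p \<in> polys_lt n \<longleftrightarrow> (if n = 0 then p = (\<lambda>_. 0) else p \<in> polys_le (n - 1))"
proof (cases n)
  case 0
  thus ?thesis by (simp add: polys_on_def)
next
  case (Suc m)
  thus ?thesis by (simp add: polys_le_eq less_Suc_eq_le)
qed

lemma real_polynomial_function_component [intro]: "real_polynomial_function (\<lambda>x::real^'d::finite. x $ i)"
  by (intro real_polynomial_function.intros bounded_linear_vec_nth)

lemma real_polynomial_function_xpow: "real_polynomial_function (xpow \<alpha>)"
  unfolding xpow_def[abs_def]
  by (intro real_polynomial_function_prod real_polynomial_function_power) auto

lemma real_polynomial_function_polys_on: "finite A \<Longrightarrow> p \<in> polys_on A \<Longrightarrow> real_polynomial_function p"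
  unfolding polys_on_def
  by (auto intro!: real_polynomial_function_sum real_polynomial_function.intros(4)
      real_polynomial_function.intros(2) real_polynomial_function_xpow)

lemma real_polynomial_function_polys_le: "p \<in> polys_le n \<Longrightarrow> real_polynomial_function p"
  unfolding polys_le_eq by (rule real_polynomial_function_polys_on[rotated]) auto

text \<open>Restrict p to the line from x0 towards x: the resulting univariate polynomial vanishes
  for all small t > 0, hence identically, and t = 1 is the point x.\<close>

lemma real_polynomial_function_eq_0_if_zero_on_open:
  fixes p :: "'a::real_normed_vector \<Rightarrow> real"
  assumes p: "real_polynomial_function p" and "open S" "x0 \<in> S" "\<And>x. x \<in> S \<Longrightarrow> p x = 0"
  shows "p = (\<lambda>_. 0)"
proof
  fix x
  define q where "q = (\<lambda>t::real. p (x0 + t *\<^sub>R (x - x0)))"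
  have "polynomial_function (\<lambda>t::real. x0 + t *\<^sub>R (x - x0))"
    by (intro polynomial_function_add polynomial_function_const polynomial_function_bounded_linear
        bounded_linear_scaleR_left)
  hence "real_polynomial_function q"
    unfolding q_def using real_polynomial_function_compose[OF _ p] by (simp add: o_def)
  then obtain a n where a: "q = (\<lambda>t. \<Sum>i\<le>n. a i * t ^ i)"
    using real_polynomial_function_iff_sum by blast
  have "((\<lambda>t::real. x0 + t *\<^sub>R (x - x0)) \<longlongrightarrow> x0 + 0 *\<^sub>R (x - x0)) (at 0)"
    by (intro tendsto_intros)
  hence "eventually (\<lambda>t. x0 + t *\<^sub>R (x - x0) \<in> S) (at 0)"
    using assms by (intro topological_tendstoD) auto
  then obtain e where e: "e > 0" "\<And>t. t \<noteq> 0 \<Longrightarrow> dist t 0 < e \<Longrightarrow> x0 + t *\<^sub>R (x - x0) \<in> S"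
    unfolding eventually_at by auto
  have "q t = 0" if "t \<in> {0<..<e}" for t
    unfolding q_def using that by (intro assms(4) e(2)) auto
  hence "{0<..<e} \<subseteq> {t. (\<Sum>i\<le>n. a i * t ^ i) = 0}"
    by (auto simp: a)
  moreover have "infinite {0<..<e}" using e(1) by (simp add: infinite_Ioo)
  ultimately have "infinite {t. (\<Sum>i\<le>n. a i * t ^ i) = 0}" using infinite_super by blast
  hence "\<forall>i\<le>n. a i = 0" using polyfun_finite_roots[of a n] by auto
  hence "q 1 = 0" by (simp add: a)
  thus "p x = 0" by (simp add: q_def)
qed

text \<open>Gram--Schmidt, for function spaces that carry no type-class structure.\<close>

lemma gram_schmidt:
  fixes ip :: "('a \<Rightarrow> real) \<Rightarrow> ('a \<Rightarrow> real) \<Rightarrow> real"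
  assumes add: "\<And>f g. f \<in> S \<Longrightarrow> g \<in> S \<Longrightarrow> (\<lambda>x. f x + g x) \<in> S"
    and scale: "\<And>f c. f \<in> S \<Longrightarrow> (\<lambda>x. c * f x) \<in> S"
    and zero: "(\<lambda>_. 0) \<in> S"
    and ip_add: "\<And>f g h. f \<in> S \<Longrightarrow> g \<in> S \<Longrightarrow> h \<in> S \<Longrightarrow> ip (\<lambda>x. f x + g x) h = ip f h + ip g h"
    and ip_scale: "\<And>f h c. f \<in> S \<Longrightarrow> h \<in> S \<Longrightarrow> ip (\<lambda>x. c * f x) h = c * ip f h"
    and ip_sym: "\<And>f h. f \<in> S \<Longrightarrow> h \<in> S \<Longrightarrow> ip f h = ip h f"
    and ip_pos: "\<And>f. f \<in> S \<Longrightarrow> f \<noteq> (\<lambda>_. 0) \<Longrightarrow> ip f f > 0"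
    and F: "finite F" "F \<subseteq> S"
  shows "\<exists>B. finite B \<and> B \<subseteq> S \<and> (\<forall>f\<in>B. \<forall>g\<in>B. ip f g = (if f = g then 1 else 0)) \<and>
    (\<forall>f\<in>F. \<exists>c. f = (\<lambda>x. \<Sum>b\<in>B. c b * b x))"
  using F
proof (induction F rule: finite_induct)
  case empty
  show ?case by (intro exI[of _ "{}"]) auto
next
  case (insert f F)
  hence "F \<subseteq> S" by simp
  from insert.IH[OF this] obtain B where B': "finite B \<and> B \<subseteq> S \<and>
    (\<forall>f\<in>B. \<forall>g\<in>B. ip f g = (if f = g then 1 else 0)) \<and> (\<forall>f\<in>F. \<exists>c. f = (\<lambda>x. \<Sum>b\<in>B. c b * b x))"
    by (elim exE)
  note B1 = conjunct2[OF conjunct2[OF B']]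
  have B: "finite B" "B \<subseteq> S" using B' by (simp_all only:)
  have ortho: "ip f g = (if f = g then 1 else 0)" if "f \<in> B" "g \<in> B" for f g
    using bspec[OF bspec[OF conjunct1[OF B1] that(1)] that(2)] .
  have span: "\<exists>c. f = (\<lambda>x. \<Sum>b\<in>B. c b * b x)" if "f \<in> F" for f
    by (rule bspec[OF conjunct2[OF B1] that])
  have f: "f \<in> S" using insert.prems by simp
  have sum_in: "(\<lambda>x. \<Sum>b\<in>T. c b * b x) \<in> S" if "T \<subseteq> B" for T and c :: "('a \<Rightarrow> real) \<Rightarrow> real"
    using finite_subset[OF that B(1)] that B(2) by (induction T rule: finite_induct) (auto intro!: zero add scale)
  have ip_zero: "ip (\<lambda>_. 0) h = 0" if "h \<in> S" for h
    using ip_scale[OF zero that, of 0] by simp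
  have ip_sum: "ip (\<lambda>x. \<Sum>b\<in>T. c b * b x) h = (\<Sum>b\<in>T. c b * ip b h)"
    if "T \<subseteq> B" "h \<in> S" for T h and c :: "('a \<Rightarrow> real) \<Rightarrow> real"
    using finite_subset[OF that(1) B(1)] that(1)
  proof (induction T rule: finite_induct)
    case (insert b T)
    have "b \<in> S" using insert.prems B(2) by auto
    thus ?case using insert that(2) sum_in[of T c]
      by (simp add: ip_add scale ip_scale)
  qed (simp add: ip_zero that)
  \<comment> \<open>The factor -1 stands in for subtraction, since S is assumed closed under sums
    and scalings.\<close>
  define g where "g = (\<lambda>x. f x + (-1) * (\<Sum>b\<in>B. ip f b * b x))"
  have g: "g \<in> S" unfolding g_def using f sum_in[of B] by (intro add scale) auto
  have g_orth: "ip g b = 0" if b: "b \<in> B" for b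
  proof -
    have "b \<in> S" using b B(2) by auto
    note m = sum_in[of B "\<lambda>b. ip f b", OF order.refl]
    have "ip g b = ip f b + (-1) * ip (\<lambda>x. \<Sum>b\<in>B. ip f b * b x) b"
      unfolding g_def using ip_add[OF f scale[OF m] \<open>b \<in> S\<close>] ip_scale[OF m \<open>b \<in> S\<close>]
      by (simp only:)
    also have "\<dots> = ip f b - (\<Sum>b'\<in>B. ip f b' * ip b' b)"
      using ip_sum[OF order.refl \<open>b \<in> S\<close>] by simp
    also have "(\<Sum>b'\<in>B. ip f b' * ip b' b) = (\<Sum>b'\<in>B. if b' = b then ip f b else 0)"
      using ortho b by (intro sum.cong) auto
    also have "\<dots> = ip f b" using b B(1) by simp
    finally show ?thesis by simp
  qed
  have f_eq: "f = (\<lambda>x. g x + (\<Sum>b\<in>B. ip f b * b x))" by (simp add: g_def)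
  show ?case
  proof (cases "g = (\<lambda>_. 0)")
    case True
    hence "\<exists>c. f = (\<lambda>x. \<Sum>b\<in>B. c b * b x)" using f_eq by auto
    thus ?thesis using B ortho span by (intro exI[of _ B] conjI ballI) auto
  next
    case False
    define N where "N = sqrt (ip g g)"
    have N: "N > 0" "N * N = ip g g" using ip_pos[OF g False] by (auto simp: N_def)
    define h where "h = (\<lambda>x. (1 / N) * g x)"
    have h: "h \<in> S" unfolding h_def by (intro scale g)
    have hh: "ip h h = 1"
    proof -
      have "ip h h = (1 / N) * ip g h" unfolding h_def by (rule ip_scale) (use g h in \<open>auto simp: h_def\<close>)
      also have "ip g h = ip h g" by (rule ip_sym[OF g h])
      also have "ip h g = (1 / N) * ip g g" unfolding h_def by (rule ip_scale) (use g in auto)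
      finally show ?thesis using N ip_pos[OF g False] by (simp add: field_simps)
    qed
    have h_orth: "ip h b = 0" "ip b h = 0" if "b \<in> B" for b
    proof -
      have b: "b \<in> S" using that B(2) by auto
      show "ip h b = 0" unfolding h_def using ip_scale[OF g b, of "1 / N"] g_orth[OF that] by (simp only: mult_zero_right)
      thus "ip b h = 0" using ip_sym[OF b h] by simp
    qed
    \<comment> \<open>Orthonormal systems are sets here, so h has to be new for the sum over
      \<open>insert h B\<close> to gain a term. If h were in B it would be orthogonal to
      itself.\<close>
    have hB: "h \<notin> B" using h_orth(1)[of h] hh by auto
    have ext: "(\<lambda>x. \<Sum>b\<in>B. c b * b x) = (\<lambda>x. \<Sum>b\<in>insert h B. (c(h := 0)) b * b x)" for c
    proof
      fix x
      have "(\<Sum>b\<in>B. (c(h := 0)) b * b x) = (\<Sum>b\<in>B. c b * b x)"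
        using hB by (intro sum.cong) auto
      thus "(\<Sum>b\<in>B. c b * b x) = (\<Sum>b\<in>insert h B. (c(h := 0)) b * b x)"
        using hB B(1) by simp
    qed
    have "f = (\<lambda>x. \<Sum>b\<in>insert h B. ((\<lambda>b. ip f b)(h := N)) b * b x)"
    proof
      fix x
      have "(\<Sum>b\<in>B. ((\<lambda>b. ip f b)(h := N)) b * b x) = (\<Sum>b\<in>B. ip f b * b x)"
        using hB by (intro sum.cong) auto
      moreover have "f x = N * h x + (\<Sum>b\<in>B. ip f b * b x)"
        using N by (subst f_eq) (simp add: h_def)
      ultimately show "f x = (\<Sum>b\<in>insert h B. ((\<lambda>b. ip f b)(h := N)) b * b x)"
        using hB B(1) by simp
    qed
    hence "\<exists>c. f = (\<lambda>x. \<Sum>b\<in>insert h B. c b * b x)" by blast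
    moreover have "\<exists>c. f' = (\<lambda>x. \<Sum>b\<in>insert h B. c b * b x)" if f': "f' \<in> F" for f'
    proof -
      obtain c where "f' = (\<lambda>x. \<Sum>b\<in>B. c b * b x)" using span[OF f'] by (elim exE)
      from trans[OF this ext] show ?thesis by (intro exI[of _ "c(h := 0)"])
    qed
    ultimately have span': "\<exists>c. f' = (\<lambda>x. \<Sum>b\<in>insert h B. c b * b x)" if "f' \<in> insert f F" for f'
      using that by (elim insertE) (simp_all only:)
    have ortho': "ip f' g' = (if f' = g' then 1 else 0)" if "f' \<in> insert h B" "g' \<in> insert h B" for f' g'
      using that ortho hh h_orth hB by auto
    have "finite (insert h B)" "insert h B \<subseteq> S" using B h by auto
    thus ?thesis
      by (intro exI[of _ "insert h B"] conjI ballI ortho' span')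
  qed
qed

section \<open>Moments of the weight\<close>

text \<open>Covers x = 0, where \<open>0 powr z\<close> is 0 for every z, so the rewriting of
  integrands holds on the boundary of the simplex too.\<close>

lemma powr_add_real_nat: "x \<ge> 0 \<Longrightarrow> x powr (a + real n) = x ^ n * x powr a"
  by (cases "x = 0") (auto simp: powr_add powr_realpow)

lemma real_polynomial_function_coord_sum:
  "real_polynomial_function (\<lambda>x::real^'d::finite. coord_sum x ^ a)"
  "real_polynomial_function (\<lambda>x::real^'d::finite. (1 - coord_sum x) ^ b)"
  by (intro real_polynomial_function_power real_polynomial_function_diff real_polynomial_function_sum
      real_polynomial_function.intros(2); force)+

locale simplex_weight =
  fixes \<kappa> :: "real ^ 'd::finite" and \<mu> \<nu> :: real
  assumes kappa_nonneg: "\<kappa> $ i \<ge> 0" and mu_nonneg: "\<mu> \<ge> 0" and nu_pos: "\<nu> > 0"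
begin

text \<open>The sum of the Dirichlet parameters \<kappa>_i + 1/2 of the coordinates. Together with
  |x|^\<nu> it makes A + \<nu> and M the Beta parameters of the radial variable.\<close>

definition A :: real where "A = gamma_sum \<kappa> + real CARD('d) / 2"
definition M :: real where "M = \<mu> + 1 / 2"
definition lam :: real where "lam = lambda_par \<kappa> \<mu> \<nu>"
abbreviation U :: "real ^ 'd \<Rightarrow> real" where "U \<equiv> U_weight \<kappa> \<mu> \<nu>"
text \<open>The expectation under the normalized weight. Inner products become E of a product, so a
  single linear functional and its moments carry the whole argument.\<close>

definition E :: "(real ^ 'd \<Rightarrow> real) \<Rightarrow> real" where "E f = inner_T U f (\<lambda>_. 1)"

lemma inner_T_eq_E: "inner_T U f g = E (\<lambda>x. f x * g x)"
  by (simp add: inner_T_def E_def)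

lemma A_eq: "A = (\<Sum>i\<in>UNIV. \<kappa> $ i + 1 / 2)"
  by (simp add: A_def gamma_sum_def sum.distrib)

lemma A_pos: "A > 0"
  unfolding A_eq using kappa_nonneg by (intro sum_pos) (auto intro: add_nonneg_pos)

lemma M_pos: "M > 0" using mu_nonneg by (simp add: M_def)

lemma lam_eq: "lam + 1 = A + \<nu> + M"
  by (simp add: lam_def lambda_par_def A_def M_def field_simps)

lemma A_ge_half: "A \<ge> 1 / 2"
proof -
  have "real CARD('d) \<ge> 1" by (simp add: Suc_leI)
  moreover have "gamma_sum \<kappa> \<ge> 0" unfolding gamma_sum_def by (intro sum_nonneg kappa_nonneg)
  ultimately show ?thesis unfolding A_def by linarith
qed

lemma lam_pos: "lam > 0"
  using lam_eq A_ge_half mu_nonneg nu_pos by (simp add: M_def)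

lemma pochhammer_nonzero [simp]:
  "pochhammer A n \<noteq> 0" "pochhammer (A + \<nu>) n \<noteq> 0" "pochhammer M n \<noteq> 0"
  "pochhammer (lam + 1) n \<noteq> 0" "pochhammer (\<kappa> $ i + 1 / 2) n \<noteq> 0"
  using pochhammer_pos[of A n] pochhammer_pos[of "A + \<nu>" n] pochhammer_pos[of M n]
    pochhammer_pos[of "lam + 1" n] pochhammer_pos[of "\<kappa> $ i + 1 / 2" n]
    A_pos nu_pos M_pos lam_pos kappa_nonneg[of i] by auto

lemma moment_integral:
  "has_bochner_integral lborel (\<lambda>x. indicator simplexT x *
      (xpow \<alpha> x * coord_sum x ^ a * (1 - coord_sum x) ^ b * U x))
    ((\<Prod>i\<in>UNIV. Gamma (\<kappa> $ i + 1 / 2 + real (\<alpha> i))) / Gamma (A + real (multideg \<alpha>)) *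
      Beta (A + \<nu> + real (multideg \<alpha> + a)) (M + real b))"
proof -
  have p: "\<kappa> $ i + 1 / 2 + real (\<alpha> i) > 0" for i using kappa_nonneg[of i] by simp
  have "has_bochner_integral lborel (\<lambda>x::real^'d. indicator simplexT x *
      ((\<Prod>i\<in>UNIV. x $ i powr (\<kappa> $ i + 1 / 2 + real (\<alpha> i) - 1)) * coord_sum x powr (\<nu> + real a) *
        (1 - coord_sum x) powr (M + real b - 1)))
    ((\<Prod>i\<in>UNIV. Gamma (\<kappa> $ i + 1 / 2 + real (\<alpha> i))) / Gamma (\<Sum>i\<in>UNIV. \<kappa> $ i + 1 / 2 + real (\<alpha> i)) *
      Beta ((\<Sum>i\<in>UNIV. \<kappa> $ i + 1 / 2 + real (\<alpha> i)) + (\<nu> + real a)) (M + real b))"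
    by (rule dirichlet_integral) (use p nu_pos M_pos in auto)
  also have "(\<Sum>i\<in>UNIV. \<kappa> $ i + 1 / 2 + real (\<alpha> i)) = A + real (multideg \<alpha>)"
    by (simp add: A_eq sum.distrib)
  also have "A + real (multideg \<alpha>) + (\<nu> + real a) = A + \<nu> + real (multideg \<alpha> + a)" by simp
  also have "(\<lambda>x::real^'d. indicator simplexT x *
      ((\<Prod>i\<in>UNIV. x $ i powr (\<kappa> $ i + 1 / 2 + real (\<alpha> i) - 1)) * coord_sum x powr (\<nu> + real a) *
        (1 - coord_sum x) powr (M + real b - 1))) = (\<lambda>x. indicator simplexT x *
      (xpow \<alpha> x * coord_sum x ^ a * (1 - coord_sum x) ^ b * U x))"
  proof
    fix x :: "real^'d"
    show "indicator simplexT x *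
      ((\<Prod>i\<in>UNIV. x $ i powr (\<kappa> $ i + 1 / 2 + real (\<alpha> i) - 1)) * coord_sum x powr (\<nu> + real a) *
        (1 - coord_sum x) powr (M + real b - 1)) = indicator simplexT x *
      (xpow \<alpha> x * coord_sum x ^ a * (1 - coord_sum x) ^ b * U x)"
    proof (cases "x \<in> simplexT")
      case True
      hence x: "\<And>i. x $ i \<ge> 0" "coord_sum x \<ge> 0" "1 - coord_sum x \<ge> 0"
        by (auto simp: simplexT_def intro: sum_nonneg)
      have 1: "x $ i powr (\<kappa> $ i + 1 / 2 + real (\<alpha> i) - 1) = x $ i ^ \<alpha> i * x $ i powr (\<kappa> $ i - 1 / 2)" for i
        using powr_add_real_nat[OF x(1), of i "\<kappa> $ i - 1 / 2" "\<alpha> i"] by (simp add: algebra_simps)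
      have 2: "(1 - coord_sum x) powr (M + real b - 1) = (1 - coord_sum x) ^ b * (1 - coord_sum x) powr (\<mu> - 1 / 2)"
        using powr_add_real_nat[OF x(3), of "\<mu> - 1 / 2" b] by (simp add: M_def algebra_simps)
      show ?thesis
        unfolding 1 2 powr_add_real_nat[OF x(2)] U_weight_def xpow_def prod.distrib by simp
    qed simp
  qed
  finally show ?thesis .
qed

definition Z :: real where "Z = (LINT x:simplexT|lborel. U x)"

lemma E_eq: "E f = (LINT x|lborel. indicator simplexT x * (f x * U x)) / Z"
  by (simp add: E_def inner_T_def Z_def set_lebesgue_integral_def)

lemma integrable_U: "integrable lborel (\<lambda>x. indicator simplexT x * U x)"
  using moment_integral[of "\<lambda>_. 0" 0 0] by (auto simp: xpow_0 has_bochner_integral_iff)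

lemma Z_eq: "Z = (\<Prod>i\<in>UNIV. Gamma (\<kappa> $ i + 1 / 2)) / Gamma A * Beta (A + \<nu>) M"
  using moment_integral[of "\<lambda>_. 0" 0 0]
  by (auto simp: xpow_0 has_bochner_integral_iff Z_def set_lebesgue_integral_def)

lemma Z_pos: "Z > 0"
  unfolding Z_eq Beta_def using kappa_nonneg A_pos nu_pos M_pos
  by (intro mult_pos_pos divide_pos_pos prod_pos Gamma_real_pos) (auto intro: add_nonneg_pos)

text \<open>Dividing by the total mass turns Gamma quotients into Pochhammer symbols. The result is
  a face factor depending on \<alpha> times a radial factor in which \<alpha> appears only through
  its degree.\<close>

lemma E_moment:
  "E (\<lambda>x. xpow \<alpha> x * coord_sum x ^ a * (1 - coord_sum x) ^ b) =
    (\<Prod>i\<in>UNIV. pochhammer (\<kappa> $ i + 1 / 2) (\<alpha> i)) / pochhammer A (multideg \<alpha>) *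
    (pochhammer (A + \<nu>) (multideg \<alpha> + a) * pochhammer M b / pochhammer (lam + 1) (multideg \<alpha> + a + b))"
proof -
  have *: "Gamma (z + real n) = Gamma z * pochhammer z n" "Gamma z > 0" if "z > 0" for z n
  proof -
    have "z \<notin> \<int>\<^sub>\<le>\<^sub>0" using that by (auto elim!: nonpos_Ints_cases)
    moreover show "Gamma z > 0" using that by (rule Gamma_real_pos)
    ultimately show "Gamma (z + real n) = Gamma z * pochhammer z n" by (simp add: pochhammer_Gamma)
  qed
  have k: "\<kappa> $ i + 1 / 2 > 0" for i using kappa_nonneg[of i] by simp
  have B: "Beta (A + \<nu>) M > 0"
    unfolding Beta_def using A_pos nu_pos M_pos by (intro divide_pos_pos mult_pos_pos Gamma_real_pos) auto
  have P: "(\<Prod>i\<in>UNIV. Gamma (\<kappa> $ i + 1 / 2)) > 0" using *(2) k by (intro prod_pos) auto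
  have cancel: "P * Q / (G * R) * (B * S) / (P / G * B) = Q / R * S"
    if "P > 0" "G > 0" "B > 0" for P Q G R B S :: real
    using that by simp
  have "(LINT x|lborel. indicator simplexT x *
      (xpow \<alpha> x * coord_sum x ^ a * (1 - coord_sum x) ^ b * U x)) =
    (\<Prod>i\<in>UNIV. Gamma (\<kappa> $ i + 1 / 2 + real (\<alpha> i))) / Gamma (A + real (multideg \<alpha>)) *
      Beta (A + \<nu> + real (multideg \<alpha> + a)) (M + real b)"
    using moment_integral by (rule has_bochner_integral_integral_eq)
  also have "(\<Prod>i\<in>UNIV. Gamma (\<kappa> $ i + 1 / 2 + real (\<alpha> i))) =
      (\<Prod>i\<in>UNIV. Gamma (\<kappa> $ i + 1 / 2)) * (\<Prod>i\<in>UNIV. pochhammer (\<kappa> $ i + 1 / 2) (\<alpha> i))"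
    by (simp only: *(1)[OF k] prod.distrib)
  also have "Gamma (A + real (multideg \<alpha>)) = Gamma A * pochhammer A (multideg \<alpha>)"
    by (rule *(1)[OF A_pos])
  also have "Beta (A + \<nu> + real (multideg \<alpha> + a)) (M + real b) = Beta (A + \<nu>) M *
    (pochhammer (A + \<nu>) (multideg \<alpha> + a) * pochhammer M b / pochhammer (A + \<nu> + M) (multideg \<alpha> + a + b))"
    by (rule Beta_pochhammer) (use A_pos nu_pos M_pos in auto)
  finally show ?thesis
    unfolding E_eq Z_eq lam_eq using cancel[OF P *(2)[OF A_pos] B] by (simp only:)
qed

section \<open>Linearity and positivity of the expectation on polynomials\<close>

lemma simplexT_compact: "compact (simplexT :: (real^'d) set)"
  unfolding compact_eq_bounded_closed
proof
  have "norm x \<le> 1" if "x \<in> simplexT" for x :: "real^'d"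
  proof -
    have "norm x \<le> (\<Sum>i\<in>UNIV. \<bar>x $ i\<bar>)" by (rule norm_le_l1_cart)
    thus ?thesis using that by (simp add: simplexT_def)
  qed
  thus "bounded (simplexT :: (real^'d) set)" by (auto simp: bounded_iff)
  have "simplexT = (\<Inter>i. {x::real^'d. 0 \<le> x $ i}) \<inter> {x. coord_sum x \<le> 1}"
    by (auto simp: simplexT_def)
  also have "closed \<dots>"
    by (intro closed_Int closed_INT ballI closed_Collect_le continuous_intros)
  finally show "closed (simplexT :: (real^'d) set)" .
qed

lemma integrable_poly:
  assumes "real_polynomial_function f"
  shows "integrable lborel (\<lambda>x. indicator simplexT x * (f x * U x))"
proof -
  have cont: "continuous_on UNIV f"
    using assms by (simp add: continuous_at_imp_continuous_on continuous_real_polymonial_function)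
  obtain B where B: "\<And>x. x \<in> simplexT \<Longrightarrow> \<bar>f x\<bar> \<le> B"
    using compact_imp_bounded[OF compact_continuous_image[OF continuous_on_subset[OF cont] simplexT_compact]]
    by (auto simp: bounded_iff)
  have [measurable]: "f \<in> borel_measurable borel" by (rule borel_measurable_continuous_onI[OF cont])
  have [measurable]: "(\<lambda>x. indicator simplexT x * U x) \<in> borel_measurable borel"
    using borel_measurable_integrable[OF integrable_U] by simp
  have "integrable lborel (\<lambda>x. f x * (indicator simplexT x * U x))"
  proof (rule Bochner_Integration.integrable_bound)
    show "integrable lborel (\<lambda>x. B * (indicator simplexT x * U x))"
      by (intro integrable_mult_right integrable_U)
    show "AE x in lborel. norm (f x * (indicator simplexT x * U x)) \<le> norm (B * (indicator simplexT x * U x))"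
    proof (rule AE_I2)
      fix x
      show "norm (f x * (indicator simplexT x * U x)) \<le> norm (B * (indicator simplexT x * U x))"
        using B[of x] by (cases "x \<in> simplexT") (auto simp: abs_mult intro!: mult_right_mono)
    qed
  qed measurable
  thus ?thesis by (simp add: mult_ac)
qed

lemma E_add:
  assumes "real_polynomial_function f" "real_polynomial_function g"
  shows "E (\<lambda>x. f x + g x) = E f + E g"
  unfolding E_eq using integrable_poly[OF assms(1)] integrable_poly[OF assms(2)]
  by (simp add: distrib_left distrib_right add_divide_distrib)

lemma E_scale: "E (\<lambda>x. c * f x) = c * E f"
proof -
  have "(\<lambda>x. indicator simplexT x * (c * f x * U x)) = (\<lambda>x. c * (indicator simplexT x * (f x * U x)))"
    by (simp add: mult_ac)
  thus ?thesis unfolding E_eq by simp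
qed

lemma E_zero: "E (\<lambda>x. 0) = 0"
  by (simp add: E_eq)

lemma E_sum:
  assumes "finite I" "\<And>i. i \<in> I \<Longrightarrow> real_polynomial_function (f i)"
  shows "E (\<lambda>x. \<Sum>i\<in>I. f i x) = (\<Sum>i\<in>I. E (f i))"
  using assms
  by (induction I rule: finite_induct) (simp_all add: E_zero E_add real_polynomial_function_sum)

lemma E_sum_scale:
  assumes "finite I" "\<And>i. i \<in> I \<Longrightarrow> real_polynomial_function (f i)"
  shows "E (\<lambda>x. \<Sum>i\<in>I. c i * f i x) = (\<Sum>i\<in>I. c i * E (f i))"
  using assms by (subst E_sum) (auto simp: E_scale intro!: real_polynomial_function.intros(4) real_polynomial_function.intros(2))

text \<open>The weight is strictly positive on the open interior V, so a vanishing integral forces p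
  = 0 almost everywhere on V. The zero set of p is closed, hence contains V, and a polynomial
  vanishing on a nonempty open set is zero.\<close>

lemma E_pos_def:
  assumes p: "real_polynomial_function p" and "p \<noteq> (\<lambda>_. 0)"
  shows "E (\<lambda>x. p x * p x) > 0"
proof -
  have pp: "real_polynomial_function (\<lambda>x. p x * p x)" using p by (intro real_polynomial_function.intros(4))
  have nonneg: "indicator simplexT x * (p x * p x * U x) \<ge> 0" for x
  proof (cases "x \<in> simplexT")
    case True
    hence "U x \<ge> 0" by (auto simp: U_weight_def simplexT_def intro!: mult_nonneg_nonneg prod_nonneg)
    thus ?thesis by simp
  qed simp
  define V where "V = (\<Inter>i. {x::real^'d. 0 < x $ i}) \<inter> {x. coord_sum x < 1}"
  have V: "open V" unfolding V_def
    by (intro open_Int open_INT ballI open_Collect_less continuous_intros) auto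
  define x0 :: "real^'d" where "x0 = (\<chi> i. 1 / (2 * real CARD('d)))"
  have x0: "x0 \<in> V" by (auto simp: V_def x0_def)
  have U_pos: "U x > 0" "x \<in> simplexT" if "x \<in> V" for x
  proof -
    have x: "\<And>i. x $ i > 0" "coord_sum x < 1" using that by (auto simp: V_def)
    moreover have "coord_sum x > 0" using x by (intro sum_pos) auto
    moreover have "x $ i \<noteq> 0" for i using x(1)[of i] by simp
    ultimately show "U x > 0" "x \<in> simplexT"
      by (auto simp: U_weight_def simplexT_def less_imp_le intro!: mult_pos_pos prod_pos)
  qed
  have "(LINT x|lborel. indicator simplexT x * (p x * p x * U x)) \<noteq> 0"
  proof
    assume "(LINT x|lborel. indicator simplexT x * (p x * p x * U x)) = 0"
    hence "AE x in lborel. indicator simplexT x * (p x * p x * U x) = 0"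
      using integral_nonneg_eq_0_iff_AE[OF integrable_poly[OF pp]] nonneg by simp
    hence "AE x in lborel. x \<in> V \<longrightarrow> x \<in> {x. p x = 0}"
    proof eventually_elim
      case (elim x)
      thus ?case using U_pos[of x] by auto
    qed
    hence AE: "AE x\<in>V in lebesgue. x \<in> {x. p x = 0}" by (rule AE_completion)
    have "continuous_on UNIV p"
      using p by (simp add: continuous_at_imp_continuous_on continuous_real_polymonial_function)
    hence "closed {x. p x = 0}" by (intro closed_Collect_eq continuous_intros)
    hence "p x = 0" if "x \<in> V" for x
      using mem_closed_if_AE_lebesgue_open[OF V _ AE that] by simp
    hence "p = (\<lambda>_. 0)" by (rule real_polynomial_function_eq_0_if_zero_on_open[OF p V x0])
    with assms(2) show False by contradiction
  qed
  moreover have "(LINT x|lborel. indicator simplexT x * (p x * p x * U x)) \<ge> 0"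
    using nonneg by (intro Bochner_Integration.integral_nonneg)
  ultimately show ?thesis unfolding E_eq using Z_pos by simp
qed

text \<open>On homogeneous polynomials of degree \<open>N\<close>, \<open>L N\<close> is the normalized integral over the face \<open>|x| = 1\<close>
  with weight \<open>\<Prod>x\<^sub>i\<^bsup>\<kappa>\<^sub>i - 1/2\<^esup>\<close>, so it ignores factors \<open>|x|\<close>.\<close>

definition L :: "nat \<Rightarrow> (real ^ 'd \<Rightarrow> real) \<Rightarrow> real" where
  "L N p = E p * pochhammer (lam + 1) N / pochhammer (A + \<nu>) N"

text \<open>By linearity from \<open>E_moment\<close>: all monomials of p have degree N, so the
  radial factor comes out of the sum. Setting a = b = 0 then identifies the remaining factor as
  \<open>L N p\<close>.\<close>

lemma E_homs_aux:
  assumes "p \<in> homs N"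
  shows "\<exists>l. \<forall>a b. E (\<lambda>x. p x * coord_sum x ^ a * (1 - coord_sum x) ^ b) =
    l * (pochhammer (A + \<nu>) (N + a) * pochhammer M b / pochhammer (lam + 1) (N + a + b))"
proof -
  obtain c where c: "p = (\<lambda>x. \<Sum>\<alpha>\<in>compositions N. c \<alpha> * xpow \<alpha> x)"
    using assms by (auto simp: polys_on_def)
  have "E (\<lambda>x. p x * coord_sum x ^ a * (1 - coord_sum x) ^ b) =
      (\<Sum>\<alpha>\<in>compositions N. c \<alpha> * ((\<Prod>i\<in>UNIV. pochhammer (\<kappa> $ i + 1 / 2) (\<alpha> i)) / pochhammer A (multideg \<alpha>))) *
    (pochhammer (A + \<nu>) (N + a) * pochhammer M b / pochhammer (lam + 1) (N + a + b))" for a b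
  proof -
    have "E (\<lambda>x. p x * coord_sum x ^ a * (1 - coord_sum x) ^ b) =
        E (\<lambda>x. \<Sum>\<alpha>\<in>compositions N. c \<alpha> * (xpow \<alpha> x * coord_sum x ^ a * (1 - coord_sum x) ^ b))"
      unfolding c by (simp add: sum_distrib_right mult.assoc)
    also have "\<dots> = (\<Sum>\<alpha>\<in>compositions N. c \<alpha> * E (\<lambda>x. xpow \<alpha> x * coord_sum x ^ a * (1 - coord_sum x) ^ b))"
      by (intro E_sum_scale real_polynomial_function.intros(4) real_polynomial_function_xpow
          real_polynomial_function_coord_sum finite_compositions)
    also have "\<dots> = (\<Sum>\<alpha>\<in>compositions N. c \<alpha> * ((\<Prod>i\<in>UNIV. pochhammer (\<kappa> $ i + 1 / 2) (\<alpha> i)) / pochhammer A (multideg \<alpha>)) *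
      (pochhammer (A + \<nu>) (N + a) * pochhammer M b / pochhammer (lam + 1) (N + a + b)))"
      unfolding E_moment by (intro sum.cong refl) (simp add: compositions_def)
    finally show ?thesis by (simp only: sum_distrib_right)
  qed
  thus ?thesis by blast
qed

lemma E_homs:
  assumes "p \<in> homs N"
  shows "E (\<lambda>x. p x * coord_sum x ^ a * (1 - coord_sum x) ^ b) =
    L N p * (pochhammer (A + \<nu>) (N + a) * pochhammer M b / pochhammer (lam + 1) (N + a + b))"
proof -
  obtain l where l: "\<And>a b. E (\<lambda>x. p x * coord_sum x ^ a * (1 - coord_sum x) ^ b) =
    l * (pochhammer (A + \<nu>) (N + a) * pochhammer M b / pochhammer (lam + 1) (N + a + b))"
    using E_homs_aux[OF assms] by blast
  have "L N p = l" using l[of 0 0] by (simp add: L_def)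
  thus ?thesis using l by simp
qed

lemma L_coord_sum_power:
  assumes "p \<in> homs N"
  shows "L (N + k) (\<lambda>x. coord_sum x ^ k * p x) = L N p"
  using E_homs[OF assms, of k 0] by (simp add: L_def mult.commute)

lemma L_xpow:
  assumes "\<alpha> \<in> compositions N"
  shows "L N (xpow \<alpha>) = (\<Prod>i\<in>UNIV. pochhammer (\<kappa> $ i + 1 / 2) (\<alpha> i)) / pochhammer A N"
  using E_moment[of \<alpha> 0 0] assms by (simp add: L_def compositions_def)

lemma L_eq_0_iff: "L N p = 0 \<longleftrightarrow> E p = 0"
  by (simp add: L_def)

lemma L_add:
  assumes "p \<in> homs N" "q \<in> homs N"
  shows "L N (\<lambda>x. p x + q x) = L N p + L N q"
  using assms by (simp add: L_def E_add real_polynomial_function_polys_on[OF finite_compositions] add_divide_distrib distrib_right)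

lemma L_scale: "L N (\<lambda>x. c * p x) = c * L N p"
  by (simp add: L_def E_scale)

lemma L_sum_scale:
  assumes "finite I" "\<And>i. i \<in> I \<Longrightarrow> f i \<in> homs N"
  shows "L N (\<lambda>x. \<Sum>i\<in>I. c i * f i x) = (\<Sum>i\<in>I. c i * L N (f i))"
proof -
  have "E (\<lambda>x. \<Sum>i\<in>I. c i * f i x) = (\<Sum>i\<in>I. c i * E (f i))"
    using assms by (intro E_sum_scale real_polynomial_function_polys_on[OF finite_compositions])
  thus ?thesis by (simp add: L_def sum_distrib_right sum_divide_distrib mult.assoc)
qed

end

section \<open>A Funk--Hecke formula\<close>

lemma prod_fps_exp:
  fixes y :: "'d::finite \<Rightarrow> real"
  shows "(\<Prod>i\<in>UNIV. fps_exp (y i)) = fps_exp (\<Sum>i\<in>UNIV. y i)"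
proof -
  have "(\<Prod>i\<in>I. fps_exp (y i)) = fps_exp (\<Sum>i\<in>I. y i)" if "finite I" for I
    using that by (induction I rule: finite_induct) (simp_all add: fps_exp_add_mult)
  thus ?thesis by simp
qed

context simplex_weight
begin

text \<open>These are the coefficients left by the s-integration: averaging the 2k-th power of
  \<Sum> sqrt(x_i y_i) s_i and dividing by (2k)! gives hk k x y / 4^k, see
  \<open>Ps_even_hk\<close>.\<close>

definition hcoef :: "('d \<Rightarrow> nat) \<Rightarrow> real" where
  "hcoef \<beta> = (\<Prod>i\<in>UNIV. 1 / (fact (\<beta> i) * pochhammer (\<kappa> $ i + 1 / 2) (\<beta> i)))"

definition hk :: "nat \<Rightarrow> real ^ 'd \<Rightarrow> real ^ 'd \<Rightarrow> real" where
  "hk k x y = (\<Sum>\<beta>\<in>compositions k. hcoef \<beta> * xpow \<beta> y * xpow \<beta> x)"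

lemma hk_sym: "hk k x y = hk k y x"
  by (simp add: hk_def mult_ac)

lemma hk_homs: "(\<lambda>x. hk k x y) \<in> homs k"
  unfolding hk_def by (intro polys_on_sum polys_on_scale xpow_in_polys_on finite_compositions)

lemma xpow_homs: "\<alpha> \<in> compositions k \<Longrightarrow> xpow \<alpha> \<in> homs k"
  by (intro xpow_in_polys_on finite_compositions)

lemma rpf_homs: "p \<in> homs k \<Longrightarrow> real_polynomial_function p"
  by (rule real_polynomial_function_polys_on[OF finite_compositions])

lemma L_hk:
  assumes "p \<in> homs j"
  shows "L (k + j) (\<lambda>x. hk k x y * p x) =
    (\<Sum>\<beta>\<in>compositions k. hcoef \<beta> * xpow \<beta> y * L (k + j) (\<lambda>x. xpow \<beta> x * p x))"
proof -
  have "L (k + j) (\<lambda>x. hk k x y * p x) =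
    L (k + j) (\<lambda>x. \<Sum>\<beta>\<in>compositions k. (hcoef \<beta> * xpow \<beta> y) * (xpow \<beta> x * p x))"
    by (simp add: hk_def sum_distrib_right mult.assoc)
  also have "\<dots> = (\<Sum>\<beta>\<in>compositions k. (hcoef \<beta> * xpow \<beta> y) * L (k + j) (\<lambda>x. xpow \<beta> x * p x))"
    using assms by (intro L_sum_scale finite_compositions homs_mult xpow_homs)
  finally show ?thesis .
qed

text \<open>Self-adjointness on the face. Since \<open>hk k\<close> is a finite sum of products of
  monomials, both sides expand to the same sum of products of moments.\<close>

lemma L_hk_fubini:
  assumes p: "p \<in> homs j" and u: "u \<in> homs i"
  shows "L (k + i) (\<lambda>y. L (k + j) (\<lambda>x. hk k x y * p x) * u y) =
    L (k + j) (\<lambda>x. L (k + i) (\<lambda>y. hk k y x * u y) * p x)"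
proof -
  have aux: "L (k + i) (\<lambda>y. L (k + j) (\<lambda>x. hk k x y * p x) * u y) =
      (\<Sum>\<beta>\<in>compositions k. hcoef \<beta> * L (k + j) (\<lambda>x. xpow \<beta> x * p x) * L (k + i) (\<lambda>y. xpow \<beta> y * u y))"
    if p: "p \<in> homs j" and u: "u \<in> homs i" for p u i j
  proof -
    have "L (k + i) (\<lambda>y. L (k + j) (\<lambda>x. hk k x y * p x) * u y) =
      L (k + i) (\<lambda>y. \<Sum>\<beta>\<in>compositions k. (hcoef \<beta> * L (k + j) (\<lambda>x. xpow \<beta> x * p x)) * (xpow \<beta> y * u y))"
      unfolding L_hk[OF p] sum_distrib_right by (simp add: mult_ac)
    also have "\<dots> = (\<Sum>\<beta>\<in>compositions k. (hcoef \<beta> * L (k + j) (\<lambda>x. xpow \<beta> x * p x)) * L (k + i) (\<lambda>y. xpow \<beta> y * u y))"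
      using u by (intro L_sum_scale finite_compositions homs_mult xpow_homs)
    finally show ?thesis .
  qed
  show ?thesis unfolding aux[OF p u] aux[OF u p] by (intro sum.cong refl) simp
qed

text \<open>In the expansion over \<beta>, coordinate i contributes (\<kappa>_i + 1/2 +
  \<beta>_i)_(\<alpha>_i) y_i^(\<beta>_i) / \<beta>_i!. Its generating series is an exponential
  times a polynomial of degree at most \<alpha>_i, so the product over i is the exponential of |y|
  times a series whose top coefficient is the monomial of \<alpha>. The q l are the coefficients of
  that series; they do not depend on k.\<close>

lemma L_hk_xpow:
  assumes \<alpha>: "\<alpha> \<in> compositions j"
  shows "\<exists>q. (\<forall>l. q l \<in> homs l) \<and> q j = xpow \<alpha> \<and> (\<forall>l>j. q l = (\<lambda>_. 0)) \<and>
    (\<forall>k y. L (k + j) (\<lambda>x. hk k x y * xpow \<alpha> x) =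
      (\<Sum>l\<le>k. q l y * coord_sum y ^ (k - l) / fact (k - l)) / pochhammer A (k + j))"
proof -
  have "\<exists>p. \<forall>i. p i (\<alpha> i) = 1 \<and> (\<forall>l>\<alpha> i. p i l = 0) \<and>
    (\<forall>\<beta>. pochhammer (\<kappa> $ i + 1 / 2 + real \<beta>) (\<alpha> i) / fact \<beta> = (\<Sum>l\<le>\<beta>. p i l / fact (\<beta> - l)))"
    by (intro choice allI pochhammer_shift_expansion)
  then obtain p where p0: "\<forall>i. p i (\<alpha> i) = 1 \<and> (\<forall>l>\<alpha> i. p i l = 0) \<and>
    (\<forall>\<beta>. pochhammer (\<kappa> $ i + 1 / 2 + real \<beta>) (\<alpha> i) / fact \<beta> = (\<Sum>l\<le>\<beta>. p i l / fact (\<beta> - l)))"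
    by (elim exE)
  note p = p0[THEN spec, THEN conjunct1] p0[THEN spec, THEN conjunct2, THEN conjunct1, rule_format]
    p0[THEN spec, THEN conjunct2, THEN conjunct2, THEN spec]
  define q where "q = (\<lambda>l y. \<Sum>\<beta>\<in>compositions l. (\<Prod>i\<in>UNIV. p i (\<beta> i)) * xpow \<beta> y)"
  have q_homs: "q l \<in> homs l" for l
    unfolding q_def by (intro polys_on_sum polys_on_scale xpow_homs)
  \<comment> \<open>The product is nonzero only if \<beta>_i \<le> \<alpha>_i for all i. At degree j
    or more this leaves \<beta> = \<alpha> alone, which fixes the top part of q.\<close>
  have vanish: "(\<Prod>i\<in>UNIV. p i (\<beta> i)) = 0" if deg: "multideg \<beta> \<ge> j" and ne: "\<beta> \<noteq> \<alpha>" for \<beta>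
  proof -
    have "\<exists>i. \<beta> i > \<alpha> i"
    proof (rule ccontr)
      assume "\<not> (\<exists>i. \<beta> i > \<alpha> i)"
      hence le: "\<beta> i \<le> \<alpha> i" for i by (simp add: not_less)
      obtain i where "\<beta> i \<noteq> \<alpha> i" using ne by auto
      with le[of i] have "\<beta> i < \<alpha> i" by simp
      hence "multideg \<beta> < multideg \<alpha>" using le by (intro sum_strict_mono_ex1) auto
      thus False using deg \<alpha> by (simp add: compositions_def)
    qed
    thus ?thesis using p(2) by auto
  qed
  have q_top: "q j = xpow \<alpha>"
  proof
    fix y
    have "q j y = (\<Sum>\<beta>\<in>compositions j. if \<beta> = \<alpha> then xpow \<alpha> y else 0)"
      unfolding q_def
    proof (intro sum.cong refl)
      fix \<beta> :: "'d \<Rightarrow> nat" assume "\<beta> \<in> compositions j"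
      thus "(\<Prod>i\<in>UNIV. p i (\<beta> i)) * xpow \<beta> y = (if \<beta> = \<alpha> then xpow \<alpha> y else 0)"
        using vanish[of \<beta>] p(1) by (auto simp: compositions_def)
    qed
    thus "q j y = xpow \<alpha> y" using \<alpha> by simp
  qed
  have q_above: "q l = (\<lambda>_. 0)" if "l > j" for l
  proof
    fix y
    have "(\<Prod>i\<in>UNIV. p i (\<beta> i)) * xpow \<beta> y = 0" if "\<beta> \<in> compositions l" for \<beta>
      using vanish[of \<beta>] that \<open>l > j\<close> \<alpha> by (auto simp: compositions_def)
    thus "q l y = 0" unfolding q_def by (intro sum.neutral ballI)
  qed
  have "L (k + j) (\<lambda>x. hk k x y * xpow \<alpha> x) =
      (\<Sum>l\<le>k. q l y * coord_sum y ^ (k - l) / fact (k - l)) / pochhammer A (k + j)" for k y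
  proof -
    \<comment> \<open>The series variable counts the degree in y; the actual coordinates of y sit in
      the coefficients.\<close>
    define P where "P = (\<lambda>i. Abs_fps (\<lambda>l. p i l * (y $ i) ^ l))"
    define F where "F = (\<lambda>i. Abs_fps (\<lambda>b. pochhammer (\<kappa> $ i + 1 / 2 + real b) (\<alpha> i) / fact b * (y $ i) ^ b))"
    have F: "F i = P i * fps_exp (y $ i)" for i
    proof (rule fps_ext)
      fix n
      have "fps_nth (P i * fps_exp (y $ i)) n =
          (\<Sum>l=0..n. p i l * (y $ i) ^ l * ((y $ i) ^ (n - l) / fact (n - l)))"
        by (simp add: fps_mult_nth P_def)
      also have "\<dots> = (\<Sum>l\<le>n. (p i l / fact (n - l)) * (y $ i) ^ n)"
        by (intro sum.cong) (auto simp: power_add[symmetric])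
      finally show "fps_nth (F i) n = fps_nth (P i * fps_exp (y $ i)) n"
        by (simp add: F_def p(3) sum_distrib_right)
    qed
    have "(\<Sum>\<beta>\<in>compositions k. hcoef \<beta> * xpow \<beta> y * L (k + j) (\<lambda>x. xpow \<beta> x * xpow \<alpha> x)) =
      (\<Sum>\<beta>\<in>compositions k. (\<Prod>i\<in>UNIV. fps_nth (F i) (\<beta> i)) / pochhammer A (k + j))"
    proof (intro sum.cong refl)
      fix \<beta> :: "'d \<Rightarrow> nat" assume \<beta>: "\<beta> \<in> compositions k"
      have "(\<lambda>i. \<beta> i + \<alpha> i) \<in> compositions (k + j)" using \<alpha> \<beta> by (simp add: compositions_def sum.distrib)
      hence eqL: "L (k + j) (\<lambda>x. xpow \<beta> x * xpow \<alpha> x) =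
        (\<Prod>i\<in>UNIV. pochhammer (\<kappa> $ i + 1 / 2) (\<beta> i + \<alpha> i)) / pochhammer A (k + j)"
        by (simp only: xpow_add[symmetric, abs_def] L_xpow eta_contract_eq)
      have "hcoef \<beta> * xpow \<beta> y * L (k + j) (\<lambda>x. xpow \<beta> x * xpow \<alpha> x) =
        (\<Prod>i\<in>UNIV. 1 / (fact (\<beta> i) * pochhammer (\<kappa> $ i + 1 / 2) (\<beta> i)) * (y $ i) ^ \<beta> i *
          pochhammer (\<kappa> $ i + 1 / 2) (\<beta> i + \<alpha> i)) / pochhammer A (k + j)"
        unfolding hcoef_def xpow_def[of \<beta> y] prod.distrib eqL times_divide_eq_right ..
      also have "(\<Prod>i\<in>UNIV. 1 / (fact (\<beta> i) * pochhammer (\<kappa> $ i + 1 / 2) (\<beta> i)) * (y $ i) ^ \<beta> i *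
          pochhammer (\<kappa> $ i + 1 / 2) (\<beta> i + \<alpha> i)) = (\<Prod>i\<in>UNIV. fps_nth (F i) (\<beta> i))"
        by (intro prod.cong refl) (simp add: F_def pochhammer_product')
      finally show "hcoef \<beta> * xpow \<beta> y * L (k + j) (\<lambda>x. xpow \<beta> x * xpow \<alpha> x) =
        (\<Prod>i\<in>UNIV. fps_nth (F i) (\<beta> i)) / pochhammer A (k + j)" .
    qed
    also have "\<dots> = fps_nth (\<Prod>i\<in>UNIV. F i) k / pochhammer A (k + j)"
      by (simp only: fps_nth_prod_compositions sum_divide_distrib)
    also have "(\<Prod>i\<in>UNIV. F i) = (\<Prod>i\<in>UNIV. P i) * fps_exp (coord_sum y)"
      unfolding F prod.distrib prod_fps_exp ..
    also have "fps_nth \<dots> k = (\<Sum>l\<le>k. fps_nth (\<Prod>i\<in>UNIV. P i) l * (coord_sum y ^ (k - l) / fact (k - l)))"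
      by (simp add: fps_mult_nth atLeast0AtMost)
    also have "\<dots> = (\<Sum>l\<le>k. q l y * coord_sum y ^ (k - l) / fact (k - l))"
      by (intro sum.cong refl)
        (simp add: fps_nth_prod_compositions q_def P_def prod.distrib xpow_def)
    finally show ?thesis by (simp only: L_hk[OF xpow_homs[OF \<alpha>]])
  qed
  thus ?thesis using q_homs q_top q_above by (intro exI[of _ q] conjI allI impI)
qed

lemma L_hk_homs:
  assumes "p \<in> homs j"
  shows "\<exists>q. (\<forall>l. q l \<in> homs l) \<and> q j = p \<and> (\<forall>l>j. q l = (\<lambda>_. 0)) \<and>
    (\<forall>k y. L (k + j) (\<lambda>x. hk k x y * p x) =
      (\<Sum>l\<le>k. q l y * coord_sum y ^ (k - l) / fact (k - l)) / pochhammer A (k + j))"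
proof -
  obtain c where c: "p = (\<lambda>x. \<Sum>\<alpha>\<in>compositions j. c \<alpha> * xpow \<alpha> x)"
    using assms by (auto simp: polys_on_def)
  have "\<exists>q. \<forall>\<alpha>\<in>compositions j. (\<forall>l. q \<alpha> l \<in> homs l) \<and> q \<alpha> j = xpow \<alpha> \<and> (\<forall>l>j. q \<alpha> l = (\<lambda>_. 0)) \<and>
    (\<forall>k y. L (k + j) (\<lambda>x. hk k x y * xpow \<alpha> x) =
      (\<Sum>l\<le>k. q \<alpha> l y * coord_sum y ^ (k - l) / fact (k - l)) / pochhammer A (k + j))"
    by (intro bchoice ballI L_hk_xpow)
  then obtain q where q0: "\<forall>\<alpha>\<in>compositions j. (\<forall>l. q \<alpha> l \<in> homs l) \<and> q \<alpha> j = xpow \<alpha> \<and> (\<forall>l>j. q \<alpha> l = (\<lambda>_. 0)) \<and>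
    (\<forall>k y. L (k + j) (\<lambda>x. hk k x y * xpow \<alpha> x) =
      (\<Sum>l\<le>k. q \<alpha> l y * coord_sum y ^ (k - l) / fact (k - l)) / pochhammer A (k + j))"
    by (elim exE)
  note q = q0[THEN bspec, THEN conjunct1, THEN spec] q0[THEN bspec, THEN conjunct2, THEN conjunct1]
    q0[THEN bspec, THEN conjunct2, THEN conjunct2, THEN conjunct1, THEN spec, THEN mp]
    q0[THEN bspec, THEN conjunct2, THEN conjunct2, THEN conjunct2, THEN spec, THEN spec]
  define r where "r = (\<lambda>l y. \<Sum>\<alpha>\<in>compositions j. c \<alpha> * q \<alpha> l y)"
  have "r l \<in> homs l" for l unfolding r_def by (intro polys_on_sum polys_on_scale q(1))
  moreover have "r j = p" unfolding r_def c by (simp add: q(2))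
  moreover have "r l = (\<lambda>_. 0)" if "l > j" for l unfolding r_def using that by (simp add: q(3))
  moreover have "L (k + j) (\<lambda>x. hk k x y * p x) =
      (\<Sum>l\<le>k. r l y * coord_sum y ^ (k - l) / fact (k - l)) / pochhammer A (k + j)" for k y
  proof -
    have "L (k + j) (\<lambda>x. hk k x y * p x) =
        L (k + j) (\<lambda>x. \<Sum>\<alpha>\<in>compositions j. c \<alpha> * (hk k x y * xpow \<alpha> x))"
      unfolding c sum_distrib_left by (simp add: mult.left_commute)
    also have "\<dots> = (\<Sum>\<alpha>\<in>compositions j. c \<alpha> * L (k + j) (\<lambda>x. hk k x y * xpow \<alpha> x))"
      by (intro L_sum_scale finite_compositions homs_mult xpow_homs hk_homs)
    also have "\<dots> = (\<Sum>\<alpha>\<in>compositions j. \<Sum>l\<le>k. c \<alpha> * q \<alpha> l y * coord_sum y ^ (k - l) / fact (k - l)) / pochhammer A (k + j)"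
      by (simp add: q(4) sum_distrib_left sum_divide_distrib mult.assoc)
    also have "(\<Sum>\<alpha>\<in>compositions j. \<Sum>l\<le>k. c \<alpha> * q \<alpha> l y * coord_sum y ^ (k - l) / fact (k - l)) =
        (\<Sum>l\<le>k. r l y * coord_sum y ^ (k - l) / fact (k - l))"
      by (subst sum.swap) (simp add: r_def sum_distrib_right sum_divide_distrib)
    finally show ?thesis .
  qed
  ultimately show ?thesis by (intro exI[of _ r] conjI allI impI)
qed

text \<open>The analogue of spherical harmonics for the face |x| = 1, given by orthogonality under L
  to all homogeneous polynomials of lower degree.\<close>

definition harm :: "nat \<Rightarrow> (real ^ 'd \<Rightarrow> real) set" where
  "harm j = {Y \<in> homs j. \<forall>i q. i < j \<longrightarrow> q \<in> homs i \<longrightarrow> L (i + j) (\<lambda>x. q x * Y x) = 0}"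

lemma harm_homs: "Y \<in> harm j \<Longrightarrow> Y \<in> homs j"
  by (simp add: harm_def)

lemma harm_orth: "Y \<in> harm j \<Longrightarrow> q \<in> homs i \<Longrightarrow> i < j \<Longrightarrow> L (i + j) (\<lambda>x. q x * Y x) = 0"
  by (simp add: harm_def)

text \<open>Move the operator from Y to u by self-adjointness. Applied to u it produces only terms
  |x|^(k - l) q_l with l \<le> i < j; the power of |x| is invisible to L and q_l is orthogonal to
  Y.\<close>

lemma funk_hecke_orth:
  assumes Y: "Y \<in> harm j" and u: "u \<in> homs i" and "i < j"
  shows "L (k + i) (\<lambda>y. L (k + j) (\<lambda>x. hk k x y * Y x) * u y) = 0"
proof -
  from L_hk_homs[OF u] obtain q where q0: "(\<forall>l. q l \<in> homs l) \<and> q i = u \<and> (\<forall>l>i. q l = (\<lambda>_. 0)) \<and>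
    (\<forall>k y. L (k + i) (\<lambda>x. hk k x y * u x) =
      (\<Sum>l\<le>k. q l y * coord_sum y ^ (k - l) / fact (k - l)) / pochhammer A (k + i))"
    by (elim exE)
  note q = q0[THEN conjunct1, THEN spec] q0[THEN conjunct2, THEN conjunct2, THEN conjunct1, THEN spec, THEN mp]
    q0[THEN conjunct2, THEN conjunct2, THEN conjunct2, THEN spec, THEN spec]
  have "L (k + i) (\<lambda>y. L (k + j) (\<lambda>x. hk k x y * Y x) * u y) =
      L (k + j) (\<lambda>x. L (k + i) (\<lambda>y. hk k y x * u y) * Y x)"
    by (rule L_hk_fubini[OF harm_homs[OF Y] u])
  also have "\<dots> = L (k + j) (\<lambda>x. \<Sum>l\<le>k. (1 / (fact (k - l) * pochhammer A (k + i))) * (coord_sum x ^ (k - l) * (q l x * Y x)))"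
    unfolding q(3) sum_divide_distrib sum_distrib_right by (simp add: mult_ac)
  also have "\<dots> = (\<Sum>l\<le>k. (1 / (fact (k - l) * pochhammer A (k + i))) * L (k + j) (\<lambda>x. coord_sum x ^ (k - l) * (q l x * Y x)))"
  proof (intro L_sum_scale)
    fix l assume "l \<in> {..k}"
    thus "(\<lambda>x. coord_sum x ^ (k - l) * (q l x * Y x)) \<in> homs (k + j)"
      using homs_coord_sum_power[OF homs_mult[OF q(1)[of l] harm_homs[OF Y]], of "k - l"]
      by (simp add: add.commute)
  qed simp
  also have "\<dots> = 0"
  proof (intro sum.neutral ballI)
    fix l assume l: "l \<in> {..k}"
    have "L (k + j) (\<lambda>x. coord_sum x ^ (k - l) * (q l x * Y x)) = 0"
    proof (cases "l > i")
      case True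
      thus ?thesis using q(2) by (simp add: L_eq_0_iff E_zero)
    next
      case False
      have "L (l + j + (k - l)) (\<lambda>x. coord_sum x ^ (k - l) * (q l x * Y x)) = L (l + j) (\<lambda>x. q l x * Y x)"
        by (rule L_coord_sum_power[OF homs_mult[OF q(1) harm_homs[OF Y]]])
      also have "\<dots> = 0" using False \<open>i < j\<close> by (intro harm_orth[OF Y q(1)]) simp
      finally show ?thesis using l by (simp add: add.commute)
    qed
    thus "1 / (fact (k - l) * pochhammer A (k + i)) * L (k + j) (\<lambda>x. coord_sum x ^ (k - l) * (q l x * Y x)) = 0"
      by simp
  qed
  finally show ?thesis .
qed

text \<open>The operator with symmetric kernel \<open>hk k\<close> does not raise degrees on the face \<open>|x| = 1\<close>, hence it preserves
  the orthogonal pieces \<open>harm j\<close>, on which it acts through its leading coefficient.\<close>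

theorem funk_hecke:
  assumes Y: "Y \<in> harm j"
  shows "L (k + j) (\<lambda>x. hk k x y * Y x) =
    (if j \<le> k then coord_sum y ^ (k - j) * Y y / (fact (k - j) * pochhammer A (k + j)) else 0)"
proof (cases "j \<le> k")
  case False
  thus ?thesis using harm_orth[OF Y hk_homs] by simp
next
  case True
  from L_hk_homs[OF harm_homs[OF Y]] obtain q where q0: "(\<forall>l. q l \<in> homs l) \<and> q j = Y \<and> (\<forall>l>j. q l = (\<lambda>_. 0)) \<and>
    (\<forall>k y. L (k + j) (\<lambda>x. hk k x y * Y x) =
      (\<Sum>l\<le>k. q l y * coord_sum y ^ (k - l) / fact (k - l)) / pochhammer A (k + j))"
    by (elim exE)
  note q = q0[THEN conjunct1, THEN spec] q0[THEN conjunct2, THEN conjunct1]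
    q0[THEN conjunct2, THEN conjunct2, THEN conjunct1, THEN spec, THEN mp]
    q0[THEN conjunct2, THEN conjunct2, THEN conjunct2, THEN spec, THEN spec]
  define \<Phi> where "\<Phi> = (\<lambda>y. L (k + j) (\<lambda>x. hk k x y * Y x))"
  \<comment> \<open>The part of the image below degree j, homogenized to degree j by powers of |y|.
    The goal is g = 0.\<close>
  define g where "g = (\<lambda>y. \<Sum>l<j. (1 / fact (k - l)) * (coord_sum y ^ (j - l) * q l y))"
  define a where "a = (1 / fact (k - j) :: real)"
  define d where "d = 1 / pochhammer A (k + j)"
  have g_homs: "g \<in> homs j" unfolding g_def
  proof (intro polys_on_sum polys_on_scale)
    fix l assume "l \<in> {..<j}"
    thus "(\<lambda>x. coord_sum x ^ (j - l) * q l x) \<in> homs j"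
      using homs_coord_sum_power[OF q(1)[of l], of "j - l"] by simp
  qed
  have \<Phi>: "\<Phi> = (\<lambda>y. d * (coord_sum y ^ (k - j) * (a * Y y + g y)))"
  proof
    fix y
    have "(\<Sum>l\<le>k. q l y * coord_sum y ^ (k - l) / fact (k - l)) =
        (\<Sum>l\<le>j. q l y * coord_sum y ^ (k - l) / fact (k - l))"
      using True q(3) by (intro sum.mono_neutral_right) auto
    also have "\<dots> = q j y * coord_sum y ^ (k - j) / fact (k - j) +
        (\<Sum>l<j. q l y * coord_sum y ^ (k - l) / fact (k - l))"
      by (simp add: lessThan_Suc_atMost[symmetric])
    also have "(\<Sum>l<j. q l y * coord_sum y ^ (k - l) / fact (k - l)) = coord_sum y ^ (k - j) * g y"
      unfolding g_def sum_distrib_left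
    proof (intro sum.cong refl)
      fix l assume "l \<in> {..<j}"
      hence "k - l = (k - j) + (j - l)" using True by simp
      hence "coord_sum y ^ (k - l) = coord_sum y ^ (k - j) * coord_sum y ^ (j - l)"
        by (simp only: power_add)
      thus "q l y * coord_sum y ^ (k - l) / fact (k - l) =
          coord_sum y ^ (k - j) * (1 / fact (k - l) * (coord_sum y ^ (j - l) * q l y))" by simp
    qed
    finally show "\<Phi> y = d * (coord_sum y ^ (k - j) * (a * Y y + g y))"
      unfolding \<Phi>_def q(4) d_def a_def by (simp add: q(2) field_simps)
  qed
  have \<Phi>_homs: "\<Phi> \<in> homs k"
  proof -
    have "\<Phi> = (\<lambda>y. \<Sum>\<beta>\<in>compositions k. (hcoef \<beta> * L (k + j) (\<lambda>x. xpow \<beta> x * Y x)) * xpow \<beta> y)"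
      unfolding \<Phi>_def L_hk[OF harm_homs[OF Y]] by (simp add: mult_ac)
    also have "\<dots> \<in> homs k" by (intro polys_on_sum polys_on_scale xpow_homs)
    finally show ?thesis .
  qed
  \<comment> \<open>Up to powers of |y|, which L ignores, g is a combination of q_l with l < j.
    Orthogonality to these therefore gives orthogonality to g; it is applied to Y and to
    \<Phi>.\<close>
  have L_low: "L (m + j) (\<lambda>y. f y * g y) = 0"
    if f: "f \<in> homs m" and orth: "\<And>l. l < j \<Longrightarrow> L (m + l) (\<lambda>y. f y * q l y) = 0" for f m
  proof -
    have "L (m + j) (\<lambda>y. f y * g y) =
        L (m + j) (\<lambda>y. \<Sum>l<j. (1 / fact (k - l)) * (coord_sum y ^ (j - l) * (f y * q l y)))"
      unfolding g_def sum_distrib_left by (simp add: mult_ac)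
    also have "\<dots> = (\<Sum>l<j. (1 / fact (k - l)) * L (m + j) (\<lambda>y. coord_sum y ^ (j - l) * (f y * q l y)))"
    proof (intro L_sum_scale)
      fix l assume "l \<in> {..<j}"
      thus "(\<lambda>y. coord_sum y ^ (j - l) * (f y * q l y)) \<in> homs (m + j)"
        using homs_coord_sum_power[OF homs_mult[OF f q(1)[of l]], of "j - l"] by simp
    qed simp
    also have "\<dots> = 0"
    proof (intro sum.neutral ballI)
      fix l assume l: "l \<in> {..<j}"
      have "L (m + l + (j - l)) (\<lambda>y. coord_sum y ^ (j - l) * (f y * q l y)) = L (m + l) (\<lambda>y. f y * q l y)"
        by (rule L_coord_sum_power[OF homs_mult[OF f q(1)]])
      thus "1 / fact (k - l) * L (m + j) (\<lambda>y. coord_sum y ^ (j - l) * (f y * q l y)) = 0"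
        using l orth[of l] by simp
    qed
    finally show ?thesis .
  qed
  have Yg: "L (j + j) (\<lambda>y. Y y * g y) = 0"
    using harm_orth[OF Y q(1)] by (intro L_low harm_homs[OF Y]) (simp add: mult.commute add.commute)
  have \<Phi>g: "L (k + j) (\<lambda>y. \<Phi> y * g y) = 0"
    using funk_hecke_orth[OF Y q(1)] by (intro L_low \<Phi>_homs) (simp add: \<Phi>_def)
  \<comment> \<open>On the face \<Phi> is a multiple of a Y + g. Both \<Phi> and Y are orthogonal to
    g, so g is orthogonal to itself.\<close>
  have gg: "L (j + j) (\<lambda>y. g y * g y) = 0"
  proof -
    have homs: "(\<lambda>y. (a * Y y + g y) * g y) \<in> homs (j + j)"
      by (intro homs_mult polys_on_add polys_on_scale harm_homs[OF Y] g_homs)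
    have "0 = L (j + j + (k - j)) (\<lambda>y. d * (coord_sum y ^ (k - j) * ((a * Y y + g y) * g y)))"
      using \<Phi>g True unfolding \<Phi> by (simp add: mult.assoc add.commute)
    also have "\<dots> = d * L (j + j) (\<lambda>y. (a * Y y + g y) * g y)"
      unfolding L_scale L_coord_sum_power[OF homs] ..
    also have "L (j + j) (\<lambda>y. (a * Y y + g y) * g y) = L (j + j) (\<lambda>y. a * (Y y * g y) + g y * g y)"
      by (simp add: algebra_simps)
    also have "\<dots> = a * L (j + j) (\<lambda>y. Y y * g y) + L (j + j) (\<lambda>y. g y * g y)"
      using homs_mult[OF harm_homs[OF Y] g_homs] homs_mult[OF g_homs g_homs]
      by (subst L_add) (auto simp: L_scale intro: polys_on_scale)
    finally show ?thesis using Yg by (simp add: d_def)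
  qed
  have "g = (\<lambda>_. 0)"
    using E_pos_def[OF rpf_homs[OF g_homs]] gg by (auto simp: L_eq_0_iff)
  thus ?thesis using True \<Phi> by (simp add: \<Phi>_def fun_eq_iff d_def a_def)
qed

end

section \<open>The kernel as an operator on polynomials\<close>

text \<open>Recognizes the \<nu>-dependent factor of \<open>theta\<close> as a Rothe coefficient;
  positivity of x keeps the denominator nonzero.\<close>

lemma rothe_eq_pochhammer:
  assumes "x > 0"
  shows "rothe x a = pochhammer x (2 * a) / (fact a * pochhammer (x + 1) a)"
proof (cases a)
  case (Suc b)
  have "pochhammer (x + 1) a > 0" using assms by (intro pochhammer_pos) simp
  moreover have "pochhammer x (2 * a) = x * (pochhammer (x + 1) a * pochhammer (x + 1 + real a) b)"
  proof -
    have "2 * a = Suc (a + b)" using Suc by simp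
    thus ?thesis by (simp only: pochhammer_rec pochhammer_product')
  qed
  ultimately show ?thesis by (simp add: rothe_def Suc add_ac)
qed (simp add: rothe_def)

context simplex_weight
begin

text \<open>The u-integral gives (\<nu>)_(2a) (A)_(2k) / (A + \<nu>)_(2(a + k)), the v-integral
  gives (1/2)_a / (\<nu> + 1)_a, and (2a)! = 4^a (1/2)_a a! removes (1/2)_a.\<close>

definition theta :: "nat \<Rightarrow> nat \<Rightarrow> real" where
  "theta a k = pochhammer \<nu> (2 * a) * pochhammer A (2 * k) /
     (fact a * pochhammer (\<nu> + 1) a * pochhammer (A + \<nu>) (2 * (a + k)))"

text \<open>Coefficients of \<Xi>: its value at 2 t^2 - 1 is the sum of \<open>ccoef n m\<close> 4^m
  t^(2m) / (2m)!, see \<open>poly_Xi_lam\<close>.\<close>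

definition ccoef :: "nat \<Rightarrow> nat \<Rightarrow> real" where
  "ccoef n m = (2 * real n + lam) / lam * ((-1) ^ (n - m) * pochhammer lam (n + m) / fact (n - m))"

text \<open>Up to \<open>norm_const\<close>, the integral of 4^m \<zeta>^(2m) / (2m)! for points of
  the simplex. Grouping by N = a + k separates the power of (1 - |x|)(1 - |y|), so that the inner
  sum over a is the one evaluated by Rothe--Hagen.\<close>

definition G :: "nat \<Rightarrow> real ^ 'd \<Rightarrow> real ^ 'd \<Rightarrow> real" where
  "G m x y = (\<Sum>N\<le>m. \<Sum>a\<le>N. theta a (N - a) / (fact (m - N) * pochhammer M (m - N)) *
     (coord_sum x * coord_sum y) ^ a * hk (N - a) x y * ((1 - coord_sum x) * (1 - coord_sum y)) ^ (m - N))"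

definition K :: "nat \<Rightarrow> real ^ 'd \<Rightarrow> real ^ 'd \<Rightarrow> real" where
  "K n x y = (\<Sum>m\<le>n. ccoef n m * G m x y)"

text \<open>Put N - a = k + j. Dividing (A)_(2(k + j)) by (A)_(k + 2j) leaves (A + 2j + k)_k, which
  with k! is \<open>central_binom (A + 2j) k\<close>. The sum is thus a Rothe--Hagen convolution,
  and its value involves A + \<nu> in place of A.\<close>

lemma sum_theta:
  assumes "j \<le> N"
  shows "(\<Sum>a\<le>N - j. theta a (N - a) / (fact (N - a - j) * pochhammer A (N - a + j))) =
    1 / (pochhammer (A + \<nu>) (N + j) * fact (N - j))"
proof -
  define n where "n = N - j"
  have N: "N = n + j" using assms by (simp add: n_def)
  have "(\<Sum>a\<le>n. theta a (N - a) / (fact (N - a - j) * pochhammer A (N - a + j))) =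
      (\<Sum>a\<le>n. rothe \<nu> a * central_binom (A + real (2 * j)) (n - a)) / pochhammer (A + \<nu>) (2 * N)"
    unfolding sum_divide_distrib
  proof (intro sum.cong refl)
    fix a assume a: "a \<in> {..n}"
    define k where "k = n - a"
    have k: "N - a = k + j" "a + (k + j) = N" "N - a - j = k" using a N by (auto simp: k_def)
    have "2 * (k + j) = (k + j + j) + k" by simp
    hence eq: "pochhammer A (2 * (k + j)) = pochhammer A (k + j + j) * pochhammer (A + real (k + j + j)) k"
      by (simp only: pochhammer_product')
    have real: "A + real (2 * j) + real k = A + real (k + j + j)" by simp
    show "theta a (N - a) / (fact (N - a - j) * pochhammer A (N - a + j)) =
      rothe \<nu> a * central_binom (A + real (2 * j)) (n - a) / pochhammer (A + \<nu>) (2 * N)"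
      unfolding theta_def k rothe_eq_pochhammer[OF nu_pos] central_binom_def k_def[symmetric]
        eq real by simp
  qed
  also have "\<dots> = central_binom (A + \<nu> + real (2 * j)) n / pochhammer (A + \<nu>) (2 * N)"
    by (simp add: rothe_hagen algebra_simps)
  also have "pochhammer (A + \<nu>) (2 * N) =
      pochhammer (A + \<nu>) (N + j) * pochhammer (A + \<nu> + real (N + j)) n"
  proof -
    have "2 * N = (N + j) + n" using N by simp
    thus ?thesis by (simp only: pochhammer_product')
  qed
  also have "A + \<nu> + real (N + j) = A + \<nu> + real (2 * j) + real n" by (simp add: N)
  finally show ?thesis
    using pochhammer_pos[of "A + \<nu> + real (2 * j) + real n" n] A_pos nu_pos
    by (simp add: n_def central_binom_def)
qed

text \<open>\<open>E_homs\<close> separates the radial factor, whose (M)_(m - N) cancels against G;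
  \<open>funk_hecke\<close> evaluates the face part and \<open>sum_theta\<close> the sum over a. The
  quotient of (A + \<nu>)_(N + j + q) by (A + \<nu>)_(N + j) is the Pochhammer symbol left in the
  result.\<close>

lemma E_G_harm:
  assumes Y: "Y \<in> harm j"
  shows "E (\<lambda>x. G m x y * (coord_sum x ^ q * Y x)) =
    Y y / pochhammer (lam + 1) (m + j + q) *
    (\<Sum>N\<in>{j..m}. pochhammer (A + \<nu> + real (N + j)) q * coord_sum y ^ (N - j) * (1 - coord_sum y) ^ (m - N) /
      (fact (m - N) * fact (N - j)))"
proof -
  define s where "s = coord_sum y"
  define f where "f = (\<lambda>N a x. hk (N - a) x y * Y x * coord_sum x ^ (a + q) * (1 - coord_sum x) ^ (m - N))"
  define c where "c = (\<lambda>N a. theta a (N - a) / (fact (m - N) * pochhammer M (m - N)) * s ^ a * (1 - s) ^ (m - N))"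
  have f_rpf: "real_polynomial_function (f N a)" for N a
    unfolding f_def using homs_mult[OF hk_homs harm_homs[OF Y]]
    by (intro real_polynomial_function.intros(4) real_polynomial_function_coord_sum rpf_homs)
  have "E (\<lambda>x. G m x y * (coord_sum x ^ q * Y x)) = E (\<lambda>x. \<Sum>N\<le>m. \<Sum>a\<le>N. c N a * f N a x)"
    unfolding G_def sum_distrib_right[of "f :: nat \<Rightarrow> real" for f] c_def f_def s_def
    by (simp add: power_add power_mult_distrib mult_ac)
  also have "\<dots> = (\<Sum>N\<le>m. \<Sum>a\<le>N. c N a * E (f N a))"
  proof -
    have "E (\<lambda>x. \<Sum>N\<le>m. \<Sum>a\<le>N. c N a * f N a x) = (\<Sum>N\<le>m. E (\<lambda>x. \<Sum>a\<le>N. c N a * f N a x))"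
      using f_rpf by (intro E_sum real_polynomial_function_sum real_polynomial_function.intros(4)
          real_polynomial_function.intros(2)) auto
    also have "\<dots> = (\<Sum>N\<le>m. \<Sum>a\<le>N. c N a * E (f N a))"
      using f_rpf by (intro sum.cong refl E_sum_scale) auto
    finally show ?thesis .
  qed
  also have "\<dots> = (\<Sum>N\<le>m. if j \<le> N then Y y / pochhammer (lam + 1) (m + j + q) *
      (pochhammer (A + \<nu> + real (N + j)) q * s ^ (N - j) * (1 - s) ^ (m - N) / (fact (m - N) * fact (N - j))) else 0)"
  proof (intro sum.cong refl)
    fix N assume N: "N \<in> {..m}"
    have Ef: "E (f N a) = (if j \<le> N - a then s ^ (N - a - j) * Y y / (fact (N - a - j) * pochhammer A (N - a + j)) else 0) *
        (pochhammer (A + \<nu>) (N + j + q) * pochhammer M (m - N) / pochhammer (lam + 1) (m + j + q))"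
      if "a \<le> N" for a
    proof -
      have e: "N - a + j + (a + q) = N + j + q" "N + j + q + (m - N) = m + j + q"
        using that N by auto
      show ?thesis
        unfolding f_def s_def E_homs[OF homs_mult[OF hk_homs harm_homs[OF Y]]] e funk_hecke[OF Y] ..
    qed
    show "(\<Sum>a\<le>N. c N a * E (f N a)) = (if j \<le> N then Y y / pochhammer (lam + 1) (m + j + q) *
      (pochhammer (A + \<nu> + real (N + j)) q * s ^ (N - j) * (1 - s) ^ (m - N) / (fact (m - N) * fact (N - j))) else 0)"
    proof (cases "j \<le> N")
      case False
      hence "c N a * E (f N a) = 0" if "a \<le> N" for a using Ef[OF that] by auto
      hence "(\<Sum>a\<le>N. c N a * E (f N a)) = 0" by (intro sum.neutral) simp
      thus ?thesis using False by simp
    next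
      case True
      \<comment> \<open>For a > N - j the kernel \<open>hk (N - a)\<close> has degree below j and
        annihilates Y.\<close>
      have "(\<Sum>a\<le>N. c N a * E (f N a)) = (\<Sum>a\<le>N - j. c N a * E (f N a))"
        using Ef by (intro sum.mono_neutral_right) auto
      also have "\<dots> = (\<Sum>a\<le>N - j. theta a (N - a) / (fact (N - a - j) * pochhammer A (N - a + j)) *
          (s ^ (N - j) * (1 - s) ^ (m - N) * Y y * pochhammer (A + \<nu>) (N + j + q) /
          (fact (m - N) * pochhammer (lam + 1) (m + j + q))))"
      proof (intro sum.cong refl)
        fix a assume "a \<in> {..N - j}"
        hence a: "a \<le> N" "j \<le> N - a" "N - j = a + (N - a - j)" using True by auto
        have "s ^ (N - j) = s ^ a * s ^ (N - a - j)" by (subst a(3)) (rule power_add)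
        thus "c N a * E (f N a) = theta a (N - a) / (fact (N - a - j) * pochhammer A (N - a + j)) *
          (s ^ (N - j) * (1 - s) ^ (m - N) * Y y * pochhammer (A + \<nu>) (N + j + q) /
          (fact (m - N) * pochhammer (lam + 1) (m + j + q)))"
          using Ef[OF a(1)] a(2) by (simp add: c_def mult_ac)
      qed
      also have "\<dots> = 1 / (pochhammer (A + \<nu>) (N + j) * fact (N - j)) *
          (s ^ (N - j) * (1 - s) ^ (m - N) * Y y * pochhammer (A + \<nu>) (N + j + q) /
          (fact (m - N) * pochhammer (lam + 1) (m + j + q)))"
        unfolding sum_distrib_right[symmetric] sum_theta[OF True] ..
      also have "pochhammer (A + \<nu>) (N + j + q) = pochhammer (A + \<nu>) (N + j) * pochhammer (A + \<nu> + real (N + j)) q"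
        by (rule pochhammer_product')
      finally show ?thesis using True by (simp add: mult_ac)
    qed
  qed
  also have "\<dots> = (\<Sum>N\<in>{j..m}. Y y / pochhammer (lam + 1) (m + j + q) *
      (pochhammer (A + \<nu> + real (N + j)) q * s ^ (N - j) * (1 - s) ^ (m - N) / (fact (m - N) * fact (N - j))))"
    by (rule sum.mono_neutral_cong_right) auto
  finally show ?thesis by (simp only: sum_distrib_left s_def)
qed

text \<open>The left side is the m-th coefficient of P exp(s z) exp((1 - s) z), with z the series
  variable, and the two exponentials multiply to exp(z). The powers of s that remain come from P
  alone.\<close>

lemma fps_shift_expansion_sum:
  fixes s c :: real
  assumes p: "\<And>\<beta>. pochhammer (c + real \<beta>) q / fact \<beta> = (\<Sum>i\<le>\<beta>. p i / fact (\<beta> - i))"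
  shows "(\<Sum>N\<le>m. pochhammer (c + real N) q * s ^ N * (1 - s) ^ (m - N) / (fact (m - N) * fact N)) =
    (\<Sum>i\<le>m. p i * s ^ i / fact (m - i))"
proof -
  define P where "P = Abs_fps (\<lambda>i. p i * s ^ i)"
  have eq: "Abs_fps (\<lambda>n. pochhammer (c + real n) q / fact n * s ^ n) = P * fps_exp s"
  proof (rule fps_ext)
    fix n
    have "fps_nth (P * fps_exp s) n = (\<Sum>i\<le>n. p i * s ^ i * (s ^ (n - i) / fact (n - i)))"
      by (simp add: fps_mult_nth P_def atLeast0AtMost)
    also have "\<dots> = (\<Sum>i\<le>n. (p i / fact (n - i)) * s ^ n)"
      by (intro sum.cong) (auto simp: power_add[symmetric])
    finally show "fps_nth (Abs_fps (\<lambda>n. pochhammer (c + real n) q / fact n * s ^ n)) n = fps_nth (P * fps_exp s) n"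
      by (simp add: p sum_distrib_right)
  qed
  have "(\<Sum>N\<le>m. pochhammer (c + real N) q * s ^ N * (1 - s) ^ (m - N) / (fact (m - N) * fact N)) =
      fps_nth (Abs_fps (\<lambda>n. pochhammer (c + real n) q / fact n * s ^ n) * fps_exp (1 - s)) m"
    unfolding fps_mult_nth atLeast0AtMost by (simp add: mult_ac)
  also have "\<dots> = fps_nth (P * (fps_exp s * fps_exp (1 - s))) m" unfolding eq mult.assoc ..
  also have "fps_exp s * fps_exp (1 - s) = fps_exp 1" by (simp flip: fps_exp_add_mult)
  also have "fps_nth (P * fps_exp 1) m = (\<Sum>i\<le>m. p i * s ^ i / fact (m - i))"
    by (simp add: fps_mult_nth P_def atLeast0AtMost)
  finally show ?thesis .
qed

text \<open>The quotient of (lam)_(n + m) by (lam + 1)_(m + j + q) is lam times a Pochhammer symbol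
  of length e = n - 1 - j - q, a polynomial of degree e in m. The other factors form an alternating
  binomial sum of order D = n - j - i, and i \<le> q gives e < D.\<close>

lemma sum_ccoef_eq_0:
  assumes "j + q < n" "i \<le> q"
  shows "(\<Sum>m\<in>{j+i..n}. ccoef n m / (pochhammer (lam + 1) (m + j + q) * fact (m - (j + i)))) = 0"
proof -
  define D where "D = n - (j + i)"
  define e where "e = n - 1 - j - q"
  have n: "n = j + i + D" using assms by (simp add: D_def)
  have eD: "e < D" "n = e + 1 + j + q" using assms by (auto simp: D_def e_def)
  have "(\<Sum>m\<in>{j+i..n}. ccoef n m / (pochhammer (lam + 1) (m + j + q) * fact (m - (j + i)))) =
      (\<Sum>m\<le>D. ccoef n (m + (j + i)) / (pochhammer (lam + 1) (m + (j + i) + j + q) * fact m))"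
    unfolding n by (rule sum.reindex_bij_witness[of _ "\<lambda>m. m + (j + i)" "\<lambda>m. m - (j + i)"]) auto
  also have "\<dots> = (\<Sum>m\<le>D. (2 * real n + lam) * (-1) ^ D / fact D *
      ((-1) ^ m * real (D choose m) * pochhammer ((lam + 1 + real (j + i + j + q)) + real m) e))"
  proof (intro sum.cong refl)
    fix m assume m: "m \<in> {..D}"
    have 1: "n - (m + (j + i)) = D - m" using n by simp
    have 2: "(-1) ^ (D - m) = (-1) ^ D * (-1) ^ m * (1::real)" using m
      by (simp add: power_diff_conv_inverse power_inverse[symmetric])
    have "n + (m + (j + i)) = Suc ((m + (j + i) + j + q) + e)" using eD by simp
    hence 3: "pochhammer lam (n + (m + (j + i))) = lam * (pochhammer (lam + 1) (m + (j + i) + j + q) *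
        pochhammer (lam + 1 + real (m + (j + i) + j + q)) e)"
      by (simp only: pochhammer_rec pochhammer_product')
    have 4: "lam + 1 + real (m + (j + i) + j + q) = (lam + 1 + real (j + i + j + q)) + real m" by simp
    have 5: "real (D choose m) = fact D / (fact m * fact (D - m))"
      using m by (simp add: binomial_fact)
    show "ccoef n (m + (j + i)) / (pochhammer (lam + 1) (m + (j + i) + j + q) * fact m) =
      (2 * real n + lam) * (-1) ^ D / fact D *
      ((-1) ^ m * real (D choose m) * pochhammer ((lam + 1 + real (j + i + j + q)) + real m) e)"
      unfolding ccoef_def 1 2 3 5 4[symmetric] using lam_pos by simp
  qed
  also have "\<dots> = 0"
    unfolding sum_distrib_left[symmetric] alternating_pochhammer_sum_eq_0[OF eD(1)] by simp
  finally show ?thesis .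
qed

text \<open>The factor (2n + lam) / lam in \<Xi> is what makes this exact. It normalizes the leading
  coefficient in \<open>E_K_harm\<close> to 1, so \<open>K n\<close> acts as the identity on top
  degree.\<close>

lemma ccoef_diag: "ccoef n n = pochhammer (lam + 1) (2 * n)"
proof -
  have "lam * pochhammer (lam + 1) (2 * n) = pochhammer lam (2 * n) * (lam + real (2 * n))"
    by (rule trans[OF pochhammer_rec[symmetric] pochhammer_Suc])
  hence "pochhammer (lam + 1) (2 * n) = pochhammer lam (2 * n) * (lam + real (2 * n)) / lam"
    using lam_pos by (simp add: eq_divide_eq mult.commute)
  moreover have "ccoef n n = pochhammer lam (2 * n) * (lam + real (2 * n)) / lam"
    by (simp add: ccoef_def mult.commute add.commute flip: mult_2)
  ultimately show ?thesis by (simp only:)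
qed

section \<open>The action of the kernel on homogeneous polynomials\<close>

lemma polys_hk: "(\<lambda>x. hk k x y) \<in> polys_le k"
  by (rule homs_polys_le[OF hk_homs]) simp

lemma G_polys_le: "(\<lambda>x. G m x y) \<in> polys_le m"
proof -
  have "(\<lambda>x. G m x y) = (\<lambda>x. \<Sum>N\<le>m. \<Sum>a\<le>N. (theta a (N - a) / (fact (m - N) * pochhammer M (m - N)) *
     coord_sum y ^ a * (1 - coord_sum y) ^ (m - N)) * (coord_sum x ^ a * hk (N - a) x y * (1 - coord_sum x) ^ (m - N)))"
    unfolding G_def power_mult_distrib by (simp add: mult_ac)
  also have "\<dots> \<in> polys_le m"
  proof (intro polys_le_sum polys_le_scale)
    fix N a assume *: "N \<in> {..m}" "a \<in> {..N}"
    have "(\<lambda>x. coord_sum x ^ a * hk (N - a) x y * (1 - coord_sum x) ^ (m - N)) \<in> polys_le (a + (N - a) + (m - N))"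
      by (intro polys_le_mult polys_le_power polys_le_coord_sum polys_hk)
    thus "(\<lambda>x. coord_sum x ^ a * hk (N - a) x y * (1 - coord_sum x) ^ (m - N)) \<in> polys_le m"
      using * by simp
  qed
  finally show ?thesis .
qed

lemma K_polys_le: "(\<lambda>x. K n x y) \<in> polys_le n"
  unfolding K_def by (intro polys_le_sum polys_le_scale polys_le_mono[OF G_polys_le]) simp

lemma K_sym: "K n x y = K n y x"
  unfolding K_def G_def by (simp add: hk_sym mult.commute)

text \<open>The image is the sum of p_i T_i |y|^i Y(y), where p_i vanishes for i > q and T_i is the
  alternating sum over m. If j + q < n, every T_i with i \<le> q is zero. If j + q = n, the term i =
  q has p_q = T_q = 1 and the others have degree below n.\<close>

lemma E_K_harm:
  assumes Y: "Y \<in> harm j" and le: "j + q \<le> n"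
  shows "\<exists>t\<in>polys_lt n. \<forall>y. E (\<lambda>x. K n x y * (coord_sum x ^ q * Y x)) =
    (if j + q = n then coord_sum y ^ q * Y y + t y else 0)"
proof -
  from pochhammer_shift_expansion[of q "A + \<nu> + real (2 * j)"]
  obtain p where p0: "p q = 1 \<and> (\<forall>i>q. p i = 0) \<and>
    (\<forall>\<beta>. pochhammer (A + \<nu> + real (2 * j) + real \<beta>) q / fact \<beta> = (\<Sum>i\<le>\<beta>. p i / fact (\<beta> - i)))"
    by (elim exE)
  note p = p0[THEN conjunct1] p0[THEN conjunct2, THEN conjunct1, THEN spec, THEN mp]
    p0[THEN conjunct2, THEN conjunct2, THEN spec]
  define T where "T = (\<lambda>i. \<Sum>m\<in>{j+i..n}. ccoef n m / (pochhammer (lam + 1) (m + j + q) * fact (m - (j + i))))"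
  have T: "T i = (\<Sum>m\<in>{j+i..n}. ccoef n m / (pochhammer (lam + 1) (m + j + q) * fact (m - (j + i))))" for i
    by (simp add: T_def)
  have main: "E (\<lambda>x. K n x y * (coord_sum x ^ q * Y x)) = (\<Sum>i\<le>n - j. p i * T i * (coord_sum y ^ i * Y y))" for y
  proof -
    define s where "s = coord_sum y"
    have EG: "E (\<lambda>x. G m x y * (coord_sum x ^ q * Y x)) =
        (if j \<le> m then Y y / pochhammer (lam + 1) (m + j + q) * (\<Sum>i\<le>m - j. p i * s ^ i / fact (m - j - i)) else 0)" for m
    proof (cases "j \<le> m")
      case True
      have "(\<Sum>N\<in>{j..m}. pochhammer (A + \<nu> + real (N + j)) q * s ^ (N - j) * (1 - s) ^ (m - N) /
          (fact (m - N) * fact (N - j))) =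
        (\<Sum>N\<le>m - j. pochhammer (A + \<nu> + real (2 * j) + real N) q * s ^ N * (1 - s) ^ (m - j - N) / (fact (m - j - N) * fact N))"
        using True
        by (intro sum.reindex_bij_witness[of _ "\<lambda>N. N + j" "\<lambda>N. N - j"]) (auto simp: add_ac)
      also have "\<dots> = (\<Sum>i\<le>m - j. p i * s ^ i / fact (m - j - i))"
        by (rule fps_shift_expansion_sum[OF p(3)])
      finally show ?thesis using True unfolding E_G_harm[OF Y] s_def by simp
    qed (simp add: E_G_harm[OF Y])
    have rpf: "real_polynomial_function (\<lambda>x. G m x y * (coord_sum x ^ q * Y x))" for m
      by (intro real_polynomial_function.intros(4) real_polynomial_function_coord_sum
          rpf_homs[OF harm_homs[OF Y]] real_polynomial_function_polys_le[OF G_polys_le])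
    have "E (\<lambda>x. K n x y * (coord_sum x ^ q * Y x)) =
        E (\<lambda>x. \<Sum>m\<le>n. ccoef n m * (G m x y * (coord_sum x ^ q * Y x)))"
      unfolding K_def sum_distrib_right by (simp add: mult.assoc)
    also have "\<dots> = (\<Sum>m\<le>n. ccoef n m * E (\<lambda>x. G m x y * (coord_sum x ^ q * Y x)))"
      using rpf by (intro E_sum_scale) auto
    also have "\<dots> = (\<Sum>m\<in>{j..n}. ccoef n m * (Y y / pochhammer (lam + 1) (m + j + q) *
        (\<Sum>i\<le>m - j. p i * s ^ i / fact (m - j - i))))"
      unfolding EG by (rule sum.mono_neutral_cong_right) auto
    also have "\<dots> = (\<Sum>m\<in>{j..n}. \<Sum>i\<le>m - j. p i * (s ^ i * Y y) *
        (ccoef n m / (pochhammer (lam + 1) (m + j + q) * fact (m - (j + i)))))"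
      by (simp add: sum_distrib_left sum_divide_distrib mult_ac)
    also have "\<dots> = (\<Sum>i\<le>n - j. \<Sum>m\<in>{j+i..n}. p i * (s ^ i * Y y) *
        (ccoef n m / (pochhammer (lam + 1) (m + j + q) * fact (m - (j + i)))))"
      unfolding sum.Sigma[OF finite_atLeastAtMost ballI[OF finite_atMost]]
        sum.Sigma[OF finite_atMost ballI[OF finite_atLeastAtMost]]
      by (rule sum.reindex_bij_witness[of _ "\<lambda>(i, m). (m, i)" "\<lambda>(m, i). (i, m)"]) auto
    also have "\<dots> = (\<Sum>i\<le>n - j. p i * T i * (s ^ i * Y y))"
      unfolding sum_distrib_left[symmetric] T[symmetric] by (simp add: mult_ac)
    finally show ?thesis by (simp only: s_def)
  qed
  show ?thesis
  proof (cases "j + q = n")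
    case False
    have "p i * T i = 0" for i
      using False le sum_ccoef_eq_0[of j q n i] p(2)[of i] by (cases "i \<le> q") (auto simp: T_def)
    hence "E (\<lambda>x. K n x y * (coord_sum x ^ q * Y x)) = 0" for y
      unfolding main by (simp only: mult_zero_left sum.neutral_const)
    thus ?thesis using False by (intro bexI[of _ "\<lambda>_. 0"] polys_on_zero) simp
  next
    case True
    define t where "t = (\<lambda>y. \<Sum>i<q. (p i * T i) * (coord_sum y ^ i * Y y))"
    have t: "t \<in> polys_lt n" unfolding t_def
    proof (intro polys_on_sum polys_on_scale)
      fix i assume "i \<in> {..<q}"
      thus "(\<lambda>y. coord_sum y ^ i * Y y) \<in> polys_lt n"
        using True by (intro homs_polys_lt[OF homs_coord_sum_power[OF harm_homs[OF Y]]]) simp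
    qed
    have e: "n + j + q = 2 * n" using True by simp
    have "T q = ccoef n n / pochhammer (lam + 1) (n + j + q)" using True by (simp add: T_def)
    hence "T q = 1" unfolding e ccoef_diag by simp
    moreover have nj: "n - j = q" using True by simp
    ultimately have "E (\<lambda>x. K n x y * (coord_sum x ^ q * Y x)) = coord_sum y ^ q * Y y + t y" for y
      using p(1) unfolding main t_def nj by (simp add: lessThan_Suc_atMost[symmetric])
    thus ?thesis using True t by (intro bexI[of _ t]) auto
  qed
qed

text \<open>Y is p minus its E-orthogonal projection to the multiples of |x| in degree m + 1, the
  projection being built by Gram--Schmidt from |x| times monomials.\<close>

lemma harm_decomposition_step:
  assumes p: "p \<in> homs (Suc m)"
  shows "\<exists>Y h. Y \<in> harm (Suc m) \<and> h \<in> homs m \<and> p = (\<lambda>x. Y x + coord_sum x * h x)"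
proof -
  define S where "S = {f :: real^'d \<Rightarrow> real. \<exists>q\<in>homs m. f = (\<lambda>x. coord_sum x * q x)}"
  define F where "F = (\<lambda>\<alpha> (x::real^'d). coord_sum x * xpow \<alpha> x) ` compositions m"
  define ip where "ip = (\<lambda>f g. E (\<lambda>x. f x * g x))"
  have S_homs: "f \<in> homs (Suc m)" if "f \<in> S" for f
    using that homs_mult[OF coord_sum_in_homs, of _ m] by (auto simp: S_def)
  have S_rpf: "real_polynomial_function f" if "f \<in> S" for f
    using rpf_homs[OF S_homs[OF that]] .
  have S_add: "(\<lambda>x. f x + g x) \<in> S" if "f \<in> S" "g \<in> S" for f g
    using that unfolding S_def by (auto simp: distrib_left[symmetric] intro!: bexI[OF _ polys_on_add])
  have S_scale: "(\<lambda>x. c * f x) \<in> S" if "f \<in> S" for f c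
    using that unfolding S_def by (auto simp: mult.left_commute[of c] intro!: bexI[OF _ polys_on_scale])
  have S_zero: "(\<lambda>_. 0) \<in> S"
    unfolding S_def using polys_on_zero by force
  have "\<exists>B. finite B \<and> B \<subseteq> S \<and> (\<forall>f\<in>B. \<forall>g\<in>B. ip f g = (if f = g then 1 else 0)) \<and>
    (\<forall>f\<in>F. \<exists>c. f = (\<lambda>x. \<Sum>b\<in>B. c b * b x))"
  proof (rule gram_schmidt)
    show "finite F" by (simp add: F_def)
    show "F \<subseteq> S" using xpow_homs by (auto simp: F_def S_def)
    fix f g h :: "real^'d \<Rightarrow> real" and c :: real
    show "ip (\<lambda>x. f x + g x) h = ip f h + ip g h" if "f \<in> S" "g \<in> S" "h \<in> S"
      using that unfolding ip_def distrib_right by (intro E_add real_polynomial_function.intros(4) S_rpf)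
    show "ip (\<lambda>x. c * f x) h = c * ip f h"
      unfolding ip_def mult.assoc by (rule E_scale)
    show "ip f h = ip h f" by (simp add: ip_def mult.commute)
    show "ip f f > 0" if "f \<in> S" "f \<noteq> (\<lambda>_. 0)"
      unfolding ip_def using that by (intro E_pos_def S_rpf)
  qed (fact S_add S_scale S_zero)+
  then obtain B where B: "finite B" "B \<subseteq> S" "\<forall>f\<in>B. \<forall>g\<in>B. ip f g = (if f = g then 1 else 0)"
    "\<forall>f\<in>F. \<exists>c. f = (\<lambda>x. \<Sum>b\<in>B. c b * b x)" by (elim exE conjE)
  define v where "v = (\<lambda>x. \<Sum>b\<in>B. ip p b * b x)"
  have v_S: "v \<in> S"
  proof -
    have "(\<lambda>x. \<Sum>b\<in>T. ip p b * b x) \<in> S" if "T \<subseteq> B" for T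
      using finite_subset[OF that B(1)] that B(2)
    proof (induction T rule: finite_induct)
      case empty
      thus ?case by (simp add: S_zero)
    next
      case (insert b T)
      have "(\<lambda>x. ip p b * b x + (\<Sum>b\<in>T. ip p b * b x)) \<in> S"
        using insert by (intro S_add S_scale) auto
      thus ?case using insert.hyps by simp
    qed
    thus ?thesis by (simp add: v_def)
  qed
  define Y where "Y = (\<lambda>x. p x - v x)"
  have Y_homs: "Y \<in> homs (Suc m)" unfolding Y_def by (intro polys_on_diff p S_homs v_S)
  have B_rpf: "real_polynomial_function b" if "b \<in> B" for b using that B(2) S_rpf by auto
  have Yb: "E (\<lambda>x. b x * Y x) = 0" if b: "b \<in> B" for b
  proof -
    have "E (\<lambda>x. b x * Y x) = E (\<lambda>x. b x * p x + (-1) * (\<Sum>b'\<in>B. ip p b' * (b' x * b x)))"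
    proof (rule arg_cong[of _ _ E], rule ext)
      fix x
      have "b x * (\<Sum>b'\<in>B. ip p b' * b' x) = (\<Sum>b'\<in>B. ip p b' * (b' x * b x))"
        unfolding sum_distrib_left by (simp add: mult_ac)
      thus "b x * Y x = b x * p x + (-1) * (\<Sum>b'\<in>B. ip p b' * (b' x * b x))"
        by (simp add: Y_def v_def right_diff_distrib)
    qed
    also have "\<dots> = E (\<lambda>x. b x * p x) + (-1) * E (\<lambda>x. \<Sum>b'\<in>B. ip p b' * (b' x * b x))"
      using b B_rpf rpf_homs[OF p]
      by (subst E_add, goal_cases)
         (auto simp only: E_scale intro!: real_polynomial_function.intros(2,4) real_polynomial_function_sum B(1))
    also have "E (\<lambda>x. \<Sum>b'\<in>B. ip p b' * (b' x * b x)) = (\<Sum>b'\<in>B. ip p b' * ip b' b)"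
      unfolding ip_def using b B_rpf
      by (intro E_sum_scale B(1) real_polynomial_function.intros(4)) auto
    also have "\<dots> = (\<Sum>b'\<in>B. if b' = b then ip p b else 0)"
      using B(3) b by (intro sum.cong) auto
    also have "\<dots> = ip p b" using b B(1) by simp
    finally show ?thesis by (simp add: ip_def mult.commute)
  qed
  have YF: "E (\<lambda>x. f x * Y x) = 0" if f: "f \<in> F" for f
  proof -
    obtain c where c: "f = (\<lambda>x. \<Sum>b\<in>B. c b * b x)" using B(4) f by (elim ballE exE) auto
    have "E (\<lambda>x. f x * Y x) = E (\<lambda>x. \<Sum>b\<in>B. c b * (b x * Y x))"
      unfolding c sum_distrib_right by (simp add: mult.assoc)
    also have "\<dots> = (\<Sum>b\<in>B. c b * E (\<lambda>x. b x * Y x))"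
      by (intro E_sum_scale B(1) real_polynomial_function.intros(4) B_rpf rpf_homs[OF Y_homs])
    finally show ?thesis using Yb by simp
  qed
  have Yr: "E (\<lambda>x. coord_sum x * q x * Y x) = 0" if q: "q \<in> homs m" for q
  proof -
    obtain c where c: "q = (\<lambda>x. \<Sum>\<alpha>\<in>compositions m. c \<alpha> * xpow \<alpha> x)"
      using q by (auto simp: polys_on_def)
    have "E (\<lambda>x. coord_sum x * q x * Y x) =
        E (\<lambda>x. \<Sum>\<alpha>\<in>compositions m. c \<alpha> * ((coord_sum x * xpow \<alpha> x) * Y x))"
      unfolding c sum_distrib_left[of _ _ "compositions m"] sum_distrib_right[of _ "compositions m"]
      by (simp add: mult_ac)
    also have "\<dots> = (\<Sum>\<alpha>\<in>compositions m. c \<alpha> * E (\<lambda>x. (coord_sum x * xpow \<alpha> x) * Y x))"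
      by (intro E_sum_scale finite_compositions real_polynomial_function.intros(4)
          rpf_homs[OF coord_sum_in_homs] real_polynomial_function_xpow rpf_homs[OF Y_homs])
    also have "\<dots> = 0" using YF by (intro sum.neutral ballI) (auto simp: F_def)
    finally show ?thesis .
  qed
  have "Y \<in> harm (Suc m)"
    unfolding harm_def
  proof (intro CollectI conjI allI impI Y_homs)
    fix i and q :: "real^'d \<Rightarrow> real" assume i: "i < Suc m" and q: "q \<in> homs i"
    \<comment> \<open>Powers of |x| do not change L, so a test polynomial of any lower degree can be
      raised to a multiple of |x| of degree m + 1, to which Y is orthogonal by construction.\<close>
    have "L (i + Suc m) (\<lambda>x. q x * Y x) = L (i + Suc m + (Suc m - i)) (\<lambda>x. coord_sum x ^ (Suc m - i) * (q x * Y x))"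
      by (rule L_coord_sum_power[symmetric, OF homs_mult[OF q Y_homs]])
    also have "(\<lambda>x. coord_sum x ^ (Suc m - i) * (q x * Y x)) = (\<lambda>x. coord_sum x * (coord_sum x ^ (m - i) * q x) * Y x)"
      using i by (simp add: Suc_diff_le mult_ac)
    also have "L (i + Suc m + (Suc m - i)) \<dots> = 0"
      unfolding L_eq_0_iff using homs_coord_sum_power[OF q, of "m - i"] i by (intro Yr) simp
    finally show "L (i + Suc m) (\<lambda>x. q x * Y x) = 0" .
  qed
  moreover obtain h where "h \<in> homs m" "v = (\<lambda>x. coord_sum x * h x)" using v_S by (auto simp: S_def)
  moreover have "p = (\<lambda>x. Y x + v x)" by (simp add: Y_def)
  ultimately show ?thesis by (intro exI[of _ Y] exI[of _ h]) auto
qed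

lemma harm_0: "harm 0 = homs 0"
  by (auto simp: harm_def)

text \<open>The extra exponent q makes the induction work: in p = Y + |x| h the term h has degree
  one less, and its factor |x| is absorbed by passing from q to q + 1.\<close>

lemma E_K_homs_aux:
  "p \<in> homs k \<Longrightarrow> k + q \<le> n \<Longrightarrow> \<exists>t\<in>polys_lt n. \<forall>y. E (\<lambda>x. K n x y * (coord_sum x ^ q * p x)) =
    (if k + q = n then coord_sum y ^ q * p y + t y else 0)"
proof (induction k arbitrary: p q)
  case 0
  thus ?case by (intro E_K_harm) (simp_all add: harm_0)
next
  case (Suc m)
  from harm_decomposition_step[OF Suc.prems(1)] obtain Y h where
    Y: "Y \<in> harm (Suc m)" and h: "h \<in> homs m" and p: "p = (\<lambda>x. Y x + coord_sum x * h x)"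
    by (elim exE conjE)
  obtain t1 where t1: "t1 \<in> polys_lt n" "\<forall>y. E (\<lambda>x. K n x y * (coord_sum x ^ q * Y x)) =
    (if Suc m + q = n then coord_sum y ^ q * Y y + t1 y else 0)"
    using E_K_harm[OF Y Suc.prems(2)] by (elim bexE)
  have "m + Suc q \<le> n" using Suc.prems by simp
  from Suc.IH[OF h this] obtain t2 where t2: "t2 \<in> polys_lt n"
    "\<forall>y. E (\<lambda>x. K n x y * (coord_sum x ^ Suc q * h x)) =
    (if m + Suc q = n then coord_sum y ^ Suc q * h y + t2 y else 0)"
    by (elim bexE)
  have rpf: "real_polynomial_function (\<lambda>x. K n x y * (coord_sum x ^ q' * f x))"
    if "f \<in> homs k" for f k q' y
    by (intro real_polynomial_function.intros(4) real_polynomial_function_coord_sum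
        rpf_homs[OF that] real_polynomial_function_polys_le[OF K_polys_le])
  have split: "E (\<lambda>x. K n x y * (coord_sum x ^ q * p x)) =
      E (\<lambda>x. K n x y * (coord_sum x ^ q * Y x)) + E (\<lambda>x. K n x y * (coord_sum x ^ Suc q * h x))" for y
  proof -
    have "(\<lambda>x. K n x y * (coord_sum x ^ q * p x)) =
        (\<lambda>x. K n x y * (coord_sum x ^ q * Y x) + K n x y * (coord_sum x ^ Suc q * h x))"
      by (simp add: p fun_eq_iff distrib_left mult_ac)
    thus ?thesis using E_add[OF rpf[OF harm_homs[OF Y]] rpf[OF h], of y q y "Suc q"] by (simp only:)
  qed
  have "E (\<lambda>x. K n x y * (coord_sum x ^ q * p x)) =
    (if Suc m + q = n then coord_sum y ^ q * p y + (t1 y + t2 y) else 0)" for y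
    unfolding split t1(2)[THEN spec] t2(2)[THEN spec] using fun_cong[OF p, of y]
    by (simp add: distrib_left mult_ac)
  moreover have "(\<lambda>y. t1 y + t2 y) \<in> polys_lt n" using t1(1) t2(1) by (rule polys_on_add)
  ultimately show ?case by (intro bexI[of _ "\<lambda>y. t1 y + t2 y"] allI)
qed

end

section \<open>Orthonormal bases\<close>

context simplex_weight
begin

lemma E_K_homs:
  assumes "p \<in> homs k" "k \<le> n"
  shows "\<exists>t\<in>polys_lt n. \<forall>y. E (\<lambda>x. K n x y * p x) = (if k = n then p y + t y else 0)"
  using E_K_homs_aux[OF assms(1), of 0 n] assms(2) by (simp only: power_0 mult_1_left add_0_right)

lemma rpf_K: "real_polynomial_function (\<lambda>x. K n x y)"
  by (rule real_polynomial_function_polys_le[OF K_polys_le])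

lemma E_K_xpow_sum:
  assumes "finite I"
  shows "E (\<lambda>x. K n x y * (\<Sum>\<alpha>\<in>I. c \<alpha> * xpow \<alpha> x)) = (\<Sum>\<alpha>\<in>I. c \<alpha> * E (\<lambda>x. K n x y * xpow \<alpha> x))"
proof -
  have "E (\<lambda>x. K n x y * (\<Sum>\<alpha>\<in>I. c \<alpha> * xpow \<alpha> x)) = E (\<lambda>x. \<Sum>\<alpha>\<in>I. c \<alpha> * (K n x y * xpow \<alpha> x))"
    unfolding sum_distrib_left by (simp add: mult.left_commute)
  also have "\<dots> = (\<Sum>\<alpha>\<in>I. c \<alpha> * E (\<lambda>x. K n x y * xpow \<alpha> x))"
    by (intro E_sum_scale assms real_polynomial_function.intros(4) rpf_K real_polynomial_function_xpow)
  finally show ?thesis .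
qed

lemma E_K_polys_lt:
  assumes "p \<in> polys_lt n"
  shows "E (\<lambda>x. K n x y * p x) = 0"
proof -
  obtain c where c: "p = (\<lambda>x. \<Sum>\<alpha>\<in>{\<alpha>. multideg \<alpha> < n}. c \<alpha> * xpow \<alpha> x)"
    using assms by (auto simp: polys_on_def)
  have "E (\<lambda>x. K n x y * xpow \<alpha> x) = 0" if "multideg \<alpha> < n" for \<alpha>
    using E_K_homs[of "xpow \<alpha>" "multideg \<alpha>" n] that xpow_homs[of \<alpha> "multideg \<alpha>"]
    by (auto simp: compositions_def)
  thus ?thesis unfolding c E_K_xpow_sum[OF finite_multideg_lt] by (intro sum.neutral) simp
qed

lemma E_K_polys_le:
  assumes "p \<in> polys_le n"
  shows "\<exists>t\<in>polys_lt n. \<forall>y. E (\<lambda>x. K n x y * p x) = p y + t y"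
proof -
  obtain c where c: "p = (\<lambda>x. \<Sum>\<alpha>\<in>{\<alpha>. multideg \<alpha> \<le> n}. c \<alpha> * xpow \<alpha> x)"
    using assms by (auto simp: polys_on_def polys_le_eq)
  define p1 where "p1 = (\<lambda>x. \<Sum>\<alpha>\<in>{\<alpha>. multideg \<alpha> < n}. c \<alpha> * xpow \<alpha> x)"
  define p2 where "p2 = (\<lambda>x. \<Sum>\<alpha>\<in>compositions n. c \<alpha> * xpow \<alpha> x)"
  have p1: "p1 \<in> polys_lt n" by (auto simp: p1_def polys_on_def)
  have p2: "p2 \<in> homs n" by (auto simp: p2_def polys_on_def)
  have p: "p = (\<lambda>x. p1 x + p2 x)"
  proof
    fix x
    have "{\<alpha> :: 'd \<Rightarrow> nat. multideg \<alpha> \<le> n} = {\<alpha>. multideg \<alpha> < n} \<union> compositions n"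
      by (auto simp: compositions_def)
    thus "p x = p1 x + p2 x" unfolding c p1_def p2_def
      by (simp only:) (rule sum.union_disjoint, auto simp: compositions_def simp del: finite_compositions intro: finite_compositions[unfolded compositions_def])
  qed
  obtain t where t: "t \<in> polys_lt n" "\<forall>y. E (\<lambda>x. K n x y * p2 x) = (if n = n then p2 y + t y else 0)"
    using E_K_homs[OF p2 order.refl] by (elim bexE)
  have "E (\<lambda>x. K n x y * p x) = p y + (t y - p1 y)" for y
  proof -
    have "E (\<lambda>x. K n x y * p x) = E (\<lambda>x. K n x y * p1 x) + E (\<lambda>x. K n x y * p2 x)"
      unfolding p distrib_left
      by (intro E_add real_polynomial_function.intros(4) rpf_K rpf_homs[OF p2]
          real_polynomial_function_polys_on[OF finite_multideg_lt p1])
    thus ?thesis using t(2) E_K_polys_lt[OF p1] by (simp add: p)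
  qed
  moreover have "(\<lambda>y. t y - p1 y) \<in> polys_lt n" using t(1) p1 by (rule polys_on_diff)
  ultimately show ?thesis by (intro bexI[of _ "\<lambda>y. t y - p1 y"] allI)
qed

text \<open>A property closed under sums and scalings and satisfied by f(y) f(x), hence inherited by
  \<open>K n\<close> from its expansion. The polynomiality clauses are included because additivity
  of E is available for polynomials.\<close>

definition fubini_kernel :: "(real ^ 'd \<Rightarrow> real ^ 'd \<Rightarrow> real) \<Rightarrow> bool" where
  "fubini_kernel k \<longleftrightarrow>
     (\<forall>y. real_polynomial_function (\<lambda>x. k x y)) \<and> (\<forall>x. real_polynomial_function (\<lambda>y. k x y)) \<and>
     (\<forall>p q. real_polynomial_function p \<longrightarrow> real_polynomial_function q \<longrightarrow>
        real_polynomial_function (\<lambda>y. E (\<lambda>x. k x y * p x)) \<and>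
        real_polynomial_function (\<lambda>x. E (\<lambda>y. k x y * q y)) \<and>
        E (\<lambda>y. E (\<lambda>x. k x y * p x) * q y) = E (\<lambda>x. E (\<lambda>y. k x y * q y) * p x))"

lemma fubini_kernelD:
  assumes "fubini_kernel k"
  shows "real_polynomial_function (\<lambda>x. k x y)" "real_polynomial_function (\<lambda>y. k x y)"
    "real_polynomial_function p \<Longrightarrow> real_polynomial_function (\<lambda>y. E (\<lambda>x. k x y * p x))"
    "real_polynomial_function q \<Longrightarrow> real_polynomial_function (\<lambda>x. E (\<lambda>y. k x y * q y))"
    "real_polynomial_function p \<Longrightarrow> real_polynomial_function q \<Longrightarrow>
      E (\<lambda>y. E (\<lambda>x. k x y * p x) * q y) = E (\<lambda>x. E (\<lambda>y. k x y * q y) * p x)"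
  using assms real_polynomial_function.intros(2)[of 0] unfolding fubini_kernel_def by blast+

lemma fubini_kernel_add:
  assumes "fubini_kernel k" "fubini_kernel l"
  shows "fubini_kernel (\<lambda>x y. k x y + l x y)"
proof -
  note k = fubini_kernelD[OF assms(1)] and l = fubini_kernelD[OF assms(2)]
  have 1: "E (\<lambda>x. (k x y + l x y) * p x) = E (\<lambda>x. k x y * p x) + E (\<lambda>x. l x y * p x)"
    if "real_polynomial_function p" for p y
    unfolding distrib_right by (intro E_add real_polynomial_function.intros(4) k l that)
  have 2: "E (\<lambda>y. (k x y + l x y) * q y) = E (\<lambda>y. k x y * q y) + E (\<lambda>y. l x y * q y)"
    if "real_polynomial_function q" for q x
    unfolding distrib_right by (intro E_add real_polynomial_function.intros(4) k l that)
  have 3: "E (\<lambda>y. E (\<lambda>x. (k x y + l x y) * p x) * q y) = E (\<lambda>x. E (\<lambda>y. (k x y + l x y) * q y) * p x)"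
    if p: "real_polynomial_function p" and q: "real_polynomial_function q" for p q
  proof -
    have "E (\<lambda>y. E (\<lambda>x. (k x y + l x y) * p x) * q y) =
        E (\<lambda>y. E (\<lambda>x. k x y * p x) * q y) + E (\<lambda>y. E (\<lambda>x. l x y * p x) * q y)"
      unfolding 1[OF p] unfolding distrib_right by (intro E_add real_polynomial_function.intros(4) k l p q)
    moreover have "E (\<lambda>x. E (\<lambda>y. (k x y + l x y) * q y) * p x) =
        E (\<lambda>x. E (\<lambda>y. k x y * q y) * p x) + E (\<lambda>x. E (\<lambda>y. l x y * q y) * p x)"
      unfolding 2[OF q] unfolding distrib_right by (intro E_add real_polynomial_function.intros(4) k l p q)
    ultimately show ?thesis using k(5)[OF p q] l(5)[OF p q] by simp
  qed
  show ?thesis unfolding fubini_kernel_def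
    using 3 by (intro conjI allI impI real_polynomial_function.intros(3) k l)
      (auto simp: 1 2 intro!: real_polynomial_function.intros(3) k l)
qed

lemma fubini_kernel_scale:
  assumes "fubini_kernel k"
  shows "fubini_kernel (\<lambda>x y. c * k x y)"
  unfolding fubini_kernel_def mult.assoc E_scale
  using fubini_kernelD[OF assms]
  by (auto intro!: real_polynomial_function.intros(4) real_polynomial_function.intros(2))

lemma fubini_kernel_zero: "fubini_kernel (\<lambda>x y. 0)"
  unfolding fubini_kernel_def by (simp add: E_zero real_polynomial_function.intros(2))

lemma fubini_kernel_product:
  assumes f: "real_polynomial_function f"
  shows "fubini_kernel (\<lambda>x y. f y * f x)"
proof -
  have 1: "E (\<lambda>x. f y * f x * p x) = E (\<lambda>x. f x * p x) * f y" for y and p :: "real^'d \<Rightarrow> real"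
    using E_scale[of "f y" "\<lambda>x. f x * p x"] by (simp add: mult_ac)
  have 2: "E (\<lambda>y. f y * f x * q y) = E (\<lambda>y. f y * q y) * f x" for x and q :: "real^'d \<Rightarrow> real"
    using E_scale[of "f x" "\<lambda>y. f y * q y"] by (simp add: mult_ac)
  show ?thesis
    unfolding fubini_kernel_def 1 2 unfolding mult.assoc E_scale
    by (auto intro!: real_polynomial_function.intros(4) real_polynomial_function.intros(2) f simp: mult.commute)
qed

lemma fubini_kernel_sum:
  "(\<And>i. i \<in> I \<Longrightarrow> fubini_kernel (k i)) \<Longrightarrow> fubini_kernel (\<lambda>x y. \<Sum>i\<in>I. k i x y)"
proof (induction I rule: infinite_finite_induct)
  case (insert i I)
  thus ?case by (simp add: fubini_kernel_add)
qed (simp_all add: fubini_kernel_zero)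

lemma fubini_kernel_K: "fubini_kernel (K n)"
proof -
  define f where "f = (\<lambda>m N a \<beta> (x :: real^'d). coord_sum x ^ a * xpow \<beta> x * (1 - coord_sum x) ^ (m - N))"
  have f: "real_polynomial_function (f m N a \<beta>)" for m N a \<beta>
    unfolding f_def
    by (intro real_polynomial_function.intros(4) real_polynomial_function_coord_sum real_polynomial_function_xpow)
  have eq: "K n = (\<lambda>x y. \<Sum>m\<le>n. \<Sum>N\<le>m. \<Sum>a\<le>N. \<Sum>\<beta>\<in>compositions (N - a).
      (ccoef n m * (theta a (N - a) / (fact (m - N) * pochhammer M (m - N))) * hcoef \<beta>) *
      (f m N a \<beta> y * f m N a \<beta> x))"
  proof (intro ext)
    fix x y :: "real^'d"
    define r s where "r = coord_sum x" and "s = coord_sum y"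
    show "K n x y = (\<Sum>m\<le>n. \<Sum>N\<le>m. \<Sum>a\<le>N. \<Sum>\<beta>\<in>compositions (N - a).
      (ccoef n m * (theta a (N - a) / (fact (m - N) * pochhammer M (m - N))) * hcoef \<beta>) *
      (f m N a \<beta> y * f m N a \<beta> x))"
      unfolding K_def G_def hk_def f_def r_def[symmetric] s_def[symmetric]
        sum_distrib_left sum_distrib_right power_mult_distrib
      by (intro sum.cong refl) simp
  qed
  show ?thesis
    unfolding eq by (intro fubini_kernel_sum fubini_kernel_scale) (rule fubini_kernel_product[OF f])
qed

text \<open>The definition asks for degree exactly n or the zero function, which is not visibly
  linear. A nonzero p orthogonal to all lower degrees cannot itself have lower degree, as it would
  be orthogonal to itself.\<close>

lemma orth_space_iff:
  "p \<in> orth_space U n \<longleftrightarrow> p \<in> polys_le n \<and> (\<forall>q\<in>polys_lt n. E (\<lambda>x. p x * q x) = 0)"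
proof
  assume p: "p \<in> orth_space U n"
  show "p \<in> polys_le n \<and> (\<forall>q\<in>polys_lt n. E (\<lambda>x. p x * q x) = 0)"
  proof (cases "p = (\<lambda>_. 0)")
    case True
    thus ?thesis by (simp add: E_zero polys_le_eq polys_on_zero)
  next
    case False
    hence *: "p \<in> polys_le n" "\<And>m q. m < n \<Longrightarrow> q \<in> polys_le m \<Longrightarrow> E (\<lambda>x. p x * q x) = 0"
      using p by (auto simp: orth_space_def inner_T_eq_E)
    have "E (\<lambda>x. p x * q x) = 0" if "q \<in> polys_lt n" for q
    proof (cases "n = 0")
      case True
      hence "q = (\<lambda>_. 0)" using that polys_lt_iff[of q n] by (simp only: if_True simp_thms)
      thus ?thesis by (simp add: E_zero)
    next
      case False
      thus ?thesis using that *(2)[of "n - 1" q] polys_lt_iff[of q n] by (simp only: if_False simp_thms)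
    qed
    thus ?thesis using *(1) by blast
  qed
next
  assume *: "p \<in> polys_le n \<and> (\<forall>q\<in>polys_lt n. E (\<lambda>x. p x * q x) = 0)"
  show "p \<in> orth_space U n"
  proof (cases "p = (\<lambda>_. 0)")
    case False
    have lt: "q \<in> polys_lt n" if "q \<in> polys_le m" "m < n" for m and q :: "real^'d \<Rightarrow> real"
      using that unfolding polys_le_eq by (elim polys_on_mono) auto
    have "p \<notin> polys_lt n"
      using * False E_pos_def[OF real_polynomial_function_polys_le[of p n]] by fastforce
    thus ?thesis using * lt by (auto simp: orth_space_def inner_T_eq_E)
  qed (simp add: orth_space_def)
qed

lemma rpf_polys_lt: "p \<in> polys_lt n \<Longrightarrow> real_polynomial_function p"
  by (rule real_polynomial_function_polys_on[OF finite_multideg_lt])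

lemma rpf_orth_space: "p \<in> orth_space U n \<Longrightarrow> real_polynomial_function p"
  unfolding orth_space_iff using real_polynomial_function_polys_le by blast

lemma K_orth_space: "(\<lambda>x. K n x y) \<in> orth_space U n"
  unfolding orth_space_iff using K_polys_le E_K_polys_lt by blast

text \<open>Exchange the two expectations and use the symmetry of K: the operator then acts on q,
  which it annihilates.\<close>

lemma E_K_orth:
  assumes p: "real_polynomial_function p" and q: "q \<in> polys_lt n"
  shows "E (\<lambda>y. E (\<lambda>x. K n x y * p x) * q y) = 0"
proof -
  have "E (\<lambda>y. E (\<lambda>x. K n x y * p x) * q y) = E (\<lambda>x. E (\<lambda>y. K n x y * q y) * p x)"
    by (rule fubini_kernelD(5)[OF fubini_kernel_K p rpf_polys_lt[OF q]])
  also have "(\<lambda>x. E (\<lambda>y. K n x y * q y)) = (\<lambda>x. 0)"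
    using E_K_polys_lt[OF q] by (subst K_sym) simp
  hence "E (\<lambda>x. E (\<lambda>y. K n x y * q y) * p x) = E (\<lambda>x. 0 * p x)" by (simp only: fun_eq_iff)
  finally show ?thesis by (simp add: E_zero)
qed

text \<open>The image of P is P + t with t of lower degree. Both the image and P are orthogonal to
  t, hence E(t^2) = 0 and t = 0.\<close>

lemma E_K_reproducing:
  assumes P: "P \<in> orth_space U n"
  shows "E (\<lambda>x. K n x y * P x) = P y"
proof -
  obtain t where t: "t \<in> polys_lt n" "\<forall>y. E (\<lambda>x. K n x y * P x) = P y + t y"
    using E_K_polys_le P unfolding orth_space_iff by blast
  have "0 = E (\<lambda>y. E (\<lambda>x. K n x y * P x) * t y)"
    using E_K_orth[OF rpf_orth_space[OF P] t(1)] by simp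
  also have "\<dots> = E (\<lambda>y. P y * t y + t y * t y)"
    unfolding t(2)[THEN spec] by (simp add: distrib_right)
  also have "\<dots> = E (\<lambda>y. P y * t y) + E (\<lambda>y. t y * t y)"
    by (intro E_add real_polynomial_function.intros(4) rpf_orth_space[OF P] rpf_polys_lt[OF t(1)])
  also have "E (\<lambda>y. P y * t y) = 0" using P t(1) unfolding orth_space_iff by blast
  finally have "t = (\<lambda>_. 0)" using E_pos_def[OF rpf_polys_lt[OF t(1)]] by force
  thus ?thesis using t(2) by simp
qed

lemma orth_space_add: "p \<in> orth_space U n \<Longrightarrow> q \<in> orth_space U n \<Longrightarrow> (\<lambda>x. p x + q x) \<in> orth_space U n"
proof -
  assume p: "p \<in> orth_space U n" and q: "q \<in> orth_space U n"
  have "E (\<lambda>x. (p x + q x) * f x) = 0" if f: "f \<in> polys_lt n" for f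
  proof -
    have "E (\<lambda>x. (p x + q x) * f x) = E (\<lambda>x. p x * f x) + E (\<lambda>x. q x * f x)"
      unfolding distrib_right
      by (intro E_add real_polynomial_function.intros(4) rpf_orth_space[OF p] rpf_orth_space[OF q] rpf_polys_lt[OF f])
    thus ?thesis using p q f by (simp add: orth_space_iff)
  qed
  thus ?thesis using p q by (simp add: orth_space_iff polys_le_add)
qed

lemma orth_space_scale: "p \<in> orth_space U n \<Longrightarrow> (\<lambda>x. c * p x) \<in> orth_space U n"
  by (simp add: orth_space_iff polys_le_scale mult.assoc E_scale)

lemma orth_space_zero: "(\<lambda>_. 0) \<in> orth_space U n"
  by (simp add: orth_space_def)

text \<open>Reproduction writes P as the same combination of images p_\<alpha> of monomials as of
  the monomials themselves, so the finitely many p_\<alpha> span the space; Gram--Schmidt then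
  applies to them.\<close>

lemma orthonormal_basis_exists: "\<exists>B. orthonormal_basis U n B"
proof -
  define p where "p = (\<lambda>\<alpha> y. E (\<lambda>x. K n x y * xpow \<alpha> x))"
  define I where "I = {\<alpha> :: 'd \<Rightarrow> nat. multideg \<alpha> \<le> n}"
  have p_in: "p \<alpha> \<in> orth_space U n" if "\<alpha> \<in> I" for \<alpha>
  proof -
    have "xpow \<alpha> \<in> polys_le n"
      using that unfolding I_def polys_le_eq by (intro xpow_in_polys_on) auto
    then obtain t where t: "t \<in> polys_lt n" "\<forall>y. E (\<lambda>x. K n x y * xpow \<alpha> x) = xpow \<alpha> y + t y"
      using E_K_polys_le by blast
    have "p \<alpha> = (\<lambda>y. xpow \<alpha> y + t y)" unfolding p_def using t(2) by (intro ext) (rule spec)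
    hence "p \<alpha> \<in> polys_le n"
      using polys_le_add[OF \<open>xpow \<alpha> \<in> polys_le n\<close> polys_lt_polys_le[OF t(1)]] by simp
    moreover have "E (\<lambda>y. p \<alpha> y * q y) = 0" if "q \<in> polys_lt n" for q
      unfolding p_def by (rule E_K_orth[OF real_polynomial_function_xpow that])
    ultimately show ?thesis by (simp add: orth_space_iff)
  qed
  have "\<exists>B. finite B \<and> B \<subseteq> orth_space U n \<and>
      (\<forall>f\<in>B. \<forall>g\<in>B. inner_T U f g = (if f = g then 1 else 0)) \<and>
      (\<forall>f\<in>p ` I. \<exists>c. f = (\<lambda>x. \<Sum>b\<in>B. c b * b x))"
  proof (rule gram_schmidt)
    show "finite (p ` I)" by (simp add: I_def)
    show "p ` I \<subseteq> orth_space U n" using p_in by auto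
    fix f g h :: "real^'d \<Rightarrow> real" and c :: real
    show "inner_T U (\<lambda>x. f x + g x) h = inner_T U f h + inner_T U g h"
      if "f \<in> orth_space U n" "g \<in> orth_space U n" "h \<in> orth_space U n"
      using that unfolding inner_T_eq_E distrib_right
      by (intro E_add real_polynomial_function.intros(4) rpf_orth_space)
    show "inner_T U (\<lambda>x. c * f x) h = c * inner_T U f h"
      unfolding inner_T_eq_E mult.assoc by (rule E_scale)
    show "inner_T U f h = inner_T U h f" by (simp add: inner_T_eq_E mult.commute)
    show "inner_T U f f > 0" if "f \<in> orth_space U n" "f \<noteq> (\<lambda>_. 0)"
      unfolding inner_T_eq_E using that by (intro E_pos_def rpf_orth_space)
  qed (fact orth_space_add orth_space_scale orth_space_zero)+
  then obtain B where B: "finite B" "B \<subseteq> orth_space U n"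
    "\<forall>f\<in>B. \<forall>g\<in>B. inner_T U f g = (if f = g then 1 else 0)"
    "\<forall>f\<in>p ` I. \<exists>c. f = (\<lambda>x. \<Sum>b\<in>B. c b * b x)" by (elim exE conjE)
  have "\<forall>\<alpha>\<in>I. \<exists>d. p \<alpha> = (\<lambda>x. \<Sum>b\<in>B. d b * b x)" using B(4) by simp
  from bchoice[OF this] obtain d where d: "\<forall>\<alpha>\<in>I. p \<alpha> = (\<lambda>x. \<Sum>b\<in>B. d \<alpha> b * b x)" by (elim exE)
  have "\<exists>c. P = (\<lambda>x. \<Sum>b\<in>B. c b * b x)" if P: "P \<in> orth_space U n" for P
  proof -
    have "P \<in> polys_le n" using P by (simp add: orth_space_iff)
    then obtain c where c: "P = (\<lambda>x. \<Sum>\<alpha>\<in>I. c \<alpha> * xpow \<alpha> x)"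
      by (auto simp: polys_on_def polys_le_eq I_def)
    have "P y = (\<Sum>b\<in>B. (\<Sum>\<alpha>\<in>I. c \<alpha> * d \<alpha> b) * b y)" for y
    proof -
      have "P y = E (\<lambda>x. K n x y * (\<Sum>\<alpha>\<in>I. c \<alpha> * xpow \<alpha> x))"
        using E_K_reproducing[OF P, of y] unfolding fun_cong[OF c] by simp
      also have "\<dots> = (\<Sum>\<alpha>\<in>I. c \<alpha> * p \<alpha> y)"
        unfolding p_def by (rule E_K_xpow_sum) (simp add: I_def)
      also have "\<dots> = (\<Sum>\<alpha>\<in>I. \<Sum>b\<in>B. c \<alpha> * d \<alpha> b * b y)"
        using d by (intro sum.cong refl) (simp add: sum_distrib_left mult.assoc)
      also have "\<dots> = (\<Sum>b\<in>B. (\<Sum>\<alpha>\<in>I. c \<alpha> * d \<alpha> b) * b y)"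
        by (subst sum.swap) (simp add: sum_distrib_right)
      finally show ?thesis .
    qed
    thus ?thesis by (intro exI[of _ "\<lambda>b. \<Sum>\<alpha>\<in>I. c \<alpha> * d \<alpha> b"] ext)
  qed
  thus ?thesis using B unfolding orthonormal_basis_def by (intro exI[of _ B]) auto
qed

text \<open>Expand the function \<open>K n\<close> with second argument y in the basis; pairing with
  Q and reproducing shows that the coefficient of Q is Q(y).\<close>

lemma orthonormal_basis_kernel:
  assumes B: "orthonormal_basis U n B"
  shows "(\<Sum>Q\<in>B. Q x * Q y) = K n x y"
proof -
  have B': "finite B" "B \<subseteq> orth_space U n" "\<And>P Q. P \<in> B \<Longrightarrow> Q \<in> B \<Longrightarrow> E (\<lambda>x. P x * Q x) = (if P = Q then 1 else 0)"
    using B by (auto simp: orthonormal_basis_def inner_T_eq_E)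
  obtain c where c: "(\<lambda>x. K n x y) = (\<lambda>x. \<Sum>Q\<in>B. c Q * Q x)"
    using B K_orth_space[of n y] unfolding orthonormal_basis_def by blast
  have "c Q = Q y" if Q: "Q \<in> B" for Q
  proof -
    have rpf: "real_polynomial_function P" if "P \<in> B" for P using that B'(2) rpf_orth_space by blast
    have "Q y = E (\<lambda>x. K n x y * Q x)" using Q B'(2) by (intro E_K_reproducing[symmetric]) auto
    also have "\<dots> = E (\<lambda>x. \<Sum>P\<in>B. c P * (P x * Q x))"
      unfolding fun_cong[OF c] sum_distrib_right by (simp add: mult.assoc)
    also have "\<dots> = (\<Sum>P\<in>B. c P * E (\<lambda>x. P x * Q x))"
      by (intro E_sum_scale B'(1) real_polynomial_function.intros(4) rpf Q)
    also have "\<dots> = (\<Sum>P\<in>B. if P = Q then c Q else 0)"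
      using B'(3) Q by (intro sum.cong) auto
    also have "\<dots> = c Q" using Q B'(1) by simp
    finally show ?thesis ..
  qed
  thus ?thesis using fun_cong[OF c, of x] by (simp add: mult.commute)
qed

text \<open>The existence of a basis enters through uniqueness: if there were none, every k would
  satisfy the defining condition vacuously.\<close>

theorem repr_kernel_eq: "repr_kernel U n x y = K n x y"
  unfolding repr_kernel_def
proof (rule the_equality)
  show "\<forall>B. orthonormal_basis U n B \<longrightarrow> K n x y = (\<Sum>Q\<in>B. Q x * Q y)"
    by (simp add: orthonormal_basis_kernel)
  fix k assume "\<forall>B. orthonormal_basis U n B \<longrightarrow> k = (\<Sum>Q\<in>B. Q x * Q y)"
  thus "k = K n x y" using orthonormal_basis_exists[of n] orthonormal_basis_kernel by blast
qed

end

section \<open>The integral representation\<close>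

lemma sum_even_indices:
  fixes f :: "nat \<Rightarrow> real"
  assumes "\<And>k. f (Suc (2 * k)) = 0"
  shows "(\<Sum>k\<le>2 * m. f k) = (\<Sum>k\<le>m. f (2 * k))"
proof (induction m)
  case (Suc m)
  have "(\<Sum>k\<le>2 * Suc m. f k) = (\<Sum>k\<le>2 * m. f k) + f (Suc (2 * m)) + f (2 * Suc m)" by simp
  thus ?case using Suc assms by simp
qed simp

lemma power_add_div_fact:
  fixes a b :: real
  shows "(a + b) ^ n / fact n = (\<Sum>k\<le>n. a ^ k / fact k * (b ^ (n - k) / fact (n - k)))"
proof -
  have "(a + b) ^ n / fact n = (\<Sum>k\<le>n. real (n choose k) * a ^ k * b ^ (n - k) / fact n)"
    by (simp add: binomial_ring sum_divide_distrib)
  also have "\<dots> = (\<Sum>k\<le>n. a ^ k / fact k * (b ^ (n - k) / fact (n - k)))"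
    by (intro sum.cong refl) (simp add: binomial_fact)
  finally show ?thesis .
qed

text \<open>In the binomial expansion the odd powers of X integrate to zero. Dividing by the
  factorial distributes the binomial coefficient over both factors, so the lemma can be applied to s
  and then again to t.\<close>

lemma integral_even_power:
  fixes X :: "'a \<Rightarrow> real"
  assumes int: "\<And>e. integrable M (\<lambda>x. X x ^ e)"
    and odd: "\<And>e. (LINT x|M. X x ^ Suc (2 * e)) = 0"
  shows "integrable M (\<lambda>x. (P + c * X x) ^ (2 * m) / fact (2 * m))"
    and "(LINT x|M. (P + c * X x) ^ (2 * m) / fact (2 * m)) =
      (\<Sum>k\<le>m. P ^ (2 * (m - k)) / fact (2 * (m - k)) * (c ^ (2 * k) * ((LINT x|M. X x ^ (2 * k)) / fact (2 * k))))"
proof -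
  define d where "d = (\<lambda>k. c ^ k / fact k * (P ^ (2 * m - k) / fact (2 * m - k)))"
  have eq: "(P + c * X x) ^ (2 * m) / fact (2 * m) = (\<Sum>k\<le>2 * m. d k * X x ^ k)" for x
    unfolding add.commute[of P] power_add_div_fact d_def
    by (intro sum.cong refl) (simp add: power_mult_distrib)
  show "integrable M (\<lambda>x. (P + c * X x) ^ (2 * m) / fact (2 * m))"
    unfolding eq by (intro Bochner_Integration.integrable_sum integrable_mult_right int)
  have "(LINT x|M. (P + c * X x) ^ (2 * m) / fact (2 * m)) = (\<Sum>k\<le>2 * m. d k * (LINT x|M. X x ^ k))"
    unfolding eq using int by (subst Bochner_Integration.integral_sum) auto
  also have "\<dots> = (\<Sum>k\<le>m. d (2 * k) * (LINT x|M. X x ^ (2 * k)))"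
    using odd by (intro sum_even_indices) simp
  also have "\<dots> = (\<Sum>k\<le>m. P ^ (2 * (m - k)) / fact (2 * (m - k)) * (c ^ (2 * k) * ((LINT x|M. X x ^ (2 * k)) / fact (2 * k))))"
    unfolding d_def diff_mult_distrib2[symmetric] by (intro sum.cong refl) (simp add: mult_ac)
  finally show "(LINT x|M. (P + c * X x) ^ (2 * m) / fact (2 * m)) =
      (\<Sum>k\<le>m. P ^ (2 * (m - k)) / fact (2 * (m - k)) * (c ^ (2 * k) * ((LINT x|M. X x ^ (2 * k)) / fact (2 * k))))" .
qed

lemma sum_power_div_fact:
  fixes w :: "'d::finite \<Rightarrow> real"
  shows "(\<Sum>i\<in>UNIV. w i) ^ e / fact e = (\<Sum>\<gamma>\<in>compositions e. \<Prod>i\<in>UNIV. w i ^ \<gamma> i / fact (\<gamma> i))"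
proof -
  have "(\<Sum>i\<in>UNIV. w i) ^ e / fact e = fps_nth (\<Prod>i\<in>UNIV. fps_exp (w i)) e"
    by (simp add: prod_fps_exp)
  thus ?thesis by (simp add: fps_nth_prod_compositions)
qed

lemma set_integral_sum:
  fixes f :: "'b \<Rightarrow> 'a \<Rightarrow> real"
  assumes "finite I" "\<And>i. i \<in> I \<Longrightarrow> set_integrable M S (f i)"
  shows "(LINT x:S|M. (\<Sum>i\<in>I. c i * f i x)) = (\<Sum>i\<in>I. c i * (LINT x:S|M. f i x))"
proof -
  have "(LINT x:S|M. (\<Sum>i\<in>I. c i * f i x)) = (LINT x|M. (\<Sum>i\<in>I. c i * (indicator S x *\<^sub>R f i x)))"
    by (simp add: set_lebesgue_integral_def sum_distrib_left mult.left_commute)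
  also have "\<dots> = (\<Sum>i\<in>I. LINT x|M. c i * (indicator S x *\<^sub>R f i x))"
    using assms by (intro Bochner_Integration.integral_sum integrable_mult_right) (auto simp: set_integrable_def)
  finally show ?thesis by (simp add: set_lebesgue_integral_def)
qed

section \<open>Normalized even moments and the polynomial \<Xi>\<close>

lemma fact_double_real: "fact (2 * n) = (4 ^ n * pochhammer (1 / 2) n * fact n :: real)"
  by (simp add: fact_double power_mult)

lemma gegen_even_moment:
  assumes "a \<ge> 0"
  shows "(LINT t|gegen_measure a. t ^ (2 * b)) / fact (2 * b) = 1 / (4 ^ b * fact b * pochhammer (a + 1 / 2) b)"
proof -
  have "pochhammer (1 / 2 :: real) b > 0" by (intro pochhammer_pos) simp
  thus ?thesis by (simp add: integral_gegen_even[OF assms] fact_double_real)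
qed

lemma gegenbauer_even:
  "gegenbauer (2 * n) l t = (\<Sum>m\<le>n. (-1) ^ (n - m) * pochhammer l (n + m) / (fact (n - m) * fact (2 * m)) * (2 * t) ^ (2 * m))"
proof -
  have "gegenbauer (2 * n) l t = (\<Sum>k\<le>n. (-1) ^ k * pochhammer l (2 * n - k) / (fact k * fact (2 * n - 2 * k)) * (2 * t) ^ (2 * n - 2 * k))"
    by (simp add: gegenbauer_def)
  also have "\<dots> = (\<Sum>m\<le>n. (-1) ^ (n - m) * pochhammer l (n + m) / (fact (n - m) * fact (2 * m)) * (2 * t) ^ (2 * m))"
  proof (rule sum.reindex_bij_witness[of _ "\<lambda>m. n - m" "\<lambda>k. n - k"])
    fix k assume "k \<in> {..n}"
    hence "n + (n - k) = 2 * n - k" "n - (n - k) = k" "2 * (n - k) = 2 * n - 2 * k" by auto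
    thus "(-1) ^ (n - (n - k)) * pochhammer l (n + (n - k)) / (fact (n - (n - k)) * fact (2 * (n - k))) * (2 * t) ^ (2 * (n - k)) =
      (-1) ^ k * pochhammer l (2 * n - k) / (fact k * fact (2 * n - 2 * k)) * (2 * t) ^ (2 * n - 2 * k)" by (simp only:)
  qed auto
  finally show ?thesis .
qed

text \<open>The values 2 t^2 - 1 cover an infinite set. This gives the uniqueness behind
  \<open>Xi_poly\<close>.\<close>

lemma poly_eqI_quadratic:
  fixes p q :: "real poly"
  assumes "\<And>t. poly p (2 * t\<^sup>2 - 1) = poly q (2 * t\<^sup>2 - 1)"
  shows "p = q"
proof (rule ccontr)
  assume "p \<noteq> q"
  hence "finite {s. poly (p - q) s = 0}" by (intro poly_roots_finite) simp
  moreover have "{0..} \<subseteq> {s. poly (p - q) s = 0}"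
  proof
    fix s :: real assume "s \<in> {0..}"
    hence "s = 2 * (sqrt ((s + 1) / 2))\<^sup>2 - 1" by (simp add: field_simps)
    thus "s \<in> {s. poly (p - q) s = 0}" using assms[of "sqrt ((s + 1) / 2)"] by simp
  qed
  ultimately have "finite {0::real..}" by (rule finite_subset[rotated])
  thus False using infinite_Ici by blast
qed

lemma poly_Xi:
  assumes "l > 0"
  shows "poly (Xi_poly n l) (2 * t\<^sup>2 - 1) = (2 * real n + l) / l * gegenbauer (2 * n) l t"
proof -
  define c where "c = (\<lambda>m. (2 * real n + l) / l * ((-1) ^ (n - m) * pochhammer l (n + m) / (fact (n - m) * fact (2 * m)) * 4 ^ m))"
  \<comment> \<open>With s = 2 t^2 - 1, the polynomial \<open>[:1/2, 1/2:]\<close> represents t^2 =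
    (1 + s) / 2. Only m = n reaches degree n, and its coefficient is nonzero because l > 0.\<close>
  define p where "p = (\<Sum>m\<le>n. smult (c m) ([:1/2, 1/2:] ^ m))"
  have p: "poly p (2 * t\<^sup>2 - 1) = (2 * real n + l) / l * gegenbauer (2 * n) l t" for t
  proof -
    have "poly p (2 * t\<^sup>2 - 1) = (\<Sum>m\<le>n. c m * (t\<^sup>2) ^ m)"
      by (simp add: p_def poly_sum field_simps)
    moreover have "(2 * t) ^ (2 * m) = 4 ^ m * (t\<^sup>2) ^ m" for m
      by (simp add: power_mult power_mult_distrib)
    ultimately show ?thesis
      unfolding gegenbauer_even sum_distrib_left c_def by (simp add: mult_ac)
  qed
  have deg: "degree ([:1/2, 1/2 :: real:] ^ m) = m" for m
    by (subst degree_power_eq) auto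
  have "degree p = n"
  proof (rule antisym)
    show "degree p \<le> n" unfolding p_def
      by (intro degree_sum_le) (auto intro: order.trans[OF degree_smult_le] simp: deg)
    have "coeff p n = (\<Sum>m\<le>n. c m * coeff ([:1/2, 1/2:] ^ m) n)"
      by (simp add: p_def coeff_sum)
    also have "\<dots> = (\<Sum>m\<le>n. if m = n then c n * (1 / 2) ^ n else 0)"
    proof (intro sum.cong refl)
      fix m assume "m \<in> {..n}"
      show "c m * coeff ([:1/2, 1/2:] ^ m) n = (if m = n then c n * (1 / 2) ^ n else 0)"
      proof (cases "m = n")
        case True
        have "coeff ([:1/2, 1/2 :: real:] ^ n) n = lead_coeff ([:1/2, 1/2:] ^ n)" by (simp only: deg)
        also have "\<dots> = (1 / 2) ^ n" by (simp add: lead_coeff_power)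
        finally show ?thesis using True by simp
      next
        case False
        thus ?thesis using \<open>m \<in> {..n}\<close> by (simp add: coeff_eq_0 deg)
      qed
    qed
    also have "\<dots> = c n * (1 / 2) ^ n" by simp
    finally have "coeff p n \<noteq> 0"
      using assms pochhammer_pos[OF assms, of "n + n"] by (simp add: c_def)
    thus "n \<le> degree p" by (rule le_degree)
  qed
  have "Xi_poly n l = p"
    unfolding Xi_poly_def
  proof (rule the_equality)
    show "degree p = n \<and> (\<forall>t. poly p (2 * t\<^sup>2 - 1) = (2 * real n + l) / l * gegenbauer (2 * n) l t)"
      using \<open>degree p = n\<close> p by blast
    fix q :: "real poly"
    assume "degree q = n \<and> (\<forall>t. poly q (2 * t\<^sup>2 - 1) = (2 * real n + l) / l * gegenbauer (2 * n) l t)"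
    thus "q = p" using p by (intro poly_eqI_quadratic) simp
  qed
  thus ?thesis using p by simp
qed

context simplex_weight
begin

lemma poly_Xi_lam:
  "poly (Xi_poly n lam) (2 * t\<^sup>2 - 1) = (\<Sum>m\<le>n. ccoef n m * 4 ^ m * (t ^ (2 * m) / fact (2 * m)))"
  unfolding poly_Xi[OF lam_pos] gegenbauer_even sum_distrib_left ccoef_def
  by (intro sum.cong refl) (simp add: power_mult_distrib power_mult)

section \<open>Integration over the auxiliary variables\<close>

abbreviation Ps :: "('d \<Rightarrow> real) measure" where
  "Ps \<equiv> PiM UNIV (\<lambda>i. gegen_measure (\<kappa> $ i))"

lemma product_sigma_finite_gegen: "product_sigma_finite (\<lambda>i. gegen_measure (\<kappa> $ i))"
  unfolding product_sigma_finite_def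
  using finite_measure_gegen(1)[OF kappa_nonneg] finite_measure.axioms(1) by blast

lemma Ps_power:
  fixes z :: "'d \<Rightarrow> real"
  shows "integrable Ps (\<lambda>s. (\<Sum>i\<in>UNIV. z i * s i) ^ e)"
    and "(LINT s|Ps. (\<Sum>i\<in>UNIV. z i * s i) ^ e) / fact e =
      (\<Sum>\<gamma>\<in>compositions e. \<Prod>i\<in>UNIV. z i ^ \<gamma> i * ((LINT t|gegen_measure (\<kappa> $ i). t ^ \<gamma> i) / fact (\<gamma> i)))"
proof -
  interpret product_sigma_finite "\<lambda>i. gegen_measure (\<kappa> $ i)" by (rule product_sigma_finite_gegen)
  define f where "f = (\<lambda>\<gamma> i t. (z i * t) ^ \<gamma> i / fact (\<gamma> i) :: real)"
  have f_int: "integrable (gegen_measure (\<kappa> $ i)) (f \<gamma> i)" for \<gamma> i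
    unfolding f_def power_mult_distrib
    using integrable_gegen_power[OF kappa_nonneg[of i], of "\<gamma> i"] by simp
  have eq: "(\<Sum>i\<in>UNIV. z i * s i) ^ e / fact e = (\<Sum>\<gamma>\<in>compositions e. \<Prod>i\<in>UNIV. f \<gamma> i (s i))" for s
    unfolding f_def by (rule sum_power_div_fact)
  have prod_int: "integrable Ps (\<lambda>s. \<Prod>i\<in>UNIV. f \<gamma> i (s i))" for \<gamma>
    using f_int by (intro product_integrable_prod) auto
  have "integrable Ps (\<lambda>s. (\<Sum>i\<in>UNIV. z i * s i) ^ e / fact e)"
    unfolding eq by (intro Bochner_Integration.integrable_sum prod_int)
  from integrable_mult_right[OF this, of "fact e"]
  show "integrable Ps (\<lambda>s. (\<Sum>i\<in>UNIV. z i * s i) ^ e)" by simp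
  have "(LINT s|Ps. (\<Sum>i\<in>UNIV. z i * s i) ^ e) / fact e = (LINT s|Ps. (\<Sum>i\<in>UNIV. z i * s i) ^ e / fact e)"
    by simp
  also have "\<dots> = (\<Sum>\<gamma>\<in>compositions e. LINT s|Ps. (\<Prod>i\<in>UNIV. f \<gamma> i (s i)))"
    unfolding eq by (intro Bochner_Integration.integral_sum prod_int)
  also have "\<dots> = (\<Sum>\<gamma>\<in>compositions e. \<Prod>i\<in>UNIV. (LINT t|gegen_measure (\<kappa> $ i). f \<gamma> i t))"
    using f_int by (intro sum.cong refl product_integral_prod) auto
  also have "\<dots> = (\<Sum>\<gamma>\<in>compositions e. \<Prod>i\<in>UNIV. z i ^ \<gamma> i * ((LINT t|gegen_measure (\<kappa> $ i). t ^ \<gamma> i) / fact (\<gamma> i)))"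
    by (simp add: f_def power_mult_distrib)
  finally show "(LINT s|Ps. (\<Sum>i\<in>UNIV. z i * s i) ^ e) / fact e =
      (\<Sum>\<gamma>\<in>compositions e. \<Prod>i\<in>UNIV. z i ^ \<gamma> i * ((LINT t|gegen_measure (\<kappa> $ i). t ^ \<gamma> i) / fact (\<gamma> i)))" .
qed

lemma gegen_moment_odd: "odd e \<Longrightarrow> (LINT t|gegen_measure (\<kappa> $ i). t ^ e) = 0"
  using integral_gegen_odd[OF kappa_nonneg[of i]] by (auto elim!: oddE simp del: power_Suc)

text \<open>A composition of an odd number has an odd part, and the corresponding one-dimensional
  moment vanishes.\<close>

lemma Ps_odd:
  fixes z :: "'d \<Rightarrow> real"
  shows "(LINT s|Ps. (\<Sum>i\<in>UNIV. z i * s i) ^ Suc (2 * e)) = 0"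
proof -
  have "(\<Prod>i\<in>UNIV. z i ^ \<gamma> i * ((LINT t|gegen_measure (\<kappa> $ i). t ^ \<gamma> i) / fact (\<gamma> i))) = 0"
    if \<gamma>: "\<gamma> \<in> compositions (Suc (2 * e))" for \<gamma>
  proof -
    have "\<exists>i. odd (\<gamma> i)"
    proof (rule ccontr)
      assume "\<not> (\<exists>i. odd (\<gamma> i))"
      hence "even (multideg \<gamma>)" by (intro dvd_sum) auto
      thus False using \<gamma> by (simp add: compositions_def)
    qed
    thus ?thesis using gegen_moment_odd by auto
  qed
  hence "(LINT s|Ps. (\<Sum>i\<in>UNIV. z i * s i) ^ Suc (2 * e)) / fact (Suc (2 * e)) = 0"
    unfolding Ps_power(2) by (intro sum.neutral) simp
  thus ?thesis by (simp del: power_Suc fact_Suc)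
qed

text \<open>Only compositions with all parts even survive; halving them gives the compositions of k,
  and the normalized moments combine to \<open>hcoef\<close>.\<close>

lemma Ps_even:
  fixes z :: "'d \<Rightarrow> real"
  shows "(LINT s|Ps. (\<Sum>i\<in>UNIV. z i * s i) ^ (2 * k)) / fact (2 * k) =
    (\<Sum>\<beta>\<in>compositions k. hcoef \<beta> * (\<Prod>i\<in>UNIV. (z i)\<^sup>2 ^ \<beta> i)) / 4 ^ k"
proof -
  define g where "g = (\<lambda>\<gamma>. \<Prod>i\<in>UNIV. z i ^ \<gamma> i * ((LINT t|gegen_measure (\<kappa> $ i). t ^ \<gamma> i) / fact (\<gamma> i)))"
  have g0: "g \<gamma> = 0" if "\<exists>i. odd (\<gamma> i)" for \<gamma>
    using that gegen_moment_odd unfolding g_def by auto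
  have "(LINT s|Ps. (\<Sum>i\<in>UNIV. z i * s i) ^ (2 * k)) / fact (2 * k) = (\<Sum>\<gamma>\<in>compositions (2 * k). g \<gamma>)"
    unfolding Ps_power(2) g_def ..
  also have "\<dots> = (\<Sum>\<gamma>\<in>{\<gamma> \<in> compositions (2 * k). \<forall>i. even (\<gamma> i)}. g \<gamma>)"
    using g0 by (intro sum.mono_neutral_right) auto
  also have "\<dots> = (\<Sum>\<beta>\<in>compositions k. g (\<lambda>i. 2 * \<beta> i))"
  proof (rule sum.reindex_bij_witness[of _ "\<lambda>\<beta> i. 2 * \<beta> i" "\<lambda>\<gamma> i. \<gamma> i div 2"])
    fix \<gamma> :: "'d \<Rightarrow> nat"
    assume \<gamma>: "\<gamma> \<in> {\<gamma> \<in> compositions (2 * k). \<forall>i. even (\<gamma> i)}"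
    thus eq: "(\<lambda>i. 2 * (\<gamma> i div 2)) = \<gamma>" by auto
    have "2 * multideg (\<lambda>i. \<gamma> i div 2) = multideg (\<lambda>i. 2 * (\<gamma> i div 2))"
      by (simp only: sum_distrib_left)
    also have "\<dots> = 2 * k" using \<gamma> unfolding eq by (simp add: compositions_def)
    finally show "(\<lambda>i. \<gamma> i div 2) \<in> compositions k" by (simp add: compositions_def)
    show "g (\<lambda>i. 2 * (\<gamma> i div 2)) = g \<gamma>" unfolding eq ..
  next
    fix \<beta> :: "'d \<Rightarrow> nat"
    assume "\<beta> \<in> compositions k"
    thus "(\<lambda>i. 2 * \<beta> i) \<in> {\<gamma> \<in> compositions (2 * k). \<forall>i. even (\<gamma> i)}"
      by (auto simp: compositions_def simp flip: sum_distrib_left)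
  qed auto
  also have "\<dots> = (\<Sum>\<beta>\<in>compositions k. hcoef \<beta> * (\<Prod>i\<in>UNIV. (z i)\<^sup>2 ^ \<beta> i) / 4 ^ k)"
  proof (intro sum.cong refl)
    fix \<beta> :: "'d \<Rightarrow> nat" assume "\<beta> \<in> compositions k"
    hence "(\<Prod>i\<in>UNIV. 4 ^ \<beta> i) = (4 ^ k :: real)"
      by (simp add: compositions_def flip: power_sum)
    thus "g (\<lambda>i. 2 * \<beta> i) = hcoef \<beta> * (\<Prod>i\<in>UNIV. (z i)\<^sup>2 ^ \<beta> i) / 4 ^ k"
      unfolding g_def gegen_even_moment[OF kappa_nonneg] hcoef_def
      by (simp add: prod.distrib prod_dividef power_mult)
  qed
  finally show ?thesis by (simp only: sum_divide_distrib)
qed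

lemma Ps_even_hk:
  assumes "x \<in> simplexT" "y \<in> simplexT"
  shows "(LINT s|Ps. (\<Sum>i\<in>UNIV. sqrt (x $ i * y $ i) * s i) ^ (2 * k)) / fact (2 * k) = hk k x y / 4 ^ k"
proof -
  have "(sqrt (x $ i * y $ i))\<^sup>2 = x $ i * y $ i" for i
    using assms by (simp add: simplexT_def)
  thus ?thesis
    unfolding Ps_even hk_def by (simp add: power_mult_distrib prod.distrib xpow_def mult_ac)
qed

text \<open>\<open>integral_even_power\<close> is used for s, with the u v and t terms as constant
  part, and then for t. The square roots in \<zeta> occur only to even powers, so on the simplex
  they turn into polynomials in x and y.\<close>

lemma inner_average:
  assumes x: "x \<in> simplexT" and y: "y \<in> simplexT"
  shows "(LINT t|gegen_measure \<mu>. (LINT s|Ps. (zeta_arg x y u v s t) ^ (2 * m) / fact (2 * m))) =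
    (\<Sum>k\<le>m. \<Sum>b\<le>m - k. (coord_sum x * coord_sum y) ^ (m - k - b) / fact (2 * (m - k - b)) *
      (hk k x y / 4 ^ k) * (((1 - coord_sum x) * (1 - coord_sum y)) ^ b / (4 ^ b * fact b * pochhammer M b)) *
      (v ^ (2 * (m - k - b)) * (u ^ (2 * (m - k - b)) * (1 - u) ^ (2 * k))))"
    and "integrable Ps (\<lambda>s. (zeta_arg x y u v s t) ^ (2 * m) / fact (2 * m))"
    and "integrable (gegen_measure \<mu>) (\<lambda>t. LINT s|Ps. (zeta_arg x y u v s t) ^ (2 * m) / fact (2 * m))"
proof -
  define X where "X = sqrt (coord_sum x) * sqrt (coord_sum y)"
  define W where "W = sqrt (1 - coord_sum x) * sqrt (1 - coord_sum y)"
  have nonneg: "coord_sum x \<ge> 0" "coord_sum y \<ge> 0" "1 - coord_sum x \<ge> 0" "1 - coord_sum y \<ge> 0"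
    using x y by (auto simp: simplexT_def intro!: sum_nonneg)
  have X2: "X ^ (2 * a) = (coord_sum x * coord_sum y) ^ a" for a
    using nonneg by (simp add: X_def power_mult power_mult_distrib)
  have W2: "W ^ (2 * a) = ((1 - coord_sum x) * (1 - coord_sum y)) ^ a" for a
    using nonneg by (simp add: W_def power_mult power_mult_distrib)
  have zeta: "zeta_arg x y u v s t = (X * u * v + W * t) + (1 - u) * (\<Sum>i\<in>UNIV. sqrt (x $ i * y $ i) * s i)" for s t
    by (simp add: zeta_arg_def X_def W_def)
  show "integrable Ps (\<lambda>s. (zeta_arg x y u v s t) ^ (2 * m) / fact (2 * m))"
    unfolding zeta by (rule integral_even_power(1)[OF Ps_power(1) Ps_odd])
  have inner: "(LINT s|Ps. (zeta_arg x y u v s t) ^ (2 * m) / fact (2 * m)) =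
    (\<Sum>k\<le>m. (X * u * v + W * t) ^ (2 * (m - k)) / fact (2 * (m - k)) * ((1 - u) ^ (2 * k) * (hk k x y / 4 ^ k)))" for t
    unfolding zeta integral_even_power(2)[OF Ps_power(1) Ps_odd] Ps_even_hk[OF x y] ..
  note t_int = integral_even_power[where X = "\<lambda>t. t", OF integrable_gegen_power[OF mu_nonneg] integral_gegen_odd[OF mu_nonneg]]
  show "integrable (gegen_measure \<mu>) (\<lambda>t. LINT s|Ps. (zeta_arg x y u v s t) ^ (2 * m) / fact (2 * m))"
    unfolding inner by (intro Bochner_Integration.integrable_sum integrable_mult_left t_int(1))
  have "(LINT t|gegen_measure \<mu>. (LINT s|Ps. (zeta_arg x y u v s t) ^ (2 * m) / fact (2 * m))) =
    (\<Sum>k\<le>m. (LINT t|gegen_measure \<mu>. (X * u * v + W * t) ^ (2 * (m - k)) / fact (2 * (m - k))) * ((1 - u) ^ (2 * k) * (hk k x y / 4 ^ k)))"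
  proof -
    have "(LINT t|gegen_measure \<mu>. (LINT s|Ps. (zeta_arg x y u v s t) ^ (2 * m) / fact (2 * m))) =
      (\<Sum>k\<le>m. LINT t|gegen_measure \<mu>. (X * u * v + W * t) ^ (2 * (m - k)) / fact (2 * (m - k)) * ((1 - u) ^ (2 * k) * (hk k x y / 4 ^ k)))"
      unfolding inner by (intro Bochner_Integration.integral_sum integrable_mult_left t_int(1))
    thus ?thesis by (simp only: integral_mult_left_zero)
  qed
  also have "\<dots> = (\<Sum>k\<le>m. (\<Sum>b\<le>m - k. (X * u * v) ^ (2 * (m - k - b)) / fact (2 * (m - k - b)) *
      (W ^ (2 * b) * (1 / (4 ^ b * fact b * pochhammer M b)))) * ((1 - u) ^ (2 * k) * (hk k x y / 4 ^ k)))"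
    unfolding t_int(2) gegen_even_moment[OF mu_nonneg] M_def ..
  also have "\<dots> = (\<Sum>k\<le>m. \<Sum>b\<le>m - k. (coord_sum x * coord_sum y) ^ (m - k - b) / fact (2 * (m - k - b)) *
      (hk k x y / 4 ^ k) * (((1 - coord_sum x) * (1 - coord_sum y)) ^ b / (4 ^ b * fact b * pochhammer M b)) *
      (v ^ (2 * (m - k - b)) * (u ^ (2 * (m - k - b)) * (1 - u) ^ (2 * k))))"
    unfolding sum_distrib_right[of "f :: nat \<Rightarrow> real" for f] power_mult_distrib[of "_ * _"] power_mult_distrib[of X] X2 W2
    by (intro sum.cong refl) (simp add: mult_ac)
  finally show "(LINT t|gegen_measure \<mu>. (LINT s|Ps. (zeta_arg x y u v s t) ^ (2 * m) / fact (2 * m))) =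
    (\<Sum>k\<le>m. \<Sum>b\<le>m - k. (coord_sum x * coord_sum y) ^ (m - k - b) / fact (2 * (m - k - b)) *
      (hk k x y / 4 ^ k) * (((1 - coord_sum x) * (1 - coord_sum y)) ^ b / (4 ^ b * fact b * pochhammer M b)) *
      (v ^ (2 * (m - k - b)) * (u ^ (2 * (m - k - b)) * (1 - u) ^ (2 * k))))" .
qed

lemma u_integral:
  "set_integrable lborel {0..1} (\<lambda>u. u ^ (2 * a) * (1 - u) ^ (2 * k) * (u powr (\<nu> - 1) * (1 - u) powr (A - 1)))"
  "(LINT u:{0..1}|lborel. u ^ (2 * a) * (1 - u) ^ (2 * k) * (u powr (\<nu> - 1) * (1 - u) powr (A - 1))) =
    Beta \<nu> A * (pochhammer \<nu> (2 * a) * pochhammer A (2 * k) / pochhammer (A + \<nu>) (2 * (a + k)))"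
proof -
  have eq: "u ^ (2 * a) * (1 - u) ^ (2 * k) * (u powr (\<nu> - 1) * (1 - u) powr (A - 1)) =
      u powr ((\<nu> + real (2 * a)) - 1) * (1 - u) powr ((A + real (2 * k)) - 1)" if "u \<in> {0..1}" for u
  proof -
    have "u powr ((\<nu> + real (2 * a)) - 1) = u ^ (2 * a) * u powr (\<nu> - 1)"
      using powr_add_real_nat[of u "\<nu> - 1" "2 * a"] that by (simp add: algebra_simps)
    moreover have "(1 - u) powr ((A + real (2 * k)) - 1) = (1 - u) ^ (2 * k) * (1 - u) powr (A - 1)"
      using powr_add_real_nat[of "1 - u" "A - 1" "2 * k"] that by (simp add: algebra_simps)
    ultimately show ?thesis by simp
  qed
  have pos: "\<nu> + real (2 * a) > 0" "A + real (2 * k) > 0" using nu_pos A_pos by auto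
  show "set_integrable lborel {0..1} (\<lambda>u. u ^ (2 * a) * (1 - u) ^ (2 * k) * (u powr (\<nu> - 1) * (1 - u) powr (A - 1)))"
    using set_integral_Beta(1)[OF pos] eq by (subst set_integrable_cong[OF refl refl eq]) auto
  have "(LINT u:{0..1}|lborel. u ^ (2 * a) * (1 - u) ^ (2 * k) * (u powr (\<nu> - 1) * (1 - u) powr (A - 1))) =
      (LINT u:{0..1}|lborel. u powr ((\<nu> + real (2 * a)) - 1) * (1 - u) powr ((A + real (2 * k)) - 1))"
    using eq by (intro set_lebesgue_integral_cong) auto
  also have "\<dots> = Beta (\<nu> + real (2 * a)) (A + real (2 * k))" by (rule set_integral_Beta(2)[OF pos])
  also have "\<dots> = Beta \<nu> A * (pochhammer \<nu> (2 * a) * pochhammer A (2 * k) / pochhammer (A + \<nu>) (2 * (a + k)))"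
    using Beta_pochhammer[OF nu_pos A_pos, of "2 * a" "2 * k"] by (simp add: add.commute distrib_left)
  finally show "(LINT u:{0..1}|lborel. u ^ (2 * a) * (1 - u) ^ (2 * k) * (u powr (\<nu> - 1) * (1 - u) powr (A - 1))) =
    Beta \<nu> A * (pochhammer \<nu> (2 * a) * pochhammer A (2 * k) / pochhammer (A + \<nu>) (2 * (a + k)))" .
qed

text \<open>The weight in v is the Gegenbauer weight with parameter \<nu> + 1/2, up to its
  normalizing constant, so the moments are already known.\<close>

lemma v_integral:
  "set_integrable lborel {-1..1} (\<lambda>v. v ^ (2 * a) * (1 - v\<^sup>2) powr (\<nu> - 1 / 2))"
  "(LINT v:{-1..1}|lborel. v ^ (2 * a) * (1 - v\<^sup>2) powr (\<nu> - 1 / 2)) =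
    1 / gegen_const (\<nu> + 1 / 2) * (pochhammer (1 / 2) a / pochhammer (\<nu> + 1) a)"
proof -
  have pos: "\<nu> + 1 / 2 > 0" using nu_pos by simp
  have e: "\<nu> + 1 / 2 - 1 = \<nu> - 1 / 2" "\<nu> + 1 / 2 + 1 / 2 = \<nu> + 1" by simp_all
  show "set_integrable lborel {-1..1} (\<lambda>v. v ^ (2 * a) * (1 - v\<^sup>2) powr (\<nu> - 1 / 2))"
    unfolding set_integrable_def
  proof (rule Bochner_Integration.integrable_bound)
    show "integrable lborel (\<lambda>t. indicator {-1..1} t * (1 - t\<^sup>2) powr (\<nu> - 1 / 2))"
      using gegen_weight(1)[OF pos] unfolding e .
    have "\<bar>v ^ (2 * a)\<bar> \<le> 1" if "v \<in> {-1..1}" for v :: real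
      using that by (auto simp: power_abs intro!: power_le_one)
    thus "AE v in lborel. norm (indicator {-1..1} v *\<^sub>R (v ^ (2 * a) * (1 - v\<^sup>2) powr (\<nu> - 1 / 2)))
        \<le> norm (indicator {-1..1} v * (1 - v\<^sup>2) powr (\<nu> - 1 / 2))"
      by (intro AE_I2) (auto simp: abs_mult indicator_def intro!: mult_left_le_one_le)
  qed measurable
  have "gegen_const (\<nu> + 1 / 2) * (LINT v:{-1..1}|lborel. v ^ (2 * a) * (1 - v\<^sup>2) powr (\<nu> - 1 / 2)) =
      (LINT t|gegen_measure (\<nu> + 1 / 2). t ^ (2 * a))"
    by (subst integral_gegen_measure_pos[OF pos]) (simp_all add: e)
  also have "\<dots> = pochhammer (1 / 2) a / pochhammer (\<nu> + 1) a"
    using integral_gegen_even[of "\<nu> + 1 / 2" a] pos unfolding e by simp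
  finally have "gegen_const (\<nu> + 1 / 2) * (LINT v:{-1..1}|lborel. v ^ (2 * a) * (1 - v\<^sup>2) powr (\<nu> - 1 / 2)) =
      pochhammer (1 / 2) a / pochhammer (\<nu> + 1) a" .
  moreover have "I = 1 / g * R" if "g * I = R" "g > 0" for g I R :: real
    using that by (simp add: field_simps)
  ultimately show "(LINT v:{-1..1}|lborel. v ^ (2 * a) * (1 - v\<^sup>2) powr (\<nu> - 1 / 2)) =
    1 / gegen_const (\<nu> + 1 / 2) * (pochhammer (1 / 2) a / pochhammer (\<nu> + 1) a)"
    using gegen_const_pos[OF pos] by blast
qed

text \<open>The total mass of the weights in u and v; the measures in s and t have mass 1.\<close>

definition norm_const :: real where
  "norm_const = Beta \<nu> A / gegen_const (\<nu> + 1 / 2)"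

lemma norm_const_pos: "norm_const > 0"
  unfolding norm_const_def Beta_def using nu_pos A_pos
  by (intro divide_pos_pos mult_pos_pos Gamma_real_pos gegen_const_pos) auto

lemma G_eq:
  "G m x y = (\<Sum>k\<le>m. \<Sum>b\<le>m - k. theta (m - k - b) k / (fact b * pochhammer M b) *
     (coord_sum x * coord_sum y) ^ (m - k - b) * hk k x y * ((1 - coord_sum x) * (1 - coord_sum y)) ^ b)"
  unfolding G_def sum.Sigma[OF finite_atMost ballI[OF finite_atMost]]
  by (rule sum.reindex_bij_witness[of _ "\<lambda>(k, b). (m - b, m - k - b)" "\<lambda>(N, a). (N - a, m - N)"]) auto

theorem kernel_integral_eq:
  assumes x: "x \<in> simplexT" and y: "y \<in> simplexT"
  shows "kernel_integral \<kappa> \<mu> \<nu> n x y = norm_const * K n x y"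
proof -
  \<comment> \<open>One finite index set for the triple sum lets each integral be exchanged with the
    sum in a single step.\<close>
  define I where "I = (SIGMA m:{..n}. SIGMA k:{..m}. {..m - k})"
  define a where "a = (\<lambda>(m, k, b). m - k - b :: nat)"
  define kk where "kk = (\<lambda>(m :: nat, k, b :: nat). k :: nat)"
  define c where "c = (\<lambda>(m, k, b). ccoef n m * 4 ^ m * ((coord_sum x * coord_sum y) ^ (m - k - b) / fact (2 * (m - k - b)) *
      (hk k x y / 4 ^ k) * (((1 - coord_sum x) * (1 - coord_sum y)) ^ b / (4 ^ b * fact b * pochhammer M b))))"
  have fin: "finite I" by (simp add: I_def)
  have flat: "(\<Sum>m\<le>n. \<Sum>k\<le>m. \<Sum>b\<le>m - k. f (m, k, b)) = (\<Sum>i\<in>I. f i)" for f :: "nat \<times> nat \<times> nat \<Rightarrow> real"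
    unfolding I_def by (simp add: sum.Sigma)
  have inner: "(LINT t|gegen_measure \<mu>. (LINT s|Ps. poly (Xi_poly n (lambda_par \<kappa> \<mu> \<nu>)) (2 * (zeta_arg x y u v s t)\<^sup>2 - 1))) =
      (\<Sum>i\<in>I. c i * (v ^ (2 * a i) * (u ^ (2 * a i) * (1 - u) ^ (2 * kk i))))" for u v
  proof -
    have "(LINT t|gegen_measure \<mu>. (LINT s|Ps. poly (Xi_poly n (lambda_par \<kappa> \<mu> \<nu>)) (2 * (zeta_arg x y u v s t)\<^sup>2 - 1))) =
        (LINT t|gegen_measure \<mu>. (LINT s|Ps. (\<Sum>m\<le>n. ccoef n m * 4 ^ m * ((zeta_arg x y u v s t) ^ (2 * m) / fact (2 * m)))))"
      unfolding lam_def[symmetric] poly_Xi_lam ..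
    also have "\<dots> = (LINT t|gegen_measure \<mu>. (\<Sum>m\<le>n. ccoef n m * 4 ^ m * (LINT s|Ps. (zeta_arg x y u v s t) ^ (2 * m) / fact (2 * m))))"
    proof -
      have "(LINT s|Ps. (\<Sum>m\<le>n. ccoef n m * 4 ^ m * ((zeta_arg x y u v s t) ^ (2 * m) / fact (2 * m)))) =
          (\<Sum>m\<le>n. LINT s|Ps. ccoef n m * 4 ^ m * ((zeta_arg x y u v s t) ^ (2 * m) / fact (2 * m)))" for t
        by (intro Bochner_Integration.integral_sum integrable_mult_right inner_average(2)[OF x y])
      thus ?thesis by (simp only: integral_mult_right_zero)
    qed
    also have "\<dots> = (\<Sum>m\<le>n. ccoef n m * 4 ^ m * (LINT t|gegen_measure \<mu>. (LINT s|Ps. (zeta_arg x y u v s t) ^ (2 * m) / fact (2 * m))))"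
    proof -
      have "(LINT t|gegen_measure \<mu>. (\<Sum>m\<le>n. ccoef n m * 4 ^ m * (LINT s|Ps. (zeta_arg x y u v s t) ^ (2 * m) / fact (2 * m)))) =
          (\<Sum>m\<le>n. LINT t|gegen_measure \<mu>. ccoef n m * 4 ^ m * (LINT s|Ps. (zeta_arg x y u v s t) ^ (2 * m) / fact (2 * m)))"
        by (intro Bochner_Integration.integral_sum integrable_mult_right inner_average(3)[OF x y])
      thus ?thesis by (simp only: integral_mult_right_zero)
    qed
    also have "\<dots> = (\<Sum>m\<le>n. \<Sum>k\<le>m. \<Sum>b\<le>m - k. c (m, k, b) * (v ^ (2 * a (m, k, b)) * (u ^ (2 * a (m, k, b)) * (1 - u) ^ (2 * kk (m, k, b)))))"
      unfolding inner_average(1)[OF x y] sum_distrib_left[of _ "f :: nat \<Rightarrow> real" for f] c_def a_def kk_def by (simp add: mult.assoc)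
    also have "\<dots> = (\<Sum>i\<in>I. c i * (v ^ (2 * a i) * (u ^ (2 * a i) * (1 - u) ^ (2 * kk i))))"
      by (rule flat)
    finally show ?thesis .
  qed
  \<comment> \<open>The exponent of 1 - u in the theorem is A - 1, so the u-integral has Beta
    parameters \<nu> and A.\<close>
  have A1: "gamma_sum \<kappa> + (real CARD('d) - 2) / 2 = A - 1" by (simp add: A_def diff_divide_distrib)
  define B where "B = (\<lambda>i. Beta \<nu> A * (pochhammer \<nu> (2 * a i) * pochhammer A (2 * kk i) / pochhammer (A + \<nu>) (2 * (a i + kk i))))"
  have "kernel_integral \<kappa> \<mu> \<nu> n x y = (LINT v:{-1..1}|lborel. (LINT u:{0..1}|lborel.
      (\<Sum>i\<in>I. (c i * v ^ (2 * a i)) * (u ^ (2 * a i) * (1 - u) ^ (2 * kk i) * (u powr (\<nu> - 1) * (1 - u) powr (A - 1))))) *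
      (1 - v\<^sup>2) powr (\<nu> - 1 / 2))"
    unfolding kernel_integral_def inner A1 sum_distrib_right by (simp add: mult.assoc)
  also have "\<dots> = (LINT v:{-1..1}|lborel. (\<Sum>i\<in>I. (c i * B i) * (v ^ (2 * a i) * (1 - v\<^sup>2) powr (\<nu> - 1 / 2))))"
    unfolding set_integral_sum[OF fin u_integral(1)] u_integral(2) B_def sum_distrib_right
    by (simp add: mult_ac)
  also have "\<dots> = (\<Sum>i\<in>I. (c i * B i) * (1 / gegen_const (\<nu> + 1 / 2) * (pochhammer (1 / 2) (a i) / pochhammer (\<nu> + 1) (a i))))"
    unfolding set_integral_sum[OF fin v_integral(1)] v_integral(2) ..
  also have "\<dots> = (\<Sum>i\<in>I. norm_const * (case i of (m, k, b) \<Rightarrow> ccoef n m * (theta (m - k - b) k / (fact b * pochhammer M b) *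
     (coord_sum x * coord_sum y) ^ (m - k - b) * hk k x y * ((1 - coord_sum x) * (1 - coord_sum y)) ^ b)))"
  proof (intro sum.cong refl)
    fix i assume "i \<in> I"
    then obtain m k b where i: "i = (m, k, b)" and mkb: "k \<le> m" "b \<le> m - k" by (auto simp: I_def)
    define a' where "a' = m - k - b"
    have m: "m = a' + k + b" using mkb by (simp add: a'_def)
    have pos: "pochhammer (1 / 2 :: real) a' > 0" by (intro pochhammer_pos) simp
    \<comment> \<open>In (2a)! = 4^a (1/2)_a a! the power of 4 cancels, together with 4^k and 4^b,
      against 4^m, and (1/2)_a cancels against the v-moment. What remains is
      \<open>theta\<close>.\<close>
    show "(c i * B i) * (1 / gegen_const (\<nu> + 1 / 2) * (pochhammer (1 / 2) (a i) / pochhammer (\<nu> + 1) (a i))) =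
      norm_const * (case i of (m, k, b) \<Rightarrow> ccoef n m * (theta (m - k - b) k / (fact b * pochhammer M b) *
     (coord_sum x * coord_sum y) ^ (m - k - b) * hk k x y * ((1 - coord_sum x) * (1 - coord_sum y)) ^ b))"
      unfolding i c_def B_def a_def kk_def prod.case a'_def[symmetric] norm_const_def theta_def fact_double_real[of a']
      using pos by (simp add: m power_add field_simps)
  qed
  also have "\<dots> = norm_const * (\<Sum>m\<le>n. \<Sum>k\<le>m. \<Sum>b\<le>m - k. ccoef n m * (theta (m - k - b) k / (fact b * pochhammer M b) *
     (coord_sum x * coord_sum y) ^ (m - k - b) * hk k x y * ((1 - coord_sum x) * (1 - coord_sum y)) ^ b))"
    unfolding sum_distrib_left[symmetric] flat[symmetric] prod.case ..
  also have "\<dots> = norm_const * K n x y"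
    unfolding K_def G_eq sum_distrib_left[of _ "f :: nat \<Rightarrow> real" for f] ..
  finally show ?thesis .
qed

lemma K_0: "K 0 x y = 1"
proof -
  have "compositions 0 = {\<lambda>_ :: 'd. 0}" by (auto simp: compositions_def)
  hence "hk 0 x y = 1" by (simp add: hk_def hcoef_def xpow_def)
  thus ?thesis using lam_pos by (simp add: K_def G_def ccoef_def theta_def)
qed

lemma kernel_const_eq: "kernel_const \<kappa> \<mu> \<nu> = 1 / norm_const"
  unfolding kernel_const_def
proof (rule the_equality)
  show "\<forall>x\<in>simplexT. \<forall>y\<in>simplexT. 1 / norm_const * kernel_integral \<kappa> \<mu> \<nu> 0 x y = 1"
    using norm_const_pos by (simp add: kernel_integral_eq K_0)
  fix a assume a: "\<forall>x\<in>simplexT. \<forall>y\<in>simplexT. a * kernel_integral \<kappa> \<mu> \<nu> 0 x y = 1"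
  \<comment> \<open>A single point of the simplex determines the constant, since \<open>K 0\<close>
    is identically 1.\<close>
  have "(0 :: real^'d) \<in> simplexT" by (simp add: simplexT_def)
  with a have "a * norm_const = 1" using kernel_integral_eq[of 0 0 0] by (force simp: K_0)
  thus "a = 1 / norm_const" using norm_const_pos by (simp add: field_simps)
qed

end

theorem theorem4p2:
  fixes \<kappa> :: "real ^ 'd" and \<mu> \<nu> :: real
  assumes "CARD('d) \<ge> 2"
    and "\<And>i. \<kappa> $ i \<ge> 0"
    and "\<mu> \<ge> 0"
    and "\<nu> > 0"
  shows "\<forall>n. \<forall>x\<in>simplexT. \<forall>y\<in>simplexT.
    repr_kernel (U_weight \<kappa> \<mu> \<nu>) n x y = kernel_const \<kappa> \<mu> \<nu> * kernel_integral \<kappa> \<mu> \<nu> n x y"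
proof (intro allI ballI)
  fix n and x y :: "real ^ 'd"
  assume xy: "x \<in> simplexT" "y \<in> simplexT"
  interpret simplex_weight \<kappa> \<mu> \<nu>
    by unfold_locales (use assms in auto)
  show "repr_kernel (U_weight \<kappa> \<mu> \<nu>) n x y = kernel_const \<kappa> \<mu> \<nu> * kernel_integral \<kappa> \<mu> \<nu> n x y"
    using norm_const_pos by (simp add: repr_kernel_eq kernel_const_eq kernel_integral_eq[OF xy])
qed

end
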